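(* Consider the feedback loop of $N$ agents, a linear filter $\mathcal F$ and a linear controller $\mathcal C$ described in the context. Assume that each agent $i\in\{1,\dots,N\}$ has a state governed by the non-linear iterated function system $$x_i(k+1)=\mathcal W_{ij}(x_i(k)),\qquad y_i(k)=\mathcal H_{i\ell}(x_i(k)),$$ where $\mathcal W_{ij}$ ($j=1,\dots,w_i$) and $\mathcal H_{i\ell}$ ($\ell=1,\dots,h_i$) are globally Lipschitz-continuous functions with global Lipschitz constants $l_{ij}$, respectively $l'_{i\ell}$. Assume we have Dini continuous probability functions $p_{ij},p'_{i\ell}:\Pi\to[0,1]$ so that $$\mathbb P\big(x_i(k+1)=\mathcal W_{ij}(x_i(k))\big)=p_{ij}(\pi(k)),\qquad \mathbb P\big(y_i(k)=\mathcal H_{i\ell}(x_i(k))\big)=p'_{i\ell}(\pi(k)),$$ and $\sum_{j=1}^{w_i}p_{ij}(\pi)=\sum_{\ell=1}^{h_i}p'_{i\ell}(\pi)=1$ for all $\pi\in\Pi$ and all $i$. Assume furthermore that there are scalars $\delta,\delta'>0$ such that $p_{ij}(\pi)\ge\delta>0$ for all $(i,j)$ and $p'_{i\ell}(\pi)\ge\delta'>0$ for all $(i,\ell)$ and all $\pi\in\Pi$. Further, assume that the following contractivity condition holds: $l_{ij}<1$ for all $1\le i\le N$, $1\le j\le w_i$. Then, for every stable linear controller $\mathcal C$ and every stable linear filter $\mathcal F$ compatible with the feedback structure, the feedback loop has a unique attractive invariant measure. In particular, the system is uniquely ergodic.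
   Context: Closed loop (discrete time). Agent $i$ has state space $\mathbb X_i$, a closed subset of $\mathbb R^{n_i}$, with finitely many maps $\mathcal W_{ij}:\mathbb X_i\to\mathbb X_i$ and $\mathcal H_{i\ell}:\mathbb X_i\to\mathbb R$. The aggregate output is $y(k)=\sum_{i=1}^N y_i(k)$. The linear filter is $$\mathcal F:\quad x_f(k+1)=A_fx_f(k)+B_fy(k),\qquad \hat y(k)=C_fx_f(k),\qquad x_f(k)\in\mathbb R^{n_f}.$$ The error is $e(k)=r-\hat y(k)$ with $r$ a constant reference value. The linear controller is $$\mathcal C:\quad x_c(k+1)=A_cx_c(k)+B_ce(k),\qquad \pi(k)=C_cx_c(k)+D_ce(k),\qquad x_c(k)\in\mathbb R^{n_c}.$$ Signals $y,\hat y,e,\pi$ are scalar, and matrices have compatible dimensions. $\Pi\subseteq\mathbb R$ is the set of admissible broadcast signals, containing all values of $\pi(k)$. "Stable" controller/filter means that $A_c$, respectively $A_f$, is Schur (all eigenvalues in the open unit disc). Conditioned on the current overall state (hence on $\pi(k)$), the choices of the transition maps and output maps of all agents at time $k$ are stochastically independent, so the joint choice of $\mathcal W_{ij_i},\mathcal H_{i\ell_i}$, $i=1,\dots,N$, has probability $\prod_i p_{ij_i}(\pi(k))\prod_i p'_{i\ell_i}(\pi(k))$. The closed loop is thus a time-homogeneous Markov chain $X(k)$ on $\mathbb X=\prod_{i=1}^N\mathbb X_i\times\mathbb R^{n_f}\times\mathbb R^{n_c}$. A function $p$ is Dini continuous if its modulus of continuity $\omega(t)=\sup_{|s-s'|\le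 t}|p(s)-p(s')|$ satisfies $\int_0^{1}\omega(t)/t\,dt<\infty$. An invariant probability measure $\mu$ is attractive if, for every initial probability distribution, the law of $X(k)$ converges to $\mu$ in distribution. The system is called uniquely ergodic if it has an attractive, unique, ergodic, invariant probability measure $\mu$ such that for every deterministic initial condition $x_0\in\mathbb X$ and every continuous $g:\mathbb X\to\mathbb R$, $$\lim_{k\to\infty}\frac1{k+1}\sum_{\nu=0}^k g(X(\nu))=\mathbb E_\mu(g)$$ almost surely (with respect to the path measure started at $x_0$). *)

theory Defs
  imports "HOL-Probability.Probability"
begin

text \<open>
  The state dimension of an agent varies with the agent, so it cannot be a type. The space
  $R^n$ is therefore the carrier of \<^const>\<open>Euclidean_space\<close> \<open>n\<close>, i.e. the sequences vanishing from
  index \<open>n\<close> on. The metric of the type \<open>nat \<Rightarrow> real\<close> is not the Euclidean one (only the topology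
  agrees), hence the explicit distance.
\<close>

definition euclidean_dist :: "nat \<Rightarrow> (nat \<Rightarrow> real) \<Rightarrow> (nat \<Rightarrow> real) \<Rightarrow> real" where
  "euclidean_dist n x y = L2_set (\<lambda>m. x m - y m) {..<n}"

definition lipschitz_map_on ::
    "nat \<Rightarrow> real \<Rightarrow> (nat \<Rightarrow> real) set \<Rightarrow> ((nat \<Rightarrow> real) \<Rightarrow> (nat \<Rightarrow> real)) \<Rightarrow> bool" where
  "lipschitz_map_on n L S f \<longleftrightarrow>
     0 \<le> L \<and> (\<forall>x\<in>S. \<forall>y\<in>S. euclidean_dist n (f x) (f y) \<le> L * euclidean_dist n x y)"

definition lipschitz_fun_on ::
    "nat \<Rightarrow> real \<Rightarrow> (nat \<Rightarrow> real) set \<Rightarrow> ((nat \<Rightarrow> real) \<Rightarrow> real) \<Rightarrow> bool" where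
  "lipschitz_fun_on n L S f \<longleftrightarrow>
     0 \<le> L \<and> (\<forall>x\<in>S. \<forall>y\<in>S. \<bar>f x - f y\<bar> \<le> L * euclidean_dist n x y)"

definition modulus_of_continuity :: "real set \<Rightarrow> (real \<Rightarrow> real) \<Rightarrow> real \<Rightarrow> ennreal" where
  "modulus_of_continuity D f t =
     (SUP (s, s') \<in> {(s, s'). s \<in> D \<and> s' \<in> D \<and> \<bar>s - s'\<bar> \<le> t}. ennreal \<bar>f s - f s'\<bar>)"

definition dini_continuous_on :: "real set \<Rightarrow> (real \<Rightarrow> real) \<Rightarrow> bool" where
  "dini_continuous_on D f \<longleftrightarrow>
     (\<integral>\<^sup>+ t \<in> {0<..1}. (modulus_of_continuity D f t / ennreal t) \<partial>lborel) < \<infinity>"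

definition schur :: "real ^ 'n ^ 'n \<Rightarrow> bool" where
  "schur A \<longleftrightarrow>
     (\<forall>z v. v \<noteq> 0 \<and> map_matrix complex_of_real A *v v = z *s v \<longrightarrow> cmod z < 1)"

text \<open>
  The law on trajectories of the time-homogeneous Markov chain on \<open>S\<close> with transition kernel \<open>K\<close>
  and initial law \<open>\<nu>\<close>, as given by the Ionescu-Tulcea theorem: the coordinate at time \<open>0\<close> has law
  \<open>\<nu>\<close>, and given the coordinates up to time \<open>m\<close>, the one at time \<open>Suc m\<close> has law \<open>K (\<omega> m)\<close>.
\<close>

definition path_measure ::
    "'a measure \<Rightarrow> ('a \<Rightarrow> 'a measure) \<Rightarrow> 'a measure \<Rightarrow> (nat \<Rightarrow> 'a) measure" where
  "path_measure S K \<nu> =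
     projective_family.lim UNIV
       (Ionescu_Tulcea.CI (\<lambda>k \<omega>. case k of 0 \<Rightarrow> \<nu> | Suc m \<Rightarrow> K (\<omega> m)) (\<lambda>_. S)) (\<lambda>_. S)"

definition invariant_measure ::
    "'a measure \<Rightarrow> ('a \<Rightarrow> 'a measure) \<Rightarrow> 'a measure \<Rightarrow> bool" where
  "invariant_measure S K \<mu> \<longleftrightarrow> \<mu> \<in> space (prob_algebra S) \<and> \<mu> \<bind> K = \<mu>"

definition ergodic_measure ::
    "'a measure \<Rightarrow> ('a \<Rightarrow> 'a measure) \<Rightarrow> 'a measure \<Rightarrow> bool" where
  "ergodic_measure S K \<mu> \<longleftrightarrow>
     (\<forall>A\<in>sets S. (AE x in \<mu>. x \<in> A \<longrightarrow> emeasure (K x) A = 1) \<longrightarrow>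
        emeasure \<mu> A = 0 \<or> emeasure \<mu> A = 1)"

definition converges_in_distribution ::
    "'a::topological_space set \<Rightarrow> (nat \<Rightarrow> 'a measure) \<Rightarrow> 'a measure \<Rightarrow> bool" where
  "converges_in_distribution X \<mu>s \<mu> \<longleftrightarrow>
     (\<forall>f :: 'a \<Rightarrow> real. continuous_on X f \<and> bounded (f ` X) \<longrightarrow>
        (\<lambda>k. \<integral>x. f x \<partial>\<mu>s k) \<longlonglongrightarrow> (\<integral>x. f x \<partial>\<mu>))"

definition attractive_measure ::
    "'a::topological_space set \<Rightarrow> ('a \<Rightarrow> 'a measure) \<Rightarrow> 'a measure \<Rightarrow> bool" where
  "attractive_measure X K \<mu> \<longleftrightarrow>
     (let S = restrict_space borel X in
        \<forall>\<nu>\<in>space (prob_algebra S).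
          converges_in_distribution X (\<lambda>k. distr (path_measure S K \<nu>) S (\<lambda>\<omega>. \<omega> k)) \<mu>)"

definition uniquely_ergodic ::
    "'a::topological_space set \<Rightarrow> ('a \<Rightarrow> 'a measure) \<Rightarrow> bool" where
  "uniquely_ergodic X K \<longleftrightarrow>
     (let S = restrict_space borel X in
        \<exists>\<mu>. invariant_measure S K \<mu> \<and>
            attractive_measure X K \<mu> \<and>
            (\<forall>\<mu>'. invariant_measure S K \<mu>' \<longrightarrow> \<mu>' = \<mu>) \<and>
            ergodic_measure S K \<mu> \<and>
            (\<forall>x0\<in>X. \<forall>g :: 'a \<Rightarrow> real. continuous_on X g \<longrightarrow>
               integrable \<mu> g \<and>
               (AE \<omega> in path_measure S K (return S x0).
                  (\<lambda>k. (\<Sum>\<nu>\<le>k. g (\<omega> \<nu>)) / real (k + 1)) \<longlonglongrightarrow> (\<integral>x. g x \<partial>\<mu>))))"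

text \<open>
  The agents are the elements of a finite type \<open>'i\<close>; agent \<open>i\<close> has transition maps indexed by
  \<open>{1..trans_count E i}\<close> and output maps indexed by \<open>{1..out_count E i}\<close>. The signals into and out
  of the filter and the controller are scalar, so the matrices $B$ and $C$ are plain vectors.
\<close>

record 'i ensemble =
  state_dim :: "'i \<Rightarrow> nat"
  agent_space :: "'i \<Rightarrow> (nat \<Rightarrow> real) set"
  trans_count :: "'i \<Rightarrow> nat"
  trans_map :: "'i \<Rightarrow> nat \<Rightarrow> (nat \<Rightarrow> real) \<Rightarrow> (nat \<Rightarrow> real)"
  trans_prob :: "'i \<Rightarrow> nat \<Rightarrow> real \<Rightarrow> real"
  out_count :: "'i \<Rightarrow> nat"
  out_map :: "'i \<Rightarrow> nat \<Rightarrow> (nat \<Rightarrow> real) \<Rightarrow> real"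
  out_prob :: "'i \<Rightarrow> nat \<Rightarrow> real \<Rightarrow> real"

record ('f::finite) linear_filter =
  A_f :: "real ^ 'f ^ 'f"
  B_f :: "real ^ 'f"
  C_f :: "real ^ 'f"

record ('c::finite) linear_controller =
  A_c :: "real ^ 'c ^ 'c"
  B_c :: "real ^ 'c"
  C_c :: "real ^ 'c"
  D_c :: real

type_synonym ('i, 'f, 'c) loop_state = "('i \<Rightarrow> nat \<Rightarrow> real) \<times> (real ^ 'f) \<times> (real ^ 'c)"

definition loop_space :: "'i ensemble \<Rightarrow> ('i, 'f::finite, 'c::finite) loop_state set" where
  "loop_space E = {(x, xf, xc). \<forall>i. x i \<in> agent_space E i}"

definition error_signal ::
    "'f::finite linear_filter \<Rightarrow> real \<Rightarrow> ('i, 'f, 'c::finite) loop_state \<Rightarrow> real" where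
  "error_signal F r = (\<lambda>(x, xf, xc). r - C_f F \<bullet> xf)"

definition broadcast_signal ::
    "'f::finite linear_filter \<Rightarrow> 'c::finite linear_controller \<Rightarrow> real \<Rightarrow>
     ('i, 'f, 'c) loop_state \<Rightarrow> real" where
  "broadcast_signal F C r = (\<lambda>(x, xf, xc).
     C_c C \<bullet> xc + D_c C * error_signal F r (x, xf, xc))"

definition loop_step ::
    "'i::finite ensemble \<Rightarrow> 'f::finite linear_filter \<Rightarrow> 'c::finite linear_controller \<Rightarrow> real \<Rightarrow>
     ('i \<Rightarrow> nat) \<Rightarrow> ('i \<Rightarrow> nat) \<Rightarrow> ('i, 'f, 'c) loop_state \<Rightarrow> ('i, 'f, 'c) loop_state" where
  "loop_step E F C r js ls = (\<lambda>(x, xf, xc).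
     (\<lambda>i. trans_map E i (js i) (x i),
      A_f F *v xf + (\<Sum>i\<in>UNIV. out_map E i (ls i) (x i)) *\<^sub>R B_f F,
      A_c C *v xc + error_signal F r (x, xf, xc) *\<^sub>R B_c C))"

definition joint_choices :: "'i ensemble \<Rightarrow> (('i \<Rightarrow> nat) \<times> ('i \<Rightarrow> nat)) set" where
  "joint_choices E =
     (\<Pi>\<^sub>E i\<in>UNIV. {1..trans_count E i}) \<times> (\<Pi>\<^sub>E i\<in>UNIV. {1..out_count E i})"

definition joint_choice_prob ::
    "'i::finite ensemble \<Rightarrow> real \<Rightarrow> ('i \<Rightarrow> nat) \<times> ('i \<Rightarrow> nat) \<Rightarrow> real" where
  "joint_choice_prob E s = (\<lambda>(js, ls).
     (\<Prod>i\<in>UNIV. trans_prob E i (js i) s) * (\<Prod>i\<in>UNIV. out_prob E i (ls i) s))"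

definition loop_kernel ::
    "'i::finite ensemble \<Rightarrow> 'f::finite linear_filter \<Rightarrow> 'c::finite linear_controller \<Rightarrow> real \<Rightarrow>
     ('i, 'f, 'c) loop_state \<Rightarrow> ('i, 'f, 'c) loop_state measure" where
  "loop_kernel E F C r z =
     distr (point_measure (joint_choices E)
              (\<lambda>c. ennreal (joint_choice_prob E (broadcast_signal F C r z) c)))
           (restrict_space borel (loop_space E))
           (\<lambda>(js, ls). loop_step E F C r js ls z)"

end

theory Submission
  imports Defs "HOL-Library.Discrete_Functions" "HOL-Computational_Algebra.Fundamental_Theorem_Algebra"
begin

text \<open>
  For given choices of the maps the loop contains no feedback: the agents drive the filter, the
  filter drives the controller, and the broadcast signal acts on the agents through the
  probabilities of the choices alone. In a suitable metric every joint choice of maps is therefore a contraction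
  with one common factor $q < 1$. A Schur matrix $A$ contracts the norm
  $N(v) = \sum_n \| A^n v \|$, since $N(Av) = N(v) - \|v\|$ and $N \le c \|\cdot\|$ in finite
  dimension (\<open>lyapunov_norm_contraction\<close>); a weighted sum of the agents' distances and of the two
  norms $N$ absorbs the couplings of the triangular system (\<open>loop_steps_contract\<close>). The loop is thus
  an iterated function system with finitely many contractions $w_j$ on a proper metric space, whose
  probabilities $p_j$ are bounded below and vary summably along every geometric sequence of
  distances; the last property is what Dini continuity gives (\<open>dini_summable\<close>).

  For such systems let $Pf(x) = \sum_j p_j(x) f(w_j x)$. Two chains at distance $t$ can be moved by the
  same map with probability at least $1 - e(t)$, which brings them to distance $q t$. As
  $\sum_k e(q^k D) < \infty$ and $e$ stays away from $1$, they make equal choices forever with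
  probability at least $\theta > 0$. Hence, on every large ball, the oscillation of $P^n f$ tends to
  $0$ (\<open>synchronisation\<close>, \<open>transfer_iter_osc_tendsto_0\<close>), and $P^n f$ converges uniformly there to a
  constant $\Lambda f$ for every continuous $f$ (\<open>transfer_iter_uniform_limit\<close>).

  The functional $\Lambda$ is integration against a probability measure
  (\<open>limit_value_representation\<close>). This measure is the law of a random point: the last $n$ moves of the
  chain in the distant future spell a word $s$ with a limiting probability, these probabilities are
  consistent in $n$, and so they define a random word growing into the past. The images of a
  ball under longer and longer words shrink to a point, whose law represents $\Lambda$.

  Everything else follows from $P^n f \to \Lambda f$. Integrating against an initial law gives
  attractivity, and comparing the integrals of continuous functions gives invariance and uniqueness.
  An absorbing set of intermediate measure would produce a second invariant measure, namely the
  normalised restriction, so the measure is ergodic. For the time averages, the sums of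
  $g(X_{k+1}) - Pg(X_k)$ have orthogonal increments, so their averages vanish almost surely; hence
  the averages of $g$ and of $P^m g$ agree in the limit, and $P^m g$ is uniformly close to
  $\Lambda g$ on the bounded set which the trajectory never leaves (\<open>time_averages_tendsto\<close>).
\<close>

section \<open>Trajectories of a Markov chain\<close>

lemma integral_bind_bounded:
  fixes f :: "'b \<Rightarrow> real"
  assumes "prob_space M" and N[measurable]: "N \<in> M \<rightarrow>\<^sub>M prob_algebra L"
    and f[measurable]: "f \<in> borel_measurable L" and bd: "\<And>x. x \<in> space L \<Longrightarrow> \<bar>f x\<bar> \<le> B"
  shows "(\<integral>x. f x \<partial>(M \<bind> N)) = (\<integral>x. \<integral>y. f y \<partial>N x \<partial>M)"
proof -
  interpret M: prob_space M by fact
  have N': "N \<in> M \<rightarrow>\<^sub>M subprob_algebra L" using N by (rule measurable_prob_algebraD)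
  have "AE x in M. emeasure (N x) (space (N x)) \<le> ennreal 1"
    using measurable_space[OF N]
    by (intro AE_I2) (auto simp: space_prob_algebra prob_space.emeasure_space_1)
  moreover have "AE x in M \<bind> N. \<bar>f x\<bar> \<le> B"
    using bd by (intro AE_I2) (simp add: space_bind_measurable[OF N'] M.not_empty)
  ultimately show ?thesis
    using f N' by (intro integral_bind[where K=L and B'=1 and B=B]) (auto simp: M.finite_measure_axioms bd)
qed

locale markov_kernel =
  fixes S :: "'a measure" and K :: "'a \<Rightarrow> 'a measure"
  assumes K[measurable]: "K \<in> S \<rightarrow>\<^sub>M prob_algebra S"
begin

lemma prob_space_K: "x \<in> space S \<Longrightarrow> prob_space (K x)"
  and sets_K: "x \<in> space S \<Longrightarrow> sets (K x) = sets S"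
  and space_K: "x \<in> space S \<Longrightarrow> space (K x) = space S"
  using measurable_space[OF K] by (auto simp: space_prob_algebra dest: sets_eq_imp_space_eq)

lemma K_sub[measurable]: "K \<in> S \<rightarrow>\<^sub>M subprob_algebra S"
  by (rule measurable_prob_algebraD[OF K])

definition kernel_op :: "('a \<Rightarrow> real) \<Rightarrow> 'a \<Rightarrow> real" where
  "kernel_op f x = (\<integral>y. f y \<partial>K x)"

lemma kernel_op_measurable[measurable]:
  assumes [measurable]: "f \<in> borel_measurable S"
  shows "kernel_op f \<in> borel_measurable S"
  unfolding kernel_op_def by measurable

lemma kernel_op_bounded:
  assumes [measurable]: "f \<in> borel_measurable S" and bd: "\<And>x. x \<in> space S \<Longrightarrow> \<bar>f x\<bar> \<le> B"
    and x: "x \<in> space S"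
  shows "\<bar>kernel_op f x\<bar> \<le> B"
proof -
  interpret prob_space "K x" using x by (rule prob_space_K)
  have "integrable (K x) f"
    using bd by (intro integrable_const_bound[of _ B])
      (auto simp: space_K[OF x] measurable_cong_sets[OF sets_K[OF x]] intro!: AE_I2)
  have "norm (\<integral>y. f y \<partial>K x) \<le> (\<integral>y. norm (f y) \<partial>K x)"
    by (rule integral_norm_bound)
  also have "\<dots> \<le> (\<integral>y. B \<partial>K x)"
    using \<open>integrable (K x) f\<close> bd by (intro integral_mono) (auto simp: space_K[OF x])
  finally show ?thesis by (simp add: kernel_op_def prob_space)
qed

lemma integral_bind_kernel:
  assumes \<nu>: "\<nu> \<in> space (prob_algebra S)" and f: "f \<in> borel_measurable S"
    and fb: "\<And>x. x \<in> space S \<Longrightarrow> \<bar>f x\<bar> \<le> B"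
  shows "(\<integral>x. f x \<partial>(\<nu> \<bind> K)) = (\<integral>x. kernel_op f x \<partial>\<nu>)"
proof -
  have "prob_space \<nu>" and sets_\<nu>: "sets \<nu> = sets S" using \<nu> by (simp_all add: space_prob_algebra)
  moreover have "K \<in> \<nu> \<rightarrow>\<^sub>M prob_algebra S"
    by (subst measurable_cong_sets[OF sets_\<nu> refl]) (rule K)
  ultimately show ?thesis
    unfolding kernel_op_def using fb by (intro integral_bind_bounded[OF _ _ f])
qed

context
  fixes \<nu> assumes \<nu>: "\<nu> \<in> space (prob_algebra S)"
begin

abbreviation (input) "transition \<equiv> (\<lambda>k \<omega>. case k of 0 \<Rightarrow> \<nu> | Suc m \<Rightarrow> K (\<omega> m))"

lemma sets_\<nu>: "sets \<nu> = sets S"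
  using \<nu> by (auto simp: space_prob_algebra)

lemma transition_prob_algebra:
  "transition i \<in> PiM {0..<i} (\<lambda>_. S) \<rightarrow>\<^sub>M prob_algebra S"
proof (cases i)
  case 0
  then show ?thesis using \<nu> by simp
next
  case (Suc m)
  have "(\<lambda>\<omega>. \<omega> m) \<in> PiM {0..<Suc m} (\<lambda>_. S) \<rightarrow>\<^sub>M S"
    by (rule measurable_component_singleton) simp
  from measurable_compose[OF this K] show ?thesis using Suc by simp
qed

lemma Ionescu_Tulcea_transition: "Ionescu_Tulcea transition (\<lambda>_. S)"
  unfolding Ionescu_Tulcea_def
proof (intro conjI allI impI)
  show "transition i \<in> PiM {0..<i} (\<lambda>_. S) \<rightarrow>\<^sub>M subprob_algebra S" for i
    by (rule measurable_prob_algebraD[OF transition_prob_algebra])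
  show "prob_space (transition i x)" if "x \<in> space (PiM {0..<i} (\<lambda>_. S))" for i and x
    using measurable_space[OF transition_prob_algebra that] by (simp only: space_prob_algebra mem_Collect_eq)
qed

interpretation IT: Ionescu_Tulcea transition "\<lambda>_. S"
  by (rule Ionescu_Tulcea_transition)

lemma path_measure_eq: "path_measure S K \<nu> = IT.PF.lim"
  by (simp add: path_measure_def)

lemma sets_path[simp, measurable_cong]: "sets (path_measure S K \<nu>) = sets (PiM UNIV (\<lambda>_. S))"
  and space_path[simp]: "space (path_measure S K \<nu>) = space (PiM UNIV (\<lambda>_. S))"
  by (simp_all add: path_measure_eq)

lemma path_coordinate_in: "\<omega> \<in> space (path_measure S K \<nu>) \<Longrightarrow> \<omega> k \<in> space S"
  by (simp add: space_PiM PiE_iff)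

text \<open>
  Trajectories are built by the Ionescu-Tulcea theorem from the iterates \<open>C 0 n\<close>, the joint laws of
  the first \<open>n\<close> coordinates. Statements about finitely many coordinates are moved to these iterates,
  which satisfy a recursion in \<open>n\<close>.
\<close>

lemma distr_path_restrict:
  "distr (path_measure S K \<nu>) (PiM {0..<n} (\<lambda>_. S)) (\<lambda>\<omega>. restrict \<omega> {0..<n})
    = IT.C 0 n (\<lambda>_. undefined)"
proof -
  have "\<not> IT.up_to {0..<n} < n"
    using IT.up_to_less[of "{0..<n}" "IT.up_to {0..<n}"] by auto
  then have "IT.up_to {0..<n} = n"
    by (intro antisym) (auto simp: IT.up_to_iff)
  then have "IT.CI {0..<n} = IT.C 0 n (\<lambda>_. undefined)"
    using IT.distr_C[of n n "\<lambda>_. undefined" 0] by (simp add: IT.CI_def)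
  then show ?thesis
    using IT.distr_lim[of "{0..<n}"] by (simp add: path_measure_eq)
qed

lemma prob_space_path: "prob_space (path_measure S K \<nu>)"
proof -
  have "prob_space (IT.C 0 0 (\<lambda>_. undefined))"
    by (rule IT.prob_space_C) (simp add: space_PiM)
  then have "prob_space (distr (path_measure S K \<nu>) (PiM {0..<0} (\<lambda>_. S)) (\<lambda>\<omega>. restrict \<omega> {0..<0}))"
    by (simp only: distr_path_restrict)
  then show ?thesis
    by (rule prob_space_distrD[rotated]) (auto intro!: measurable_restrict)
qed

lemma law_0: "distr (path_measure S K \<nu>) S (\<lambda>\<omega>. \<omega> 0) = \<nu>"
proof -
  have emp: "(\<lambda>_. undefined) \<in> space (PiM {0..<0::nat} (\<lambda>_. S))"
    by (simp add: space_PiM)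
  have r: "(\<lambda>\<omega>. restrict \<omega> {0..<Suc 0}) \<in> path_measure S K \<nu> \<rightarrow>\<^sub>M PiM {0..<Suc 0} (\<lambda>_. S)"
    by (auto intro!: measurable_restrict)
  have c: "(\<lambda>\<omega>. \<omega> 0) \<in> PiM {0..<Suc 0} (\<lambda>_. S) \<rightarrow>\<^sub>M S"
    by (rule measurable_component_singleton) simp
  have "distr (path_measure S K \<nu>) S (\<lambda>\<omega>. \<omega> 0)
      = distr (distr (path_measure S K \<nu>) (PiM {0..<Suc 0} (\<lambda>_. S)) (\<lambda>\<omega>. restrict \<omega> {0..<Suc 0})) S (\<lambda>\<omega>. \<omega> 0)"
    by (subst distr_distr[OF c r]) (simp add: comp_def)
  also have "\<dots> = distr (IT.C 0 (Suc 0) (\<lambda>_. undefined)) S (\<lambda>\<omega>. \<omega> 0)"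
    by (simp only: distr_path_restrict)
  also have "IT.C 0 (Suc 0) (\<lambda>_. undefined) = IT.eP 0 (\<lambda>_. undefined)"
    using bind_return[OF IT.measurable_eP[of 0] emp] by simp
  also have "distr (IT.eP 0 (\<lambda>_. undefined)) S (\<lambda>\<omega>. \<omega> 0) = distr \<nu> S (\<lambda>x. x)"
    unfolding IT.eP_def using sets_\<nu> emp
    by (subst distr_distr[OF c]) (auto simp: comp_def intro!: measurable_fun_upd[where J="{0..<0}"] cong: measurable_cong_sets)
  also have "\<dots> = \<nu>"
    using sets_\<nu> by (simp add: distr_id2)
  finally show ?thesis .
qed

text \<open>
  The Markov property in the form in which it is used throughout. The joint law of one more
  coordinate arises by a kernel step from the last known coordinate, so integrating out the new
  coordinate turns \<open>f\<close> into \<open>kernel_op f\<close> while the past \<open>h\<close> passes through as a factor.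
\<close>

lemma path_integral_step:
  fixes h :: "(nat \<Rightarrow> 'a) \<Rightarrow> real"
  assumes h: "h \<in> borel_measurable (PiM {0..<Suc n} (\<lambda>_. S))"
    and hb: "\<And>\<omega>. \<omega> \<in> space (PiM {0..<Suc n} (\<lambda>_. S)) \<Longrightarrow> \<bar>h \<omega>\<bar> \<le> B"
    and f[measurable]: "f \<in> borel_measurable S" and fb: "\<And>x. x \<in> space S \<Longrightarrow> \<bar>f x\<bar> \<le> B'"
  shows "(\<integral>\<omega>. h (restrict \<omega> {0..<Suc n}) * f (\<omega> (Suc n)) \<partial>path_measure S K \<nu>)
       = (\<integral>\<omega>. h (restrict \<omega> {0..<Suc n}) * kernel_op f (\<omega> n) \<partial>path_measure S K \<nu>)"
proof -
  let ?P = "\<lambda>m. PiM {0..<m} (\<lambda>_. S)" and ?u = "\<lambda>_::nat. undefined :: 'a"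
  have r[measurable]: "(\<lambda>\<omega>. restrict \<omega> {0..<m}) \<in> path_measure S K \<nu> \<rightarrow>\<^sub>M ?P m" for m
    by (auto intro!: measurable_restrict)
  have rr[measurable]: "(\<lambda>\<omega>. restrict \<omega> {0..<Suc n}) \<in> ?P (Suc (Suc n)) \<rightarrow>\<^sub>M ?P (Suc n)"
    by (auto intro!: measurable_restrict)
  note h[measurable]
  have emp: "?u \<in> space (PiM {0..<0} (\<lambda>_. S))"
    by (simp add: space_PiM)
  define \<Phi> where "\<Phi> \<omega> = h (restrict \<omega> {0..<Suc n}) * f (\<omega> (Suc n))" for \<omega>
  have c[measurable]: "(\<lambda>\<omega>. \<omega> (Suc n)) \<in> ?P (Suc (Suc n)) \<rightarrow>\<^sub>M S" "(\<lambda>\<omega>. \<omega> n) \<in> ?P (Suc n) \<rightarrow>\<^sub>M S"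
    by (auto intro!: measurable_component_singleton)
  have \<Phi>[measurable]: "\<Phi> \<in> borel_measurable (?P (Suc (Suc n)))"
    unfolding \<Phi>_def by measurable
  have rsp: "restrict \<omega> {0..<Suc n} \<in> space (?P (Suc n))" if "\<omega> \<in> space (?P (Suc (Suc n)))" for \<omega>
    using measurable_space[OF rr that] .
  have \<Phi>b: "\<bar>\<Phi> \<omega>\<bar> \<le> B * B'" if "\<omega> \<in> space (?P (Suc (Suc n)))" for \<omega>
    unfolding \<Phi>_def abs_mult using hb[OF rsp[OF that]] fb[OF measurable_space[OF c(1) that]]
    by (intro mult_mono) auto
  have "(\<integral>\<omega>. \<Phi> \<omega> \<partial>path_measure S K \<nu>) = (\<integral>\<omega>. \<Phi> (restrict \<omega> {0..<Suc (Suc n)}) \<partial>path_measure S K \<nu>)"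
    by (intro Bochner_Integration.integral_cong) (auto simp: \<Phi>_def min_def)
  also have "\<dots> = (\<integral>\<omega>. \<Phi> \<omega> \<partial>IT.C 0 (Suc (Suc n)) ?u)"
    unfolding distr_path_restrict[symmetric] by (subst integral_distr) auto
  also have "\<dots> = (\<integral>\<omega>. \<Phi> \<omega> \<partial>(IT.C 0 (Suc n) ?u \<bind> IT.eP (Suc n)))"
    by simp
  also have "\<dots> = (\<integral>\<omega>. \<integral>y. \<Phi> y \<partial>IT.eP (Suc n) \<omega> \<partial>IT.C 0 (Suc n) ?u)"
  proof (rule integral_bind_bounded[OF _ _ \<Phi> \<Phi>b])
    show "prob_space (IT.C 0 (Suc n) ?u)" by (rule IT.prob_space_C[OF emp])
    have "IT.eP (Suc n) \<in> ?P (Suc n) \<rightarrow>\<^sub>M prob_algebra (?P (Suc (Suc n)))"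
      by (intro measurable_prob_algebraI IT.measurable_eP IT.prob_space_eP)
    then show "IT.eP (Suc n) \<in> IT.C 0 (Suc n) ?u \<rightarrow>\<^sub>M prob_algebra (?P (Suc (Suc n)))"
      by (subst measurable_cong_sets[OF IT.sets_C[OF emp, of "Suc n"] refl]) simp
  qed
  also have "\<dots> = (\<integral>\<omega>. h \<omega> * kernel_op f (\<omega> n) \<partial>IT.C 0 (Suc n) ?u)"
  proof (rule Bochner_Integration.integral_cong[OF refl])
    fix \<omega> assume "\<omega> \<in> space (IT.C 0 (Suc n) ?u)"
    then have \<omega>: "\<omega> \<in> space (?P (Suc n))"
      using IT.space_C[OF emp, of "Suc n"] by simp
    have u: "fun_upd \<omega> (Suc n) x \<in> space (?P (Suc (Suc n)))" if "x \<in> space S" for x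
      using \<omega> that by (auto simp: space_PiM PiE_iff extensional_def less_Suc_eq)
    have \<omega>n: "\<omega> n \<in> space S" using measurable_space[OF c(2) \<omega>] .
    have "(\<integral>y. \<Phi> y \<partial>IT.eP (Suc n) \<omega>) = (\<integral>x. \<Phi> (fun_upd \<omega> (Suc n) x) \<partial>K (\<omega> n))"
      unfolding IT.eP_def nat.case using \<omega> sets_K[OF \<omega>n]
      by (subst integral_distr)
        (auto intro!: measurable_fun_upd[where J="{0..<Suc n}"] cong: measurable_cong_sets)
    also have "\<dots> = (\<integral>x. h \<omega> * f x \<partial>K (\<omega> n))"
    proof (rule Bochner_Integration.integral_cong[OF refl])
      fix x
      have "restrict (fun_upd \<omega> (Suc n) x) {0..<Suc n} = \<omega>"
        using \<omega> by (auto simp: space_PiM PiE_iff extensional_def fun_eq_iff restrict_def)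
      then show "\<Phi> (fun_upd \<omega> (Suc n) x) = h \<omega> * f x" by (simp add: \<Phi>_def)
    qed
    finally show "(\<integral>y. \<Phi> y \<partial>IT.eP (Suc n) \<omega>) = h \<omega> * kernel_op f (\<omega> n)"
      by (simp add: kernel_op_def)
  qed
  also have "\<dots> = (\<integral>\<omega>. h (restrict \<omega> {0..<Suc n}) * kernel_op f (\<omega> n) \<partial>path_measure S K \<nu>)"
    unfolding distr_path_restrict[symmetric] by (subst integral_distr) auto
  finally show ?thesis by (simp add: \<Phi>_def)
qed

lemma coordinate_measurable[measurable]: "(\<lambda>\<omega>. \<omega> n) \<in> path_measure S K \<nu> \<rightarrow>\<^sub>M S"
  by (auto intro!: measurable_component_singleton)

lemma integral_path_Suc:
  assumes f: "f \<in> borel_measurable S" and fb: "\<And>x. x \<in> space S \<Longrightarrow> \<bar>f x\<bar> \<le> B"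
  shows "(\<integral>\<omega>. f (\<omega> (Suc n)) \<partial>path_measure S K \<nu>) = (\<integral>\<omega>. kernel_op f (\<omega> n) \<partial>path_measure S K \<nu>)"
  using path_integral_step[of "\<lambda>_. 1" n 1 f B] f fb by simp

lemma integral_law:
  assumes "f \<in> borel_measurable S" and "\<And>x. x \<in> space S \<Longrightarrow> \<bar>f x\<bar> \<le> B"
  shows "(\<integral>x. f x \<partial>distr (path_measure S K \<nu>) S (\<lambda>\<omega>. \<omega> n)) = (\<integral>x. (kernel_op ^^ n) f x \<partial>\<nu>)"
  using assms
proof (induction n arbitrary: f)
  case 0
  then show ?case by (simp only: law_0 funpow_0)
next
  case (Suc n)
  have "(\<integral>x. f x \<partial>distr (path_measure S K \<nu>) S (\<lambda>\<omega>. \<omega> (Suc n)))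
      = (\<integral>x. kernel_op f x \<partial>distr (path_measure S K \<nu>) S (\<lambda>\<omega>. \<omega> n))"
    using Suc.prems by (simp add: integral_distr integral_path_Suc[OF Suc.prems])
  also have "\<dots> = (\<integral>x. (kernel_op ^^ n) (kernel_op f) x \<partial>\<nu>)"
    using Suc.prems by (intro Suc.IH kernel_op_measurable kernel_op_bounded)
  finally show ?case by (simp only: funpow_Suc_right comp_apply)
qed

text \<open>
  With the indicators of \<open>A\<close> and of the complement of \<open>B\<close> the right-hand side of the one-step
  identity vanishes, hence so does the probability of being in \<open>A\<close> and jumping out of \<open>B\<close>.
\<close>

lemma AE_path_step:
  assumes A[measurable]: "A \<in> sets S" and B[measurable]: "B \<in> sets S"
    and AB: "\<And>x. x \<in> A \<Longrightarrow> emeasure (K x) B = 1"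
  shows "AE \<omega> in path_measure S K \<nu>. \<omega> n \<in> A \<longrightarrow> \<omega> (Suc n) \<in> B"
proof -
  let ?M = "path_measure S K \<nu>"
  interpret prob_space ?M by (rule prob_space_path)
  let ?f = "indicator (space S - B) :: 'a \<Rightarrow> real"
  have zero: "indicator A x * kernel_op ?f x = (0::real)" if "x \<in> space S" for x
  proof (cases "x \<in> A")
    case True
    interpret Kx: prob_space "K x" using that by (rule prob_space_K)
    have "measure (K x) B = 1" using AB[OF True] by (simp add: measure_def)
    then have "measure (K x) (space S - B) = 0"
      using Kx.prob_compl[of B] B by (simp add: sets_K[OF that] space_K[OF that])
    then show ?thesis
      by (simp add: kernel_op_def space_K[OF that] Int_absorb2)
  qed simp
  have h: "(\<lambda>\<omega>. indicator A (\<omega> n) :: real) \<in> borel_measurable (PiM {0..<Suc n} (\<lambda>_. S))"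
    by (intro measurable_compose[OF measurable_component_singleton borel_measurable_indicator]) auto
  have "(\<integral>\<omega>. indicator A (\<omega> n) * ?f (\<omega> (Suc n)) \<partial>?M) = (\<integral>\<omega>. indicator A (\<omega> n) * kernel_op ?f (\<omega> n) \<partial>?M)"
    using path_integral_step[OF h, of 1 ?f 1] by (simp add: indicator_def)
  also have "\<dots> = 0"
    using zero by (intro Bochner_Integration.integral_eq_zero_AE AE_I2) (simp only: path_coordinate_in)
  finally have "(\<integral>\<omega>. indicator A (\<omega> n) * ?f (\<omega> (Suc n)) \<partial>?M) = 0" .
  moreover have "integrable ?M (\<lambda>\<omega>. indicator A (\<omega> n) * ?f (\<omega> (Suc n)))"
    by (rule integrable_const_bound[of _ 1]) (auto simp: indicator_def)
  ultimately have "AE \<omega> in ?M. indicator A (\<omega> n) * ?f (\<omega> (Suc n)) = 0"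
    by (subst (asm) integral_nonneg_eq_0_iff_AE) (auto simp: indicator_def)
  then show ?thesis
    using path_coordinate_in by (elim AE_mp) (auto intro!: AE_I2 simp: indicator_def split: if_splits)
qed

lemma AE_path_invariant:
  assumes B: "B \<in> sets S" and start: "AE x in \<nu>. x \<in> B"
    and inv: "\<And>x. x \<in> B \<Longrightarrow> emeasure (K x) B = 1"
  shows "AE \<omega> in path_measure S K \<nu>. \<forall>n. \<omega> n \<in> B"
proof -
  have "AE x in distr (path_measure S K \<nu>) S (\<lambda>\<omega>. \<omega> 0). x \<in> B"
    using start by (simp only: law_0)
  then have "AE \<omega> in path_measure S K \<nu>. \<omega> 0 \<in> B"
    by (rule AE_distrD[OF coordinate_measurable])
  moreover have "AE \<omega> in path_measure S K \<nu>. \<forall>n. \<omega> n \<in> B \<longrightarrow> \<omega> (Suc n) \<in> B"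
    unfolding AE_all_countable using AE_path_step[OF B B inv] by blast
  ultimately show ?thesis
  proof eventually_elim
    case (elim \<omega>)
    show ?case
    proof
      show "\<omega> n \<in> B" for n using elim by (induction n) auto
    qed
  qed
qed

end
end

text \<open>
  Second moments of order $1/n$ need not be summable, but they are along the squares. The gap between consecutive
  squares $k^2$ and $(k+1)^2$ has length of order $k$, which bounded increments bridge at a cost of
  order $k / k^2$.
\<close>

section \<open>Averages of martingale differences\<close>

lemma averages_tendsto_0_from_squares:
  fixes s :: "nat \<Rightarrow> real"
  assumes step: "\<And>n. \<bar>s (Suc n) - s n\<bar> \<le> C"
    and squares: "(\<lambda>k. s (k\<^sup>2) / real (k\<^sup>2)) \<longlonglongrightarrow> 0"
  shows "(\<lambda>n. s n / real n) \<longlonglongrightarrow> 0"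
proof -
  have C: "0 \<le> C" using step[of 0] by linarith
  have lip: "\<bar>s (m + j) - s m\<bar> \<le> C * real j" for m j
  proof (induction j)
    case (Suc j)
    have "\<bar>s (m + Suc j) - s m\<bar> \<le> \<bar>s (m + j) - s m\<bar> + \<bar>s (Suc (m + j)) - s (m + j)\<bar>" by simp
    also have "\<dots> \<le> C * real j + C" using Suc.IH step by (intro add_mono)
    finally show ?case by (simp add: algebra_simps)
  qed simp
  have "\<exists>N. \<forall>n\<ge>N. Z \<le> floor_sqrt n" for Z
    by (rule exI[of _ "Z\<^sup>2"]) (auto simp: le_floor_sqrt_iff)
  then have sqrt_top: "filterlim floor_sqrt at_top sequentially"
    by (auto simp: filterlim_at_top eventually_sequentially)
  have "(\<lambda>k. \<bar>s (k\<^sup>2) / real (k\<^sup>2)\<bar> + 2 * C * inverse (real k)) \<longlonglongrightarrow> \<bar>0\<bar> + 2 * C * 0"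
    by (intro tendsto_intros squares LIMSEQ_inverse_real_of_nat tendsto_inverse_0_at_top filterlim_real_sequentially)
  then have lim: "(\<lambda>k. \<bar>s (k\<^sup>2) / real (k\<^sup>2)\<bar> + 2 * C * inverse (real k)) \<longlonglongrightarrow> 0" by simp
  show ?thesis
  proof (rule Lim_null_comparison[OF _ filterlim_compose[OF lim sqrt_top]])
    show "\<forall>\<^sub>F n in sequentially. norm (s n / real n) \<le>
       \<bar>s ((floor_sqrt n)\<^sup>2) / real ((floor_sqrt n)\<^sup>2)\<bar> + 2 * C * inverse (real (floor_sqrt n))"
      using eventually_gt_at_top[of 0]
    proof eventually_elim
      case (elim n)
      \<comment> \<open>The last square time before \<open>n\<close>.\<close>
      define k where "k = floor_sqrt n"
      have k: "k\<^sup>2 \<le> n" "n < (Suc k)\<^sup>2" by (auto simp: k_def Suc_floor_sqrt_power2_gt)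
      then have kpos: "k > 0" using elim by (cases k) auto
      have n: "n = k\<^sup>2 + (n - k\<^sup>2)" and "n - k\<^sup>2 \<le> 2 * k"
        using k by (auto simp: power2_eq_square)
      then have "\<bar>s n - s (k\<^sup>2)\<bar> \<le> C * real (2 * k)"
        using lip[of "k\<^sup>2" "n - k\<^sup>2"] C by (smt (verit) mult_left_mono of_nat_mono)
      then have "\<bar>s n\<bar> \<le> \<bar>s (k\<^sup>2)\<bar> + 2 * C * k" by simp
      then have "\<bar>s n\<bar> / n \<le> (\<bar>s (k\<^sup>2)\<bar> + 2 * C * k) / real (k\<^sup>2)"
        using kpos k(1) C by (intro frac_le) (auto simp del: of_nat_power)
      also have "\<dots> = \<bar>s (k\<^sup>2) / real (k\<^sup>2)\<bar> + 2 * C * inverse (real k)"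
        using kpos by (simp add: field_simps power2_eq_square)
      finally show ?case by (simp add: k_def)
    qed
  qed
qed

context markov_kernel begin

context
  fixes \<nu> assumes \<nu>: "\<nu> \<in> space (prob_algebra S)"
begin

text \<open>
  The partial sum depends on coordinates up to $n$ only, so the Markov property makes it
  orthogonal to the next difference; the variances of the differences just add up.
\<close>

lemma martingale_second_moment:
  assumes f[measurable]: "f \<in> borel_measurable S" and fb: "\<And>x. x \<in> space S \<Longrightarrow> \<bar>f x\<bar> \<le> B"
  shows "(\<integral>\<omega>. (\<Sum>k<n. f (\<omega> (Suc k)) - kernel_op f (\<omega> k))\<^sup>2 \<partial>path_measure S K \<nu>) \<le> real n * (2 * B)\<^sup>2"
proof (induction n)
  case (Suc n)
  let ?M = "path_measure S K \<nu>"
  interpret prob_space ?M by (rule prob_space_path[OF \<nu>])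
  note sets_path[OF \<nu>, measurable_cong]
  note coordinate_measurable[OF \<nu>, measurable]
  define m where "m \<omega> = (\<Sum>k<n. f (\<omega> (Suc k)) - kernel_op f (\<omega> k))" for \<omega>
  define D where "D \<omega> = f (\<omega> (Suc n)) - kernel_op f (\<omega> n)" for \<omega>
  have Pb: "\<bar>kernel_op f x\<bar> \<le> B" if "x \<in> space S" for x
    using kernel_op_bounded[OF f _ that] fb by blast
  have Db: "\<bar>f (\<omega> (Suc k)) - kernel_op f (\<omega> k)\<bar> \<le> 2 * B" if "\<omega> (Suc k) \<in> space S" "\<omega> k \<in> space S" for \<omega> k
    using fb[OF that(1)] Pb[OF that(2)] by linarith
  have mb: "\<bar>m \<omega>\<bar> \<le> real n * (2 * B)" if "\<And>k. k \<le> n \<Longrightarrow> \<omega> k \<in> space S" for \<omega>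
  proof -
    have "\<bar>m \<omega>\<bar> \<le> (\<Sum>k<n. \<bar>f (\<omega> (Suc k)) - kernel_op f (\<omega> k)\<bar>)"
      unfolding m_def by (rule sum_abs)
    also have "\<dots> \<le> (\<Sum>k<n. 2 * B)"
      using that by (intro sum_mono Db) auto
    finally show ?thesis by simp
  qed
  have c: "(\<lambda>\<omega>. \<omega> k) \<in> PiM {0..<Suc n} (\<lambda>_. S) \<rightarrow>\<^sub>M S" if "k \<le> n" for k
    using that by (intro measurable_component_singleton) auto
  have m_meas: "m \<in> borel_measurable (PiM {0..<Suc n} (\<lambda>_. S))"
    unfolding m_def
    by (intro borel_measurable_sum borel_measurable_diff measurable_compose[OF c f]
        measurable_compose[OF c kernel_op_measurable[OF f]]) auto
  \<comment> \<open>The partial sum is a function of the first \<open>n + 1\<close> coordinates, as the Markov property requires.\<close>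
  have m_restrict: "m (restrict \<omega> {0..<Suc n}) = m \<omega>" for \<omega>
    unfolding m_def by (intro sum.cong) auto
  have in_S: "\<omega> k \<in> space S" if "\<omega> \<in> space ?M" for \<omega> k
    using path_coordinate_in[OF \<nu> that] .
  have [measurable]: "m \<in> borel_measurable ?M" "D \<in> borel_measurable ?M"
    unfolding m_def D_def by measurable
  have int: "integrable ?M (\<lambda>\<omega>. m \<omega> * f (\<omega> (Suc n)))" "integrable ?M (\<lambda>\<omega>. m \<omega> * kernel_op f (\<omega> n))"
    by (rule integrable_const_bound[of _ "real n * (2 * B) * B"],
        auto simp: abs_mult intro!: AE_I2 mult_mono mb fb Pb in_S order_trans[OF abs_ge_zero])+
  have int2: "integrable ?M (\<lambda>\<omega>. (m \<omega>)\<^sup>2)"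
    by (rule integrable_const_bound[of _ "(real n * (2 * B))\<^sup>2"])
      (auto intro!: AE_I2 abs_le_square_iff[THEN iffD1] order_trans[OF mb abs_ge_self] in_S)
  have D2: "(D \<omega>)\<^sup>2 \<le> (2 * B)\<^sup>2" if "\<omega> \<in> space ?M" for \<omega>
    unfolding D_def using Db[of \<omega> n] in_S[OF that] by (intro abs_le_square_iff[THEN iffD1]) force
  have int3: "integrable ?M (\<lambda>\<omega>. (D \<omega>)\<^sup>2)"
    by (rule integrable_const_bound[of _ "(2 * B)\<^sup>2"]) (use D2 in \<open>auto intro!: AE_I2 simp: power_mult_distrib\<close>)
  have "(\<integral>\<omega>. m \<omega> * f (\<omega> (Suc n)) \<partial>?M) = (\<integral>\<omega>. m \<omega> * kernel_op f (\<omega> n) \<partial>?M)"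
    using path_integral_step[OF \<nu> m_meas _ f fb, of "real n * (2 * B)"] mb
    unfolding m_restrict by (auto simp: space_PiM PiE_iff)
  then have cross: "(\<integral>\<omega>. m \<omega> * D \<omega> \<partial>?M) = 0" and intmD: "integrable ?M (\<lambda>\<omega>. m \<omega> * D \<omega>)"
    using int by (simp_all add: D_def right_diff_distrib)
  have "(\<integral>\<omega>. (\<Sum>k<Suc n. f (\<omega> (Suc k)) - kernel_op f (\<omega> k))\<^sup>2 \<partial>?M)
      = (\<integral>\<omega>. (m \<omega>)\<^sup>2 + 2 * (m \<omega> * D \<omega>) + (D \<omega>)\<^sup>2 \<partial>?M)"
  proof (rule Bochner_Integration.integral_cong[OF refl])
    fix \<omega>
    have "(\<Sum>k<Suc n. f (\<omega> (Suc k)) - kernel_op f (\<omega> k)) = m \<omega> + D \<omega>"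
      by (simp add: m_def D_def)
    then show "(\<Sum>k<Suc n. f (\<omega> (Suc k)) - kernel_op f (\<omega> k))\<^sup>2 = (m \<omega>)\<^sup>2 + 2 * (m \<omega> * D \<omega>) + (D \<omega>)\<^sup>2"
      by (simp add: power2_sum)
  qed
  also have "\<dots> = (\<integral>\<omega>. (m \<omega>)\<^sup>2 \<partial>?M) + 2 * (\<integral>\<omega>. m \<omega> * D \<omega> \<partial>?M) + (\<integral>\<omega>. (D \<omega>)\<^sup>2 \<partial>?M)"
    using int2 int3 intmD by simp
  also have "\<dots> = (\<integral>\<omega>. (m \<omega>)\<^sup>2 \<partial>?M) + (\<integral>\<omega>. (D \<omega>)\<^sup>2 \<partial>?M)"
    by (simp add: cross)
  also have "(\<integral>\<omega>. (D \<omega>)\<^sup>2 \<partial>?M) \<le> (\<integral>\<omega>. (2 * B)\<^sup>2 \<partial>?M)"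
    using int3 D2 by (intro integral_mono) auto
  also have "(\<integral>\<omega>. (m \<omega>)\<^sup>2 \<partial>?M) \<le> real n * (2 * B)\<^sup>2"
    using Suc.IH by (simp add: m_def)
  finally show ?case by (simp add: prob_space algebra_simps)
qed simp

text \<open>
  The average at time $k^2$ has second moment of order $1/k^2$. These are summable, so the squared
  averages at square times have an almost surely finite sum and tend to $0$.
\<close>

theorem martingale_averages_tendsto_0:
  assumes f[measurable]: "f \<in> borel_measurable S" and fb: "\<And>x. x \<in> space S \<Longrightarrow> \<bar>f x\<bar> \<le> B"
  shows "AE \<omega> in path_measure S K \<nu>.
    (\<lambda>n. (\<Sum>k<n. f (\<omega> (Suc k)) - kernel_op f (\<omega> k)) / real n) \<longlonglongrightarrow> 0"
proof -
  let ?M = "path_measure S K \<nu>"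
  interpret prob_space ?M by (rule prob_space_path[OF \<nu>])
  note sets_path[OF \<nu>, measurable_cong]
  note coordinate_measurable[OF \<nu>, measurable]
  have Pb: "\<bar>kernel_op f x\<bar> \<le> B" if "x \<in> space S" for x
    using kernel_op_bounded[OF f _ that] fb by blast
  define m where "m n \<omega> = (\<Sum>k<n. f (\<omega> (Suc k)) - kernel_op f (\<omega> k))" for n \<omega>
  have m_meas[measurable]: "m n \<in> borel_measurable ?M" for n
    unfolding m_def by measurable
  have step: "\<bar>m (Suc n) \<omega> - m n \<omega>\<bar> \<le> 2 * B" if "\<omega> \<in> space ?M" for n \<omega>
    using fb[OF path_coordinate_in[OF \<nu> that, of "Suc n"]] Pb[OF path_coordinate_in[OF \<nu> that, of n]]
    by (simp add: m_def)
  have mb: "\<bar>m n \<omega>\<bar> \<le> real n * (2 * B)" if "\<omega> \<in> space ?M" for n \<omega>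
  proof (induction n)
    case (Suc n)
    then show ?case using step[OF that, of n] by (simp add: algebra_simps)
  qed (simp add: m_def)
  define q where "q k \<omega> = (m (k\<^sup>2) \<omega> / real (k\<^sup>2))\<^sup>2" for k \<omega>
  have [measurable]: "q k \<in> borel_measurable ?M" for k
    unfolding q_def by measurable
  have m2: "integrable ?M (\<lambda>\<omega>. (m n \<omega>)\<^sup>2)" for n
    by (rule integrable_const_bound[of _ "(real n * (2 * B))\<^sup>2"])
      (auto intro!: AE_I2 abs_le_square_iff[THEN iffD1] order_trans[OF mb abs_ge_self])
  have qint: "integrable ?M (q k)" for k
    unfolding q_def power_divide using m2 by simp
  have Eq: "(\<integral>\<omega>. q k \<omega> \<partial>?M) \<le> (2 * B)\<^sup>2 * inverse ((real k)\<^sup>2)" for k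
  proof (cases "k = 0")
    case False
    have "(\<integral>\<omega>. q k \<omega> \<partial>?M) = (\<integral>\<omega>. (m (k\<^sup>2) \<omega>)\<^sup>2 \<partial>?M) / (real (k\<^sup>2))\<^sup>2"
      unfolding q_def power_divide by simp
    also have "\<dots> \<le> real (k\<^sup>2) * (2 * B)\<^sup>2 / (real (k\<^sup>2))\<^sup>2"
      using martingale_second_moment[OF f fb, of "k\<^sup>2"] unfolding m_def
      by (intro divide_right_mono) auto
    also have "\<dots> = (2 * B)\<^sup>2 * inverse ((real k)\<^sup>2)"
      using False by (simp add: field_simps power2_eq_square)
    finally show ?thesis .
  qed (simp add: q_def m_def)
  have "summable (\<lambda>k. \<integral>\<omega>. q k \<omega> \<partial>?M)"
  proof (rule summable_comparison_test')
    show "summable (\<lambda>k. (2 * B)\<^sup>2 * inverse ((real k)\<^sup>2))"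
      using inverse_power_summable[of 2, where 'a=real] by (intro summable_mult) simp
    show "norm (\<integral>\<omega>. q k \<omega> \<partial>?M) \<le> (2 * B)\<^sup>2 * inverse ((real k)\<^sup>2)" if "k \<ge> 0" for k
      using Eq[of k] integral_nonneg_AE[of "q k" ?M] by (simp add: q_def)
  qed
  then have "(\<Sum>k. ennreal (\<integral>\<omega>. q k \<omega> \<partial>?M)) = ennreal (\<Sum>k. \<integral>\<omega>. q k \<omega> \<partial>?M)"
    by (intro suminf_ennreal2) (auto simp: q_def)
  moreover have "(\<integral>\<^sup>+\<omega>. ennreal (q k \<omega>) \<partial>?M) = ennreal (\<integral>\<omega>. q k \<omega> \<partial>?M)" for k
    by (intro nn_integral_eq_integral[OF qint]) (simp add: q_def)
  ultimately have "(\<integral>\<^sup>+\<omega>. (\<Sum>k. ennreal (q k \<omega>)) \<partial>?M) \<noteq> \<infinity>"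
    by (subst nn_integral_suminf) auto
  then have "AE \<omega> in ?M. (\<Sum>k. ennreal (q k \<omega>)) \<noteq> \<infinity>"
    by (intro nn_integral_PInf_AE) auto
  then show ?thesis
  proof (rule AE_mp, intro AE_I2 impI)
    fix \<omega> assume \<omega>: "\<omega> \<in> space ?M" and fin: "(\<Sum>k. ennreal (q k \<omega>)) \<noteq> \<infinity>"
    have "summable (\<lambda>k. q k \<omega>)"
      using fin by (intro summable_suminf_not_top) (auto simp: q_def)
    then have "(\<lambda>k. q k \<omega>) \<longlonglongrightarrow> 0" by (rule summable_LIMSEQ_zero)
    then have "(\<lambda>k. sqrt (q k \<omega>)) \<longlonglongrightarrow> sqrt 0" by (intro tendsto_intros)
    then have "(\<lambda>k. \<bar>m (k\<^sup>2) \<omega> / real (k\<^sup>2)\<bar>) \<longlonglongrightarrow> 0"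
      by (simp add: q_def)
    then have "(\<lambda>k. m (k\<^sup>2) \<omega> / real (k\<^sup>2)) \<longlonglongrightarrow> 0"
      by (rule tendsto_rabs_zero_cancel)
    from averages_tendsto_0_from_squares[of "\<lambda>n. m n \<omega>", OF step[OF \<omega>] this]
    show "(\<lambda>n. (\<Sum>k<n. f (\<omega> (Suc k)) - kernel_op f (\<omega> k)) / real n) \<longlonglongrightarrow> 0"
      by (simp add: m_def)
  qed
qed

end
end

text \<open>
  The coupling inequality for one step: an index distributed according to \<open>u\<close> and one distributed
  according to \<open>v\<close> can be chosen equal with probability $\sum_j \min(u_j, v_j)$. Equal indices
  cost \<open>T\<close>, different ones \<open>M\<close>.
\<close>

section \<open>Synchronisation of contractive systems with place-dependent probabilities\<close>

lemma overlap_estimate: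
  fixes u v a b :: "'j \<Rightarrow> real"
  assumes u0: "\<And>j. j \<in> J \<Longrightarrow> 0 \<le> u j" and v0: "\<And>j. j \<in> J \<Longrightarrow> 0 \<le> v j"
    and u1: "sum u J = 1" and v1: "sum v J = 1"
    and far: "\<And>i j. i \<in> J \<Longrightarrow> j \<in> J \<Longrightarrow> \<bar>a i - b j\<bar> \<le> M"
    and near: "\<And>j. j \<in> J \<Longrightarrow> \<bar>a j - b j\<bar> \<le> T"
    and "T \<le> M" and c: "c \<le> (\<Sum>j\<in>J. min (u j) (v j))"
  shows "\<bar>(\<Sum>j\<in>J. u j * a j) - (\<Sum>j\<in>J. v j * b j)\<bar> \<le> c * T + (1 - c) * M"
proof -
  define m where "m j = min (u j) (v j)" for j
  \<comment> \<open>The mass of each distribution that cannot be matched with the other one.\<close>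
  define s where "s = 1 - sum m J"
  define u' v' where "u' j = u j - m j" and "v' j = v j - m j" for j
  have su: "sum u' J = s" and sv: "sum v' J = s"
    using u1 v1 unfolding u'_def v'_def s_def by (simp_all only: sum_subtractf)
  have um: "0 \<le> u' j" and vm: "0 \<le> v' j" for j by (simp_all add: m_def u'_def v'_def)
  have s0: "0 \<le> s" unfolding su[symmetric] by (intro sum_nonneg um)
  have finJ: "finite J" using u1 by (metis sum.infinite zero_neq_one)
  have rest: "\<bar>(\<Sum>j\<in>J. u' j * a j) - (\<Sum>j\<in>J. v' j * b j)\<bar> \<le> s * M"
  proof (cases "s = 0")
    case True
    have "u' j = 0" "v' j = 0" if "j \<in> J" for j
      using that True sum_nonneg_eq_0_iff[of J u'] sum_nonneg_eq_0_iff[of J v'] finJ um vm su sv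
      by simp_all
    then show ?thesis using True by simp
  next
    case False
    have "(\<Sum>i\<in>J. \<Sum>j\<in>J. u' i * v' j * (a i - b j))
        = (\<Sum>i\<in>J. \<Sum>j\<in>J. (u' i * a i) * v' j - u' i * (v' j * b j))"
      by (intro sum.cong refl) (simp only: algebra_simps)
    also have "\<dots> = (\<Sum>i\<in>J. u' i * a i) * sum v' J - sum u' J * (\<Sum>j\<in>J. v' j * b j)"
      by (simp only: sum_subtractf sum_product)
    also have "\<dots> = s * ((\<Sum>j\<in>J. u' j * a j) - (\<Sum>j\<in>J. v' j * b j))"
      by (simp only: su sv) (simp only: algebra_simps)
    finally have "s * \<bar>(\<Sum>j\<in>J. u' j * a j) - (\<Sum>j\<in>J. v' j * b j)\<bar>
        = \<bar>\<Sum>i\<in>J. \<Sum>j\<in>J. u' i * v' j * (a i - b j)\<bar>"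
      using s0 by (simp only: abs_mult abs_of_nonneg)
    also have "\<dots> \<le> (\<Sum>i\<in>J. \<Sum>j\<in>J. \<bar>u' i * v' j * (a i - b j)\<bar>)"
      by (rule order_trans[OF sum_abs]) (rule sum_mono, rule sum_abs)
    also have "\<dots> \<le> (\<Sum>i\<in>J. \<Sum>j\<in>J. u' i * v' j * M)"
      using um vm far by (intro sum_mono) (simp add: abs_mult mult_left_mono)
    also have "\<dots> = s * (s * M)"
      by (simp only: sum_distrib_right[symmetric] sum_distrib_left[symmetric] su sv mult.assoc)
    finally show ?thesis using s0 False by (simp add: mult_le_cancel_left)
  qed
  have "(\<Sum>j\<in>J. u j * a j) - (\<Sum>j\<in>J. v j * b j) = (\<Sum>j\<in>J. u j * a j - v j * b j)"
    by (simp only: sum_subtractf)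
  also have "\<dots> = (\<Sum>j\<in>J. m j * (a j - b j) + (u' j * a j - v' j * b j))"
    unfolding u'_def v'_def by (intro sum.cong refl) (simp add: algebra_simps)
  also have "\<dots> = (\<Sum>j\<in>J. m j * (a j - b j)) + ((\<Sum>j\<in>J. u' j * a j) - (\<Sum>j\<in>J. v' j * b j))"
    by (simp only: sum_subtractf sum.distrib)
  finally have split: "(\<Sum>j\<in>J. u j * a j) - (\<Sum>j\<in>J. v j * b j) = \<dots>" .
  have m0: "0 \<le> m j" if "j \<in> J" for j using u0 v0 that by (simp add: m_def)
  have "\<bar>\<Sum>j\<in>J. m j * (a j - b j)\<bar> \<le> (\<Sum>j\<in>J. \<bar>m j * (a j - b j)\<bar>)" by (rule sum_abs)
  also have "\<dots> \<le> (\<Sum>j\<in>J. m j * T)"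
    using m0 near by (intro sum_mono) (simp add: abs_mult mult_left_mono)
  also have "\<dots> = (1 - s) * T" by (simp add: s_def sum_distrib_right)
  finally have "\<bar>(\<Sum>j\<in>J. u j * a j) - (\<Sum>j\<in>J. v j * b j)\<bar> \<le> (1 - s) * T + s * M"
    unfolding split using rest by linarith
  also have "\<dots> = M - (1 - s) * (M - T)" by (simp add: algebra_simps)
  also have "\<dots> \<le> M - c * (M - T)"
    using c \<open>T \<le> M\<close> by (intro diff_left_mono mult_right_mono) (auto simp: s_def m_def)
  finally show ?thesis by (simp add: algebra_simps)
qed

text \<open>
  The bound $1 - e \ge \exp(-e/\delta)$ holds for $0 \le e \le 1 - \delta$ and turns a summable
  sequence into a product that stays positive, uniformly in the first index and the length.
\<close>

lemma prod_one_minus_ge: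
  fixes e :: "nat \<Rightarrow> real"
  assumes sm: "summable e" and e0: "\<And>k. 0 \<le> e k" and e1: "\<And>k. e k \<le> 1 - \<delta>" and \<delta>: "0 < \<delta>"
  shows "exp (- suminf e / \<delta>) \<le> (\<Prod>i<n. 1 - e (k + i))"
proof -
  have "exp (- (e i / \<delta>)) \<le> 1 - e i" for i
  proof -
    have pos: "0 < 1 - e i" "\<delta> \<le> 1 - e i" using e1[of i] \<delta> by auto
    have "1 / (1 - e i) = 1 + e i / (1 - e i)" using pos by (simp add: field_simps)
    also have "\<dots> \<le> 1 + e i / \<delta>" using pos \<delta> e0[of i] by (intro add_left_mono divide_left_mono) auto
    also have "\<dots> \<le> exp (e i / \<delta>)" by (rule exp_ge_add_one_self)
    finally show ?thesis using pos by (simp add: exp_minus field_simps)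
  qed
  then have lower: "(\<Prod>i<n. exp (- (e (k + i) / \<delta>))) \<le> (\<Prod>i<n. 1 - e (k + i))"
    by (intro prod_mono) auto
  have "(\<Sum>i<n. e (k + i)) = sum e {k..<k + n}"
    using sum.shift_bounds_nat_ivl[of e 0 k n] by (simp add: atLeast0LessThan add.commute)
  also have "\<dots> \<le> suminf e"
    using sm e0 by (intro sum_le_suminf) auto
  finally have "exp (- suminf e / \<delta>) \<le> exp (- (\<Sum>i<n. e (k + i)) / \<delta>)"
    using \<delta> by (simp add: divide_right_mono)
  also have "\<dots> = (\<Prod>i<n. exp (- (e (k + i) / \<delta>)))"
    by (subst exp_sum[symmetric]) (simp_all add: sum_negf sum_divide_distrib)
  finally show ?thesis using lower by (rule order_trans)
qed

text \<open>
  The distance \<open>d\<close> need not be the metric of the type, since the maps contract only an adapted one;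
  continuity and properness of \<open>d\<close> tie it to the topology. The last assumption is
  Dini continuity of the probabilities in summed form: their variation at the scales
  $D q^k$, which a synchronised pair of chains passes through, is summable in $k$.
\<close>

locale contractive_ifs =
  fixes X :: "'a::metric_space set" and d :: "'a \<Rightarrow> 'a \<Rightarrow> real" and J :: "'j set"
    and w :: "'j \<Rightarrow> 'a \<Rightarrow> 'a" and p :: "'j \<Rightarrow> 'a \<Rightarrow> real" and q \<delta> :: real
  assumes X_nonempty: "X \<noteq> {}" and X_closed: "closed X"
    and d_zero: "\<And>x y. x \<in> X \<Longrightarrow> y \<in> X \<Longrightarrow> d x y = 0 \<longleftrightarrow> x = y"
    and d_sym: "\<And>x y. d x y = d y x"
    and d_triangle: "\<And>x y z. d x z \<le> d x y + d y z"
    and d_continuous: "continuous_on (X \<times> X) (\<lambda>(x, y). d x y)"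
    and d_proper: "\<And>x R. x \<in> X \<Longrightarrow> compact {y \<in> X. d x y \<le> R}"
    and finite_J: "finite J"
    and w_in: "\<And>j x. j \<in> J \<Longrightarrow> x \<in> X \<Longrightarrow> w j x \<in> X"
    and q: "0 < q" "q < 1"
    and w_contract: "\<And>j x y. j \<in> J \<Longrightarrow> x \<in> X \<Longrightarrow> y \<in> X \<Longrightarrow> d (w j x) (w j y) \<le> q * d x y"
    and \<delta>: "0 < \<delta>"
    and p_ge: "\<And>j x. j \<in> J \<Longrightarrow> x \<in> X \<Longrightarrow> \<delta> \<le> p j x"
    and p_sum: "\<And>x. x \<in> X \<Longrightarrow> (\<Sum>j\<in>J. p j x) = 1"
    and p_variation: "\<And>D. \<exists>\<eta>. summable \<eta> \<and>
      (\<forall>k. \<forall>x\<in>X. \<forall>y\<in>X. d x y \<le> D * q ^ k \<longrightarrow> (\<forall>j\<in>J. \<bar>p j x - p j y\<bar> \<le> \<eta> k))"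
begin

lemma d_nonneg: "0 \<le> d x y"
  using d_triangle[of x x y] d_triangle[of x y x] d_sym[of x y] by linarith

lemma p_nonneg: "j \<in> J \<Longrightarrow> x \<in> X \<Longrightarrow> 0 \<le> p j x"
  using p_ge \<delta> by fastforce

lemma J_nonempty: "J \<noteq> {}"
  using X_nonempty p_sum by fastforce

text \<open>
  Heine-Cantor with respect to \<open>d\<close>: the pairs whose images are \<open>\<epsilon>\<close>-apart form a compact set off
  the diagonal, and \<open>d\<close> attains a positive minimum on it.
\<close>

lemma compact_uniform:
  fixes g :: "'a \<Rightarrow> 'b::metric_space"
  assumes C: "compact C" "C \<subseteq> X" and g: "continuous_on C g" and "0 < \<epsilon>"
  obtains t where "0 < t" "\<And>x y. x \<in> C \<Longrightarrow> y \<in> C \<Longrightarrow> d x y < t \<Longrightarrow> dist (g x) (g y) < \<epsilon>"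
proof -
  let ?h = "\<lambda>z. dist (g (fst z)) (g (snd z))"
  let ?F = "(C \<times> C) \<inter> ?h -` {\<epsilon>..}"
  have h: "continuous_on (C \<times> C) ?h"
    by (intro continuous_on_dist continuous_on_compose2[OF g] continuous_on_fst continuous_on_snd) auto
  have F: "compact ?F"
    using continuous_closedin_preimage[OF h closed_atLeast] closedin_compact[OF compact_Times[OF C(1) C(1)]]
    by blast
  show ?thesis
  proof (cases "?F = {}")
    case True
    show ?thesis
      by (rule that[of 1]) (use True in \<open>auto simp: not_le disjoint_iff\<close>)
  next
    case False
    have "continuous_on ?F (\<lambda>(x, y). d x y)"
      using C(2) by (intro continuous_on_subset[OF d_continuous]) auto
    from continuous_attains_inf[OF F False this] obtain z where
      z: "z \<in> ?F" "\<And>y. y \<in> ?F \<Longrightarrow> d (fst z) (snd z) \<le> d (fst y) (snd y)"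
      by (auto simp: case_prod_beta)
    have "fst z \<noteq> snd z" using z(1) \<open>0 < \<epsilon>\<close> by auto
    then have "d (fst z) (snd z) \<noteq> 0"
      using z(1) C(2) d_zero[of "fst z" "snd z"] by (auto simp: mem_Times_iff)
    then have pos: "0 < d (fst z) (snd z)" using d_nonneg[of "fst z" "snd z"] by linarith
    show ?thesis
      by (rule that[OF pos]) (use z(2) in \<open>force simp: not_le[symmetric]\<close>)
  qed
qed

lemma compact_uniform_geometric:
  fixes g :: "'a \<Rightarrow> 'b::metric_space"
  assumes C: "compact C" "C \<subseteq> X" and g: "continuous_on C g" and "0 < \<epsilon>"
  obtains N where "\<And>n x y. N \<le> n \<Longrightarrow> x \<in> C \<Longrightarrow> y \<in> C \<Longrightarrow> d x y \<le> D * q ^ n \<Longrightarrow> dist (g x) (g y) < \<epsilon>"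
proof -
  obtain t where t: "0 < t" "\<And>x y. x \<in> C \<Longrightarrow> y \<in> C \<Longrightarrow> d x y < t \<Longrightarrow> dist (g x) (g y) < \<epsilon>"
    using compact_uniform[OF C g \<open>0 < \<epsilon>\<close>] by blast
  have "(\<lambda>n. D * q ^ n) \<longlonglongrightarrow> D * 0"
    using q by (intro tendsto_mult_left LIMSEQ_power_zero) auto
  then have "\<forall>\<^sub>F n in sequentially. D * q ^ n < t"
    using t(1) by (intro order_tendstoD(2)) auto
  then obtain N where N: "\<And>n. n \<ge> N \<Longrightarrow> D * q ^ n < t" by (auto simp: eventually_sequentially)
  show ?thesis
  proof (rule that[of N])
    fix n x y assume "N \<le> n" "x \<in> C" "y \<in> C" "d x y \<le> D * q ^ n"
    then show "dist (g x) (g y) < \<epsilon>" using N[of n] by (intro t(2)) auto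
  qed
qed

lemma continuous_on_X_I:
  fixes g :: "'a \<Rightarrow> 'b::metric_space"
  assumes g: "\<And>x \<epsilon>. x \<in> X \<Longrightarrow> 0 < \<epsilon> \<Longrightarrow> \<exists>t>0. \<forall>y\<in>X. d x y < t \<longrightarrow> dist (g x) (g y) < \<epsilon>"
  shows "continuous_on X g"
proof (unfold continuous_on_def tendsto_iff, intro ballI allI impI)
  fix x \<epsilon> assume x: "x \<in> X" and "(0::real) < \<epsilon>"
  from g[OF this] obtain t where t: "t > 0" "\<And>y. y \<in> X \<Longrightarrow> d x y < t \<Longrightarrow> dist (g x) (g y) < \<epsilon>" by blast
  have "continuous_on X (\<lambda>y. d x y)"
    using x by (intro continuous_on_compose2[OF d_continuous, where f="\<lambda>y. (x, y)", simplified]) (auto intro!: continuous_intros)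
  then have "((\<lambda>y. d x y) \<longlongrightarrow> d x x) (at x within X)"
    using x by (simp add: continuous_on_def)
  then have "\<forall>\<^sub>F y in at x within X. d x y < t"
    using t(1) d_zero[OF x x] by (auto intro: order_tendstoD)
  moreover have "\<forall>\<^sub>F y in at x within X. y \<in> X" by (simp add: eventually_at_filter)
  ultimately show "\<forall>\<^sub>F y in at x within X. dist (g y) (g x) < \<epsilon>"
    by eventually_elim (use t(2) in \<open>simp add: dist_commute\<close>)
qed

text \<open>
  Smallness in \<open>d\<close> gives smallness in the metric of the type only on compact sets; the closed
  \<open>d\<close>-ball around the image point serves as such a set.
\<close>

lemma w_continuous: assumes j: "j \<in> J" shows "continuous_on X (w j)"
proof (rule continuous_on_X_I)
  fix x and \<epsilon> :: real assume x: "x \<in> X" and "0 < \<epsilon>"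
  let ?C = "{y \<in> X. d (w j x) y \<le> 1}"
  obtain t where t: "0 < t" "\<And>u v. u \<in> ?C \<Longrightarrow> v \<in> ?C \<Longrightarrow> d u v < t \<Longrightarrow> dist u v < \<epsilon>"
    using compact_uniform[of ?C "\<lambda>x. x" \<epsilon>] d_proper[OF w_in[OF j x]] \<open>0 < \<epsilon>\<close> by (auto simp: continuous_on_id)
  have "dist (w j x) (w j y) < \<epsilon>" if y: "y \<in> X" "d x y < min t 1" for y
  proof (rule t(2))
    have le: "d (w j x) (w j y) \<le> d x y"
      using w_contract[OF j x y(1)] q d_nonneg[of x y] by (smt (verit) mult_left_le_one_le)
    show "w j y \<in> ?C" "d (w j x) (w j y) < t" using le y w_in[OF j] by auto
    show "w j x \<in> ?C" using w_in[OF j x] d_zero[of "w j x" "w j x"] by simp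
  qed
  then show "\<exists>t>0. \<forall>y\<in>X. d x y < t \<longrightarrow> dist (w j x) (w j y) < \<epsilon>"
    using t(1) by (intro exI[of _ "min t 1"]) auto
qed

lemma p_continuous: assumes j: "j \<in> J" shows "continuous_on X (p j)"
proof (rule continuous_on_X_I)
  fix x and \<epsilon> :: real assume x: "x \<in> X" and "0 < \<epsilon>"
  obtain \<eta> where \<eta>: "summable \<eta>"
    "\<And>k x y. x \<in> X \<Longrightarrow> y \<in> X \<Longrightarrow> d x y \<le> 1 * q ^ k \<Longrightarrow> \<bar>p j x - p j y\<bar> \<le> \<eta> k"
    using p_variation[of 1] j by metis
  have "\<forall>\<^sub>F k in sequentially. \<eta> k < \<epsilon>"
    using summable_LIMSEQ_zero[OF \<eta>(1)] \<open>0 < \<epsilon>\<close> by (rule order_tendstoD)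
  then obtain k where "\<eta> k < \<epsilon>" by (auto simp: eventually_sequentially)
  then have "dist (p j x) (p j y) < \<epsilon>" if "y \<in> X" "d x y < q ^ k" for y
    using \<eta>(2)[OF x that(1), of k] that(2) by (simp add: dist_real_def)
  then show "\<exists>t>0. \<forall>y\<in>X. d x y < t \<longrightarrow> dist (p j x) (p j y) < \<epsilon>"
    using q by (intro exI[of _ "q ^ k"]) auto
qed

definition transfer :: "('a \<Rightarrow> real) \<Rightarrow> 'a \<Rightarrow> real" where
  "transfer f x = (\<Sum>j\<in>J. p j x * f (w j x))"

lemma transfer_continuous:
  assumes "continuous_on X f" shows "continuous_on X (transfer f)"
  unfolding transfer_def
  by (intro continuous_intros p_continuous continuous_on_compose2[OF assms w_continuous])
    (auto intro: w_in)

lemma transfer_iter_continuous: "continuous_on X f \<Longrightarrow> continuous_on X ((transfer ^^ n) f)"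
  by (induction n) (auto intro: transfer_continuous)

definition base :: 'a where "base = (SOME x. x \<in> X)"

lemma base_in: "base \<in> X"
  unfolding base_def using X_nonempty by (simp add: some_in_eq)

definition trap :: "real \<Rightarrow> 'a set" where "trap R = {x \<in> X. d base x \<le> R}"

definition min_radius :: real where "min_radius = Max ((\<lambda>j. d base (w j base)) ` J) / (1 - q)"

lemma compact_trap: "compact (trap R)" and trap_subset: "trap R \<subseteq> X"
  unfolding trap_def using d_proper[OF base_in] by auto

lemma bounded_on_trap:
  fixes g :: "'a \<Rightarrow> real"
  assumes g: "continuous_on X g"
  obtains B where "\<And>x. x \<in> trap R \<Longrightarrow> \<bar>g x\<bar> \<le> B"
proof -
  have "compact (g ` trap R)"
    by (intro compact_continuous_image continuous_on_subset[OF g trap_subset] compact_trap)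
  from compact_imp_bounded[OF this] show ?thesis using that unfolding bounded_iff by auto
qed

lemma min_radius_nonneg: "0 \<le> min_radius"
proof -
  obtain j where "j \<in> J" using J_nonempty by blast
  then have "0 \<le> Max ((\<lambda>j. d base (w j base)) ` J)"
    using finite_J d_nonneg by (intro Max_ge_iff[THEN iffD2]) auto
  then show ?thesis using q by (simp add: min_radius_def)
qed

lemma base_in_trap: "min_radius \<le> R \<Longrightarrow> base \<in> trap R"
  using base_in d_zero[OF base_in base_in] min_radius_nonneg by (simp add: trap_def)

text \<open>
  A map moves the base point by at most $(1-q)$ times \<open>min_radius\<close> and shrinks the distance to
  its image by $q$, so large balls around the base point are invariant. They exhaust the space.
\<close>

lemma w_trap:
  assumes R: "min_radius \<le> R" and j: "j \<in> J" and x: "x \<in> trap R"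
  shows "w j x \<in> trap R"
proof -
  have "d base (w j base) \<le> Max ((\<lambda>j. d base (w j base)) ` J)"
    using finite_J j by auto
  also have "\<dots> = min_radius * (1 - q)" using q by (simp add: min_radius_def)
  also have "\<dots> \<le> R * (1 - q)" using R q by (intro mult_right_mono) auto
  finally have a: "d base (w j base) \<le> R * (1 - q)" .
  have "d base (w j x) \<le> d base (w j base) + d (w j base) (w j x)" by (rule d_triangle)
  also have "d (w j base) (w j x) \<le> q * d base x"
    using x j base_in by (intro w_contract) (auto simp: trap_def)
  also have "q * d base x \<le> q * R" using x q by (intro mult_left_mono) (auto simp: trap_def)
  finally have "d base (w j x) \<le> R" using a by (simp add: algebra_simps)
  then show ?thesis using x w_in[OF j] by (simp add: trap_def)
qed

lemma trap_diameter: "x \<in> trap R \<Longrightarrow> y \<in> trap R \<Longrightarrow> d x y \<le> 2 * R"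
  using d_triangle[of x y base] d_sym[of x base] by (auto simp: trap_def)

lemma transfer_bounds:
  assumes R: "min_radius \<le> R" and f: "\<And>x. x \<in> trap R \<Longrightarrow> a \<le> f x \<and> f x \<le> b" and x: "x \<in> trap R"
  shows "a \<le> transfer f x \<and> transfer f x \<le> b"
proof -
  have xX: "x \<in> X" using x trap_subset by auto
  have "(\<Sum>j\<in>J. p j x * a) \<le> transfer f x" "transfer f x \<le> (\<Sum>j\<in>J. p j x * b)"
    unfolding transfer_def using f w_trap[OF R _ x] p_nonneg[OF _ xX]
    by (auto intro!: sum_mono mult_left_mono)
  then show ?thesis using p_sum[OF xX] by (simp add: sum_distrib_right[symmetric])
qed

lemma transfer_iter_bounds:
  assumes R: "min_radius \<le> R" and f: "\<And>x. x \<in> trap R \<Longrightarrow> a \<le> f x \<and> f x \<le> b"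
  shows "x \<in> trap R \<Longrightarrow> a \<le> (transfer ^^ n) f x \<and> (transfer ^^ n) f x \<le> b"
proof (induction n arbitrary: x)
  case (Suc n)
  show ?case using transfer_bounds[OF R Suc.IH Suc.prems] by simp
qed (use f in simp)

lemma transfer_iter_osc:
  assumes R: "min_radius \<le> R" and f: "\<And>x y. x \<in> trap R \<Longrightarrow> y \<in> trap R \<Longrightarrow> \<bar>f x - f y\<bar> \<le> M"
    and x: "x \<in> trap R" and y: "y \<in> trap R"
  shows "\<bar>(transfer ^^ n) f x - (transfer ^^ n) f y\<bar> \<le> M"
proof -
  have "f z - M \<le> (transfer ^^ n) f u \<and> (transfer ^^ n) f u \<le> f z + M"
    if "z \<in> trap R" "u \<in> trap R" for z u
    by (rule transfer_iter_bounds[OF R _ that(2)]) (use f[OF _ that(1)] in fastforce)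
  then have "(transfer ^^ n) f y - M \<le> f z \<and> f z \<le> (transfer ^^ n) f y + M" if "z \<in> trap R" for z
    using that y by (smt (verit))
  then have "(transfer ^^ n) f y - M \<le> (transfer ^^ n) f x \<and> (transfer ^^ n) f x \<le> (transfer ^^ n) f y + M"
    by (rule transfer_iter_bounds[OF R _ x])
  then show ?thesis by linarith
qed

text \<open>
  The heart of the argument. Two chains started in a ball use the same maps for the next $m$ steps
  with probability at least \<open>\<theta>\<close>, whatever $m$ is; after that they are $2Rq^m$-close, and \<open>f\<close> differs by
  at most \<open>\<epsilon>\<close> at their positions. In the other case the difference is at most the
  oscillation \<open>M\<close>. The failure probability at distance $2Rq^k$ is at most \<open>e k\<close>, which
  is summable by the Dini condition and stays below $1 - \delta$ because every
  common choice has probability at least \<open>\<delta>\<close>.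
\<close>

lemma synchronisation:
  assumes R: "min_radius \<le> R"
  obtains \<theta> where "0 < \<theta>" "\<theta> \<le> 1" "\<And>f m M \<epsilon> x y.
    \<lbrakk>\<And>x y. x \<in> trap R \<Longrightarrow> y \<in> trap R \<Longrightarrow> \<bar>f x - f y\<bar> \<le> M;
     \<And>x y. x \<in> trap R \<Longrightarrow> y \<in> trap R \<Longrightarrow> d x y \<le> 2 * R * q ^ m \<Longrightarrow> \<bar>f x - f y\<bar> \<le> \<epsilon>;
     \<epsilon> \<le> M; x \<in> trap R; y \<in> trap R\<rbrakk>
    \<Longrightarrow> \<bar>(transfer ^^ m) f x - (transfer ^^ m) f y\<bar> \<le> \<theta> * \<epsilon> + (1 - \<theta>) * M"
proof -
  obtain \<eta> where \<eta>: "summable \<eta>"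
    "\<And>k x y j. x \<in> X \<Longrightarrow> y \<in> X \<Longrightarrow> d x y \<le> 2 * R * q ^ k \<Longrightarrow> j \<in> J \<Longrightarrow> \<bar>p j x - p j y\<bar> \<le> \<eta> k"
    using p_variation[of "2 * R"] by metis
  obtain j0 where j0: "j0 \<in> J" using J_nonempty by blast
  have R0: "0 \<le> R" using R min_radius_nonneg by linarith
  have \<eta>0: "0 \<le> \<eta> k" for k
    using \<eta>(2)[OF base_in base_in _ j0, of k] d_zero[OF base_in base_in] R0 q by simp
  define e where "e k = min (real (card J) * \<eta> k) (1 - \<delta>)" for k
  have \<delta>1: "\<delta> \<le> 1"
  proof -
    have "\<delta> \<le> p j0 base" by (rule p_ge[OF j0 base_in])
    also have "\<dots> \<le> (\<Sum>j\<in>J. p j base)"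
      using finite_J j0 p_nonneg[OF _ base_in] by (intro member_le_sum) auto
    finally show ?thesis using p_sum[OF base_in] by simp
  qed
  have e0: "0 \<le> e k" and e1: "e k \<le> 1 - \<delta>" for k using \<eta>0 \<delta>1 by (auto simp: e_def)
  have sum_e: "summable e"
  proof (rule summable_comparison_test')
    show "summable (\<lambda>k. real (card J) * \<eta> k)" using \<eta>(1) by (rule summable_mult)
    show "norm (e k) \<le> real (card J) * \<eta> k" if "k \<ge> 0" for k
      using e0[of k] by (auto simp: e_def)
  qed
  note prod_ge = prod_one_minus_ge[OF sum_e e0 e1 \<delta>]
  define \<theta> where "\<theta> = exp (- suminf e / \<delta>)"
  have overlap: "1 - e k \<le> (\<Sum>j\<in>J. min (p j x) (p j y))"
    if xy: "x \<in> X" "y \<in> X" and close: "d x y \<le> 2 * R * q ^ k" for x y k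
  proof -
    have "1 - (\<Sum>j\<in>J. min (p j x) (p j y)) = (\<Sum>j\<in>J. p j x - min (p j x) (p j y))"
      using p_sum[OF xy(1)] by (simp add: sum_subtractf)
    also have "\<dots> \<le> (\<Sum>j\<in>J. \<eta> k)"
      using \<eta>(2)[OF xy close] by (intro sum_mono) fastforce
    finally have 1: "1 - (\<Sum>j\<in>J. min (p j x) (p j y)) \<le> real (card J) * \<eta> k" by simp
    have "\<delta> \<le> min (p j0 x) (p j0 y)" using p_ge[OF j0] xy by simp
    also have "\<dots> \<le> (\<Sum>j\<in>J. min (p j x) (p j y))"
      using finite_J j0 p_nonneg xy by (intro member_le_sum) auto
    finally show ?thesis using 1 by (auto simp: e_def)
  qed
  show ?thesis
  proof (rule that[of \<theta>])
    show "0 < \<theta>" by (simp add: \<theta>_def)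
    show "\<theta> \<le> 1"
      using suminf_nonneg[OF sum_e e0] \<delta> by (simp add: \<theta>_def)
  next
    fix f :: "'a \<Rightarrow> real" and m :: nat and M \<epsilon> :: real and x y
    assume osc: "\<And>x y. x \<in> trap R \<Longrightarrow> y \<in> trap R \<Longrightarrow> \<bar>f x - f y\<bar> \<le> M"
      and near: "\<And>x y. x \<in> trap R \<Longrightarrow> y \<in> trap R \<Longrightarrow> d x y \<le> 2 * R * q ^ m \<Longrightarrow> \<bar>f x - f y\<bar> \<le> \<epsilon>"
      and "\<epsilon> \<le> M" and x: "x \<in> trap R" and y: "y \<in> trap R"
    have main: "\<bar>(transfer ^^ i) f x - (transfer ^^ i) f y\<bar>
        \<le> (\<Prod>l<i. 1 - e (k + l)) * \<epsilon> + (1 - (\<Prod>l<i. 1 - e (k + l))) * M"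
      if "k + i = m" "x \<in> trap R" "y \<in> trap R" "d x y \<le> 2 * R * q ^ k" for k i x y
      using that
    proof (induction i arbitrary: k x y)
      case 0
      then show ?case using near by simp
    next
      case (Suc i)
      let ?\<pi> = "\<Prod>l<i. 1 - e (Suc k + l)"
      let ?T = "?\<pi> * \<epsilon> + (1 - ?\<pi>) * M"
      have X: "x \<in> X" "y \<in> X" using Suc.prems trap_subset by auto
      have \<pi>0: "0 \<le> ?\<pi>" using e1 \<delta> by (intro prod_nonneg) (smt (verit))
      have T: "?T \<le> M"
        using mult_left_mono[OF \<open>\<epsilon> \<le> M\<close> \<pi>0] by (simp add: algebra_simps)
      \<comment> \<open>If both chains choose \<open>j\<close>, their distance drops to the next scale and the induction hypothesis applies.\<close>
      have near': "\<bar>(transfer ^^ i) f (w j x) - (transfer ^^ i) f (w j y)\<bar> \<le> ?T" if j: "j \<in> J" for j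
      proof (rule Suc.IH)
        show "Suc k + i = m" using Suc.prems by simp
        show "w j x \<in> trap R" "w j y \<in> trap R" using w_trap[OF R j] Suc.prems by auto
        have "d (w j x) (w j y) \<le> q * d x y" by (rule w_contract[OF j X])
        also have "\<dots> \<le> q * (2 * R * q ^ k)" using Suc.prems q by (intro mult_left_mono) auto
        finally show "d (w j x) (w j y) \<le> 2 * R * q ^ Suc k" by (simp add: algebra_simps)
      qed
      have far': "\<bar>(transfer ^^ i) f (w j x) - (transfer ^^ i) f (w j' y)\<bar> \<le> M" if "j \<in> J" "j' \<in> J" for j j'
        using w_trap[OF R] that Suc.prems by (intro transfer_iter_osc[OF R osc]) auto
      have "\<bar>(transfer ^^ Suc i) f x - (transfer ^^ Suc i) f y\<bar> \<le> (1 - e k) * ?T + (1 - (1 - e k)) * M"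
        unfolding funpow.simps comp_apply transfer_def[of "(transfer ^^ i) f"]
        using overlap[OF X Suc.prems(4)] T near' far' p_nonneg X p_sum
        by (intro overlap_estimate) auto
      also have "\<dots> = (1 - e k) * ?\<pi> * \<epsilon> + (1 - (1 - e k) * ?\<pi>) * M"
        by (simp add: algebra_simps)
      also have "(1 - e k) * ?\<pi> = (\<Prod>l<Suc i. 1 - e (k + l))"
        by (subst prod.lessThan_Suc_shift) simp
      finally show ?case .
    qed
    let ?\<pi> = "\<Prod>l<m. 1 - e (0 + l)"
    have "\<bar>(transfer ^^ m) f x - (transfer ^^ m) f y\<bar> \<le> ?\<pi> * \<epsilon> + (1 - ?\<pi>) * M"
      using x y trap_diameter[OF x y] by (intro main) auto
    also have "\<dots> = M - ?\<pi> * (M - \<epsilon>)" by (simp add: algebra_simps)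
    also have "\<dots> \<le> M - \<theta> * (M - \<epsilon>)"
      using prod_ge[of 0 m] \<open>\<epsilon> \<le> M\<close> unfolding \<theta>_def
      by (intro diff_left_mono mult_right_mono) auto
    finally show "\<bar>(transfer ^^ m) f x - (transfer ^^ m) f y\<bar> \<le> \<theta> * \<epsilon> + (1 - \<theta>) * M"
      by (simp add: algebra_simps)
  qed
qed

text \<open>
  For large \<open>m\<close> uniform continuity makes \<open>\<epsilon>\<close> in the synchronisation estimate half of the oscillation,
  which then shrinks at least by the factor $1 - \theta/2$. The factor does not depend on the function, so the step
  can be repeated with the new function.
\<close>

lemma transfer_iter_osc_tendsto_0:
  assumes R: "min_radius \<le> R" and f: "continuous_on X f" and "0 < \<epsilon>"
  obtains N where "\<And>n x y. N \<le> n \<Longrightarrow> x \<in> trap R \<Longrightarrow> y \<in> trap R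
    \<Longrightarrow> \<bar>(transfer ^^ n) f x - (transfer ^^ n) f y\<bar> \<le> \<epsilon>"
proof -
  obtain \<theta> where \<theta>: "0 < \<theta>" "\<theta> \<le> 1" and sync: "\<And>f m M \<epsilon> x y.
    \<lbrakk>\<And>x y. x \<in> trap R \<Longrightarrow> y \<in> trap R \<Longrightarrow> \<bar>f x - f y\<bar> \<le> M;
     \<And>x y. x \<in> trap R \<Longrightarrow> y \<in> trap R \<Longrightarrow> d x y \<le> 2 * R * q ^ m \<Longrightarrow> \<bar>f x - f y\<bar> \<le> \<epsilon>;
     \<epsilon> \<le> M; x \<in> trap R; y \<in> trap R\<rbrakk>
    \<Longrightarrow> \<bar>(transfer ^^ m) f x - (transfer ^^ m) f y\<bar> \<le> \<theta> * \<epsilon> + (1 - \<theta>) * M"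
    using synchronisation[OF R] by blast
  have halve: "\<exists>m. \<forall>x\<in>trap R. \<forall>y\<in>trap R. \<bar>(transfer ^^ m) g x - (transfer ^^ m) g y\<bar> \<le> (1 - \<theta> / 2) * M"
    if g: "continuous_on X g" and M: "0 < M" and osc: "\<forall>x\<in>trap R. \<forall>y\<in>trap R. \<bar>g x - g y\<bar> \<le> M" for g M
  proof -
    obtain m where m: "\<And>n x y. m \<le> n \<Longrightarrow> x \<in> trap R \<Longrightarrow> y \<in> trap R \<Longrightarrow> d x y \<le> 2 * R * q ^ n
        \<Longrightarrow> dist (g x) (g y) < M / 2"
      using compact_uniform_geometric[OF compact_trap trap_subset continuous_on_subset[OF g trap_subset],
          of "M / 2" R "2 * R"] M by (metis half_gt_zero)
    have "\<bar>(transfer ^^ m) g x - (transfer ^^ m) g y\<bar> \<le> \<theta> * (M / 2) + (1 - \<theta>) * M"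
      if "x \<in> trap R" "y \<in> trap R" for x y
    proof (rule sync[OF _ _ _ that])
      show "\<bar>g x - g y\<bar> \<le> M / 2" if "x \<in> trap R" "y \<in> trap R" "d x y \<le> 2 * R * q ^ m" for x y
        using m[OF order_refl that] by (simp add: dist_real_def)
    qed (use osc M in auto)
    moreover have "\<theta> * (M / 2) + (1 - \<theta>) * M = (1 - \<theta> / 2) * M" by (simp add: algebra_simps)
    ultimately show ?thesis by auto
  qed
  obtain B where B: "\<And>x. x \<in> trap R \<Longrightarrow> \<bar>f x\<bar> \<le> B" using bounded_on_trap[OF f] by blast
  define M where "M = 2 * \<bar>B\<bar> + 1"
  have M: "0 < M" by (simp add: M_def)
  have osc: "\<forall>x\<in>trap R. \<forall>y\<in>trap R. \<bar>f x - f y\<bar> \<le> M"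
  proof (intro ballI)
    fix x y assume "x \<in> trap R" "y \<in> trap R"
    then show "\<bar>f x - f y\<bar> \<le> M" using B[of x] B[of y] by (simp add: M_def)
  qed
  have iter: "\<exists>m. \<forall>x\<in>trap R. \<forall>y\<in>trap R. \<bar>(transfer ^^ m) f x - (transfer ^^ m) f y\<bar> \<le> (1 - \<theta> / 2) ^ r * M" for r
  proof (induction r)
    case 0
    show ?case by (rule exI[of _ 0]) (use osc in simp)
  next
    case (Suc r)
    then obtain m where m: "\<forall>x\<in>trap R. \<forall>y\<in>trap R. \<bar>(transfer ^^ m) f x - (transfer ^^ m) f y\<bar> \<le> (1 - \<theta> / 2) ^ r * M"
      by blast
    have "0 < (1 - \<theta> / 2) ^ r * M" using \<theta> M by simp
    from halve[OF transfer_iter_continuous[OF f] this m] obtain m' where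
      "\<forall>x\<in>trap R. \<forall>y\<in>trap R. \<bar>(transfer ^^ m') ((transfer ^^ m) f) x - (transfer ^^ m') ((transfer ^^ m) f) y\<bar>
        \<le> (1 - \<theta> / 2) * ((1 - \<theta> / 2) ^ r * M)" by blast
    then show ?case
      by (intro exI[of _ "m' + m"]) (simp add: funpow_add mult.assoc)
  qed
  have "(\<lambda>r. (1 - \<theta> / 2) ^ r * M) \<longlonglongrightarrow> 0 * M"
    using \<theta> by (intro tendsto_mult_right LIMSEQ_power_zero) auto
  then have "\<forall>\<^sub>F r in sequentially. (1 - \<theta> / 2) ^ r * M < \<epsilon>"
    using \<open>0 < \<epsilon>\<close> by (intro order_tendstoD(2)) auto
  then obtain r where r: "(1 - \<theta> / 2) ^ r * M < \<epsilon>" by (auto simp: eventually_sequentially)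
  from iter[of r] obtain N where N:
    "\<forall>x\<in>trap R. \<forall>y\<in>trap R. \<bar>(transfer ^^ N) f x - (transfer ^^ N) f y\<bar> \<le> (1 - \<theta> / 2) ^ r * M" by blast
  show ?thesis
  proof (rule that[of N])
    fix n x y assume "N \<le> n" and xy: "x \<in> trap R" "y \<in> trap R"
    have "\<bar>(transfer ^^ (n - N)) ((transfer ^^ N) f) x - (transfer ^^ (n - N)) ((transfer ^^ N) f) y\<bar> \<le> \<epsilon>"
      by (rule transfer_iter_osc[OF R _ xy]) (use N r in fastforce)
    also have "(transfer ^^ (n - N)) ((transfer ^^ N) f) = (transfer ^^ n) f"
      using \<open>N \<le> n\<close> funpow_add[of "n - N" N transfer] by simp
    finally show "\<bar>(transfer ^^ n) f x - (transfer ^^ n) f y\<bar> \<le> \<epsilon>" .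
  qed
qed

text \<open>
  The functional $\Lambda$: for continuous \<open>f\<close> the iterates converge to this number at every point.
\<close>

definition limit_value :: "('a \<Rightarrow> real) \<Rightarrow> real" where
  "limit_value f = lim (\<lambda>n. (transfer ^^ n) f base)"

text \<open>
  The value of $P^m f$ at the base point is an average of values of $P^n f$ on the ball for
  $n \le m$, hence within the oscillation of $P^n f$ of each of them. This gives convergence at the
  base point and uniform convergence on the ball at once.
\<close>

lemma transfer_iter_uniform_limit:
  assumes R: "min_radius \<le> R" and f: "continuous_on X f" and "0 < \<epsilon>"
  obtains N where "\<And>n x. N \<le> n \<Longrightarrow> x \<in> trap R \<Longrightarrow> \<bar>(transfer ^^ n) f x - limit_value f\<bar> \<le> \<epsilon>"
proof -
  have near: "\<exists>N. \<forall>n\<ge>N. \<forall>m\<ge>n. \<forall>x\<in>trap R. \<bar>(transfer ^^ n) f x - (transfer ^^ m) f base\<bar> \<le> \<epsilon>"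
    if pos: "0 < \<epsilon>" for \<epsilon>
  proof -
    obtain N where N: "\<And>n x y. N \<le> n \<Longrightarrow> x \<in> trap R \<Longrightarrow> y \<in> trap R
        \<Longrightarrow> \<bar>(transfer ^^ n) f x - (transfer ^^ n) f y\<bar> \<le> \<epsilon>"
      using transfer_iter_osc_tendsto_0[OF R f pos] by blast
    have "\<bar>(transfer ^^ n) f x - (transfer ^^ m) f base\<bar> \<le> \<epsilon>" if "N \<le> n" "n \<le> m" "x \<in> trap R" for n m x
    proof -
      have "(transfer ^^ m) f = (transfer ^^ (m - n)) ((transfer ^^ n) f)"
        using \<open>n \<le> m\<close> funpow_add[of "m - n" n transfer] by simp
      moreover have "(transfer ^^ n) f x - \<epsilon> \<le> (transfer ^^ (m - n)) ((transfer ^^ n) f) base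
          \<and> (transfer ^^ (m - n)) ((transfer ^^ n) f) base \<le> (transfer ^^ n) f x + \<epsilon>"
        by (rule transfer_iter_bounds[OF R _ base_in_trap[OF R]])
          (use N[OF \<open>N \<le> n\<close> _ \<open>x \<in> trap R\<close>] in fastforce)
      ultimately show ?thesis by (simp add: abs_le_iff)
    qed
    then show ?thesis by blast
  qed
  have "Cauchy (\<lambda>n. (transfer ^^ n) f base)"
  proof (rule CauchyI')
    fix e :: real assume "0 < e"
    then obtain N where N: "\<forall>n\<ge>N. \<forall>m\<ge>n. \<forall>x\<in>trap R. \<bar>(transfer ^^ n) f x - (transfer ^^ m) f base\<bar> \<le> e / 2"
      using near[of "e / 2"] by auto
    have "dist ((transfer ^^ m) f base) ((transfer ^^ n) f base) < e" if "N \<le> m" "m < n" for m n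
    proof -
      have "\<bar>(transfer ^^ m) f base - (transfer ^^ n) f base\<bar> \<le> e / 2"
        using N base_in_trap[OF R] that by simp
      then show ?thesis using \<open>0 < e\<close> by (simp add: dist_real_def)
    qed
    then show "\<exists>M. \<forall>m\<ge>M. \<forall>n>m. dist ((transfer ^^ m) f base) ((transfer ^^ n) f base) < e"
      by blast
  qed
  then have conv: "(\<lambda>n. (transfer ^^ n) f base) \<longlonglongrightarrow> limit_value f"
    by (simp add: limit_value_def real_Cauchy_convergent convergent_LIMSEQ_iff[symmetric])
  from near[OF \<open>0 < \<epsilon>\<close>] obtain N where
    N: "\<forall>n\<ge>N. \<forall>m\<ge>n. \<forall>x\<in>trap R. \<bar>(transfer ^^ n) f x - (transfer ^^ m) f base\<bar> \<le> \<epsilon>" by blast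
  show ?thesis
  proof (rule that[of N])
    fix n x assume n: "N \<le> n" and x: "x \<in> trap R"
    have "(\<lambda>m. \<bar>(transfer ^^ n) f x - (transfer ^^ m) f base\<bar>) \<longlonglongrightarrow> \<bar>(transfer ^^ n) f x - limit_value f\<bar>"
      by (intro tendsto_intros conv)
    then show "\<bar>(transfer ^^ n) f x - limit_value f\<bar> \<le> \<epsilon>"
      by (rule LIMSEQ_le_const2) (use N n x in blast)
  qed
qed

lemma transfer_iter_tendsto:
  assumes f: "continuous_on X f" and x: "x \<in> X"
  shows "(\<lambda>n. (transfer ^^ n) f x) \<longlonglongrightarrow> limit_value f"
proof (rule LIMSEQ_I)
  fix r :: real assume "0 < r"
  define R where "R = max min_radius (d base x)"
  have R: "min_radius \<le> R" and xR: "x \<in> trap R" using x by (auto simp: R_def trap_def)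
  obtain N where "\<And>n x. N \<le> n \<Longrightarrow> x \<in> trap R \<Longrightarrow> \<bar>(transfer ^^ n) f x - limit_value f\<bar> \<le> r / 2"
    using transfer_iter_uniform_limit[OF R f, of "r / 2"] \<open>0 < r\<close> by auto
  then show "\<exists>no. \<forall>n\<ge>no. norm ((transfer ^^ n) f x - limit_value f) < r"
    using xR \<open>0 < r\<close> by (intro exI[of _ N]) fastforce
qed

lemma limit_valueI:
  assumes f: "continuous_on X f" and l: "(\<lambda>n. (transfer ^^ n) f base) \<longlonglongrightarrow> l"
  shows "limit_value f = l"
  using LIMSEQ_unique[OF transfer_iter_tendsto[OF f base_in] l] .

text \<open>
  Passing from \<open>f\<close> to \<open>transfer f\<close> shifts the convergent sequence by one; this is the invariance
  of the measure that will represent the functional.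
\<close>

lemma limit_value_transfer:
  assumes f: "continuous_on X f" shows "limit_value (transfer f) = limit_value f"
proof (rule limit_valueI[OF transfer_continuous[OF f]])
  have "(\<lambda>n. (transfer ^^ Suc n) f base) \<longlonglongrightarrow> limit_value f"
    using transfer_iter_tendsto[OF f base_in] by (rule LIMSEQ_Suc)
  then show "(\<lambda>n. (transfer ^^ n) (transfer f) base) \<longlonglongrightarrow> limit_value f"
    by (simp only: funpow_Suc_right comp_apply)
qed

lemma limit_value_sum:
  assumes f: "\<And>i. i \<in> I \<Longrightarrow> continuous_on X (f i)"
  shows "limit_value (\<lambda>x. \<Sum>i\<in>I. f i x) = (\<Sum>i\<in>I. limit_value (f i))"
proof (rule limit_valueI)
  have "(transfer ^^ n) (\<lambda>x. \<Sum>i\<in>I. f i x) = (\<lambda>x. \<Sum>i\<in>I. (transfer ^^ n) (f i) x)" for n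
  proof (induction n)
    case (Suc n)
    show ?case
      unfolding funpow.simps comp_apply Suc.IH
      by (simp only: transfer_def sum_distrib_left) (intro ext, rule sum.swap)
  qed simp
  then show "(\<lambda>n. (transfer ^^ n) (\<lambda>x. \<Sum>i\<in>I. f i x) base) \<longlonglongrightarrow> (\<Sum>i\<in>I. limit_value (f i))"
    using transfer_iter_tendsto[OF f base_in] by (simp add: tendsto_sum)
qed (intro continuous_on_sum f)

lemma limit_value_cmult:
  assumes f: "continuous_on X f"
  shows "limit_value (\<lambda>x. c * f x) = c * limit_value f"
proof (rule limit_valueI)
  have "(transfer ^^ n) (\<lambda>x. c * f x) = (\<lambda>x. c * (transfer ^^ n) f x)" for n
  proof (induction n)
    case (Suc n)
    show ?case
      unfolding funpow.simps comp_apply Suc.IH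
      by (simp only: transfer_def sum_distrib_left mult.left_commute)
  qed simp
  then show "(\<lambda>n. (transfer ^^ n) (\<lambda>x. c * f x) base) \<longlonglongrightarrow> c * limit_value f"
    using transfer_iter_tendsto[OF f base_in] by (simp add: tendsto_mult_left)
qed (intro continuous_intros f)

lemma limit_value_mono:
  assumes f: "continuous_on X f" and g: "continuous_on X g"
    and R: "min_radius \<le> R" and le: "\<And>x. x \<in> trap R \<Longrightarrow> f x \<le> g x"
  shows "limit_value f \<le> limit_value g"
proof (rule LIMSEQ_le[OF transfer_iter_tendsto[OF f base_in] transfer_iter_tendsto[OF g base_in]])
  have "(transfer ^^ n) f x \<le> (transfer ^^ n) g x" if "x \<in> trap R" for n x
    using that
  proof (induction n arbitrary: x)
    case (Suc n)
    then show ?case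
      using w_trap[OF R _ Suc.prems] p_nonneg trap_subset[of R]
      by (auto simp: transfer_def intro!: sum_mono mult_left_mono)
  qed (use le in simp)
  then show "\<exists>N. \<forall>n\<ge>N. (transfer ^^ n) f base \<le> (transfer ^^ n) g base"
    using base_in_trap[OF R] by blast
qed

lemma limit_value_const: "limit_value (\<lambda>_. c) = c"
proof (rule limit_valueI)
  have "(transfer ^^ n) (\<lambda>_. c) x = c" if "x \<in> X" for n x
    using that
  proof (induction n arbitrary: x)
    case (Suc n)
    then show ?case using p_sum[of x] w_in[OF _ Suc.prems]
      by (simp add: transfer_def sum_distrib_right[symmetric])
  qed simp
  then show "(\<lambda>n. (transfer ^^ n) (\<lambda>_. c) base) \<longlonglongrightarrow> c" using base_in by simp
qed simp

end

section \<open>Markov kernels given by a finite random choice\<close>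

definition choice_kernel ::
    "'a measure \<Rightarrow> 'j set \<Rightarrow> ('j \<Rightarrow> 'a \<Rightarrow> real) \<Rightarrow> ('j \<Rightarrow> 'a \<Rightarrow> 'a) \<Rightarrow> 'a \<Rightarrow> 'a measure" where
  "choice_kernel S J p w x = distr (point_measure J (\<lambda>j. ennreal (p j x))) S (\<lambda>j. w j x)"

locale random_choice =
  fixes S :: "'a measure" and J :: "'j set" and p :: "'j \<Rightarrow> 'a \<Rightarrow> real" and w :: "'j \<Rightarrow> 'a \<Rightarrow> 'a"
  assumes finite_choices: "finite J"
    and map_measurable: "\<And>j. j \<in> J \<Longrightarrow> w j \<in> S \<rightarrow>\<^sub>M S"
    and prob_measurable: "\<And>j. j \<in> J \<Longrightarrow> p j \<in> borel_measurable S"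
    and prob_nonneg: "\<And>j x. j \<in> J \<Longrightarrow> x \<in> space S \<Longrightarrow> 0 \<le> p j x"
    and prob_sum: "\<And>x. x \<in> space S \<Longrightarrow> (\<Sum>j\<in>J. p j x) = 1"
begin

lemma map_into: "x \<in> space S \<Longrightarrow> (\<lambda>j. w j x) \<in> J \<rightarrow> space S"
  using measurable_space[OF map_measurable] by auto

lemma integral_choice_kernel:
  fixes f :: "'a \<Rightarrow> real"
  assumes x: "x \<in> space S" and f: "f \<in> borel_measurable S"
  shows "(\<integral>y. f y \<partial>choice_kernel S J p w x) = (\<Sum>j\<in>J. p j x * f (w j x))"
proof -
  have "(\<integral>y. f y \<partial>choice_kernel S J p w x) = (\<integral>j. f (w j x) \<partial>point_measure J (\<lambda>j. ennreal (p j x)))"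
    unfolding choice_kernel_def using map_into[OF x] f by (subst integral_distr) auto
  also have "\<dots> = (\<Sum>j\<in>J. p j x * f (w j x))"
    using finite_choices prob_nonneg x by (subst lebesgue_integral_point_measure_finite) auto
  finally show ?thesis .
qed

lemma emeasure_choice_kernel:
  assumes x: "x \<in> space S" and A: "A \<in> sets S"
  shows "emeasure (choice_kernel S J p w x) A = ennreal (\<Sum>j\<in>J. p j x * indicator A (w j x))"
proof -
  have "emeasure (choice_kernel S J p w x) A
      = emeasure (point_measure J (\<lambda>j. ennreal (p j x))) {j \<in> J. w j x \<in> A}"
    unfolding choice_kernel_def using map_into[OF x] A
    by (subst emeasure_distr) (auto simp: space_point_measure intro!: arg_cong2[where f=emeasure])
  also have "\<dots> = (\<Sum>j | j \<in> J \<and> w j x \<in> A. ennreal (p j x))"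
    using finite_choices by (subst emeasure_point_measure_finite) auto
  also have "\<dots> = (\<Sum>j\<in>J. ennreal (p j x * indicator A (w j x)))"
    using finite_choices by (intro sum.mono_neutral_cong_left) (auto simp: indicator_def)
  also have "\<dots> = ennreal (\<Sum>j\<in>J. p j x * indicator A (w j x))"
    using prob_nonneg x by (intro sum_ennreal) auto
  finally show ?thesis .
qed

lemma prob_space_choice_kernel: "x \<in> space S \<Longrightarrow> prob_space (choice_kernel S J p w x)"
  using emeasure_choice_kernel[of x "space S"] map_into[of x] prob_sum[of x]
  by (intro prob_spaceI) (auto simp: choice_kernel_def Pi_iff)

lemma choice_kernel_measurable: "choice_kernel S J p w \<in> S \<rightarrow>\<^sub>M prob_algebra S"
proof (intro measurable_prob_algebraI measurable_subprob_algebra prob_space_choice_kernel)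
  fix A assume A: "A \<in> sets S"
  have "(\<lambda>x. ennreal (\<Sum>j\<in>J. p j x * indicator A (w j x))) \<in> borel_measurable S"
    using A by (intro measurable_compose[OF _ measurable_ennreal] borel_measurable_sum
        borel_measurable_times prob_measurable measurable_compose[OF map_measurable borel_measurable_indicator]) auto
  then show "(\<lambda>x. emeasure (choice_kernel S J p w x) A) \<in> borel_measurable S"
    using emeasure_choice_kernel[OF _ A] by (subst measurable_cong) auto
next
  show "subprob_space (choice_kernel S J p w x)" if "x \<in> space S" for x
    using prob_space_choice_kernel[OF that] by (rule prob_space_imp_subprob_space)
qed (simp_all add: choice_kernel_def)

sublocale markov_kernel S "choice_kernel S J p w"
  by standard (rule choice_kernel_measurable)

lemma kernel_op_choice:
  "x \<in> space S \<Longrightarrow> f \<in> borel_measurable S \<Longrightarrow> kernel_op f x = (\<Sum>j\<in>J. p j x * f (w j x))"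
  by (simp add: kernel_op_def integral_choice_kernel)

end

section \<open>Random words and the limit measure\<close>

context contractive_ifs begin

lemma trap_sets: "trap R \<in> sets (restrict_space borel X)"
  using trap_subset compact_imp_closed[OF compact_trap]
  by (auto simp: sets_restrict_space intro!: image_eqI[of _ _ "trap R"])

text \<open>
  The head of a word is the move made first, so that a word grows at its head into the past.
  \<open>word_prob s x\<close> is the probability that the chain started at \<open>x\<close> makes the moves of \<open>s\<close>.
\<close>

primrec word_map :: "'j list \<Rightarrow> 'a \<Rightarrow> 'a" where
  "word_map [] x = x"
| "word_map (j # s) x = word_map s (w j x)"

primrec word_prob :: "'j list \<Rightarrow> 'a \<Rightarrow> real" where
  "word_prob [] x = 1"
| "word_prob (j # s) x = p j x * word_prob s (w j x)"

lemma word_map_in: "s \<in> lists J \<Longrightarrow> x \<in> X \<Longrightarrow> word_map s x \<in> X"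
  by (induction s arbitrary: x) (auto intro: w_in)

lemma word_map_trap: "min_radius \<le> R \<Longrightarrow> s \<in> lists J \<Longrightarrow> x \<in> trap R \<Longrightarrow> word_map s x \<in> trap R"
  by (induction s arbitrary: x) (auto intro: w_trap)

lemma word_map_contract:
  "s \<in> lists J \<Longrightarrow> x \<in> X \<Longrightarrow> y \<in> X \<Longrightarrow> d (word_map s x) (word_map s y) \<le> q ^ length s * d x y"
proof (induction s arbitrary: x y)
  case (Cons j s)
  then have "d (word_map s (w j x)) (word_map s (w j y)) \<le> q ^ length s * d (w j x) (w j y)"
    by (auto intro: w_in)
  also have "\<dots> \<le> q ^ length s * (q * d x y)"
    using Cons.prems q by (intro mult_left_mono w_contract) auto
  finally show ?case by (simp add: mult_ac)
qed simp

lemma word_map_continuous: "s \<in> lists J \<Longrightarrow> continuous_on X (word_map s)"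
proof (induction s)
  case (Cons j s)
  then show ?case
    by (auto intro!: continuous_on_compose2[OF _ w_continuous, where g="word_map s" and t=X] w_in)
qed (simp add: continuous_on_id)

lemma word_prob_continuous: "s \<in> lists J \<Longrightarrow> continuous_on X (word_prob s)"
proof (induction s)
  case (Cons j s)
  then show ?case
    by (auto intro!: continuous_on_mult p_continuous continuous_on_compose2[OF _ w_continuous, where g="word_prob s" and t=X] w_in)
qed simp

lemma word_prob_ge: "s \<in> lists J \<Longrightarrow> x \<in> X \<Longrightarrow> \<delta> ^ length s \<le> word_prob s x"
proof (induction s arbitrary: x)
  case (Cons j s)
  then show ?case using \<delta> by (auto intro!: mult_mono p_ge p_nonneg w_in)
qed simp

text \<open>
  The limiting probability that the most recent moves of the chain spell the word \<open>s\<close>.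
\<close>

definition weight :: "'j list \<Rightarrow> real" where
  "weight s = limit_value (word_prob s)"

lemma weight_pos: assumes s: "s \<in> lists J" shows "0 < weight s"
proof -
  have "limit_value (\<lambda>_. \<delta> ^ length s) \<le> weight s"
    unfolding weight_def using s trap_subset
    by (intro limit_value_mono[OF _ word_prob_continuous order_refl] word_prob_ge) auto
  then show ?thesis using zero_less_power[OF \<delta>, of "length s"] by (simp add: limit_value_const)
qed

text \<open>
  The conditional mean of \<open>f\<close>, in the limit of large times, given that the most recent moves spell \<open>s\<close>.
\<close>

definition cylinder_mean :: "('a \<Rightarrow> real) \<Rightarrow> 'j list \<Rightarrow> real" where
  "cylinder_mean f s = limit_value (\<lambda>x. word_prob s x * f (word_map s x)) / weight s"

lemma word_integrand_continuous:
  assumes "s \<in> lists J" "continuous_on X f"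
  shows "continuous_on X (\<lambda>x. word_prob s x * f (word_map s x))"
  using assms by (intro continuous_on_mult word_prob_continuous
      continuous_on_compose2[OF assms(2) word_map_continuous]) (auto intro: word_map_in)

text \<open>
  Summing over the move before a word amounts to one application of \<open>transfer\<close>, which does not
  change the limit value. With \<open>f = 1\<close> it makes the weights of words consistent; in general it makes
  the cylinder means a martingale.
\<close>

lemma limit_value_split_word:
  assumes s: "s \<in> lists J" and f: "continuous_on X f"
  shows "(\<Sum>j\<in>J. limit_value (\<lambda>x. word_prob (j # s) x * f (word_map (j # s) x)))
    = limit_value (\<lambda>x. word_prob s x * f (word_map s x))"
proof -
  have "(\<Sum>j\<in>J. limit_value (\<lambda>x. word_prob (j # s) x * f (word_map (j # s) x)))
      = limit_value (\<lambda>x. \<Sum>j\<in>J. word_prob (j # s) x * f (word_map (j # s) x))"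
    using s f by (intro limit_value_sum[symmetric] word_integrand_continuous) auto
  also have "(\<lambda>x. \<Sum>j\<in>J. word_prob (j # s) x * f (word_map (j # s) x))
      = transfer (\<lambda>x. word_prob s x * f (word_map s x))"
    by (simp add: transfer_def fun_eq_iff mult.assoc)
  also have "limit_value \<dots> = limit_value (\<lambda>x. word_prob s x * f (word_map s x))"
    by (rule limit_value_transfer[OF word_integrand_continuous[OF s f]])
  finally show ?thesis .
qed

lemma weight_split: "s \<in> lists J \<Longrightarrow> (\<Sum>j\<in>J. weight (j # s)) = weight s"
  using limit_value_split_word[of s "\<lambda>_. 1"] by (simp add: weight_def del: word_prob.simps)

text \<open>
  Given the moves \<open>s\<close>, the state lies in the image of the ball under \<open>s\<close>, and a mean of \<open>f\<close> is as
  close to \<open>c\<close> as all values of \<open>f\<close> on that image.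
\<close>

lemma cylinder_mean_near:
  assumes s: "s \<in> lists J" and f: "continuous_on X f"
    and near: "\<And>x. x \<in> trap min_radius \<Longrightarrow> \<bar>f (word_map s x) - c\<bar> \<le> \<epsilon>"
  shows "\<bar>cylinder_mean f s - c\<bar> \<le> \<epsilon>"
proof -
  note cont = word_integrand_continuous[OF s f] word_prob_continuous[OF s]
  have *: "word_prob s x \<ge> 0" if "x \<in> trap min_radius" for x
    using word_prob_ge[OF s, of x] that trap_subset[of min_radius] zero_less_power[OF \<delta>, of "length s"]
    by (meson less_imp_le order_trans subsetD)
  have near': "c - \<epsilon> \<le> f (word_map s x)" "f (word_map s x) \<le> c + \<epsilon>" if "x \<in> trap min_radius" for x
    using near[OF that] by linarith+
  have "limit_value (\<lambda>x. (c - \<epsilon>) * word_prob s x) \<le> limit_value (\<lambda>x. word_prob s x * f (word_map s x))"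
    using near' * by (intro limit_value_mono[OF _ cont(1) order_refl] continuous_intros cont)
      (subst mult.commute, intro mult_left_mono, auto)
  moreover have "limit_value (\<lambda>x. word_prob s x * f (word_map s x)) \<le> limit_value (\<lambda>x. (c + \<epsilon>) * word_prob s x)"
    using near' * by (intro limit_value_mono[OF cont(1) _ order_refl] continuous_intros cont)
      (subst mult.commute[of "c + \<epsilon>"], intro mult_left_mono, auto)
  ultimately show ?thesis
    using weight_pos[OF s] unfolding limit_value_cmult[OF cont(2)] weight_def[symmetric] cylinder_mean_def
    by (simp add: abs_le_iff field_simps)
qed

text \<open>
  The growing random word is itself a Markov chain on words, with the conditional probability
  \<open>weight (j # s) / weight s\<close> of \<open>j\<close> being the move before \<open>s\<close>. Positive weights keep the quotient
  meaningful, so all facts about trajectories apply to it.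
\<close>

lemma words_random_choice:
  "random_choice (count_space (lists J)) J (\<lambda>j s. weight (j # s) / weight s) (#)"
proof
  show "(\<Sum>j\<in>J. weight (j # s) / weight s) = 1" if "s \<in> space (count_space (lists J))" for s
    using weight_split[of s] weight_pos[of s] that by (simp add: sum_divide_distrib[symmetric])
  show "0 \<le> weight (j # s) / weight s" if "j \<in> J" "s \<in> space (count_space (lists J))" for j s
    using weight_pos[of s] weight_pos[of "j # s"] that by simp
qed (use finite_J in auto)

interpretation words: random_choice "count_space (lists J)" J "\<lambda>j s. weight (j # s) / weight s" "(#)"
  by (rule words_random_choice)

abbreviation word_kernel :: "'j list \<Rightarrow> 'j list measure" where
  "word_kernel \<equiv> choice_kernel (count_space (lists J)) J (\<lambda>j s. weight (j # s) / weight s) (#)"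

abbreviation word_paths :: "(nat \<Rightarrow> 'j list) measure" where
  "word_paths \<equiv> path_measure (count_space (lists J)) word_kernel (return (count_space (lists J)) [])"

lemma return_Nil: "return (count_space (lists J)) [] \<in> space (prob_algebra (count_space (lists J)))"
  by (simp add: space_prob_algebra prob_space_return)

lemma cylinder_mean_bounded:
  assumes f: "continuous_on X f" and B: "\<And>x. x \<in> trap min_radius \<Longrightarrow> \<bar>f x\<bar> \<le> B" and s: "s \<in> lists J"
  shows "\<bar>cylinder_mean f s\<bar> \<le> B"
  using cylinder_mean_near[OF s f, of 0 B] B word_map_trap[OF order_refl s] by simp

text \<open>
  The cylinder means form a martingale along the random word, and at the empty word the mean is the
  limit value itself.
\<close>

lemma integral_cylinder_mean:
  assumes f: "continuous_on X f" and B: "\<And>x. x \<in> trap min_radius \<Longrightarrow> \<bar>f x\<bar> \<le> B"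
  shows "(\<integral>\<omega>. cylinder_mean f (\<omega> n) \<partial>word_paths) = limit_value f"
proof (induction n)
  case 0
  have "(\<integral>\<omega>. cylinder_mean f (\<omega> 0) \<partial>word_paths)
      = (\<integral>s. cylinder_mean f s \<partial>distr word_paths (count_space (lists J)) (\<lambda>\<omega>. \<omega> 0))"
    by (rule integral_distr[OF words.coordinate_measurable[OF return_Nil], symmetric]) simp
  also have "\<dots> = cylinder_mean f []"
    unfolding words.law_0[OF return_Nil] by (subst integral_return) auto
  also have "\<dots> = limit_value f"
  proof -
    have "word_prob [] = (\<lambda>_. 1)" by (simp add: fun_eq_iff)
    then show ?thesis by (simp add: cylinder_mean_def weight_def limit_value_const)
  qed
  finally show ?case .
next
  case (Suc n)
  have "(\<integral>\<omega>. cylinder_mean f (\<omega> (Suc n)) \<partial>word_paths) = (\<integral>\<omega>. words.kernel_op (cylinder_mean f) (\<omega> n) \<partial>word_paths)"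
    by (rule words.integral_path_Suc[OF return_Nil]) (auto intro!: cylinder_mean_bounded[OF f B])
  also have "\<dots> = (\<integral>\<omega>. cylinder_mean f (\<omega> n) \<partial>word_paths)"
  proof (rule Bochner_Integration.integral_cong[OF refl])
    fix \<omega> assume "\<omega> \<in> space word_paths"
    then have s: "\<omega> n \<in> lists J"
      using words.path_coordinate_in[OF return_Nil] by simp
    have "words.kernel_op (cylinder_mean f) (\<omega> n)
        = (\<Sum>j\<in>J. weight (j # \<omega> n) / weight (\<omega> n) * cylinder_mean f (j # \<omega> n))"
      using s by (subst words.kernel_op_choice) auto
    also have "\<dots> = (\<Sum>j\<in>J. limit_value (\<lambda>x. word_prob (j # \<omega> n) x * f (word_map (j # \<omega> n) x)) / weight (\<omega> n))"
    proof (intro sum.cong refl)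
      fix j assume "j \<in> J"
      then have "weight (j # \<omega> n) \<noteq> 0" using s weight_pos[of "j # \<omega> n"] by simp
      then show "weight (j # \<omega> n) / weight (\<omega> n) * cylinder_mean f (j # \<omega> n)
          = limit_value (\<lambda>x. word_prob (j # \<omega> n) x * f (word_map (j # \<omega> n) x)) / weight (\<omega> n)"
        by (simp add: cylinder_mean_def del: word_prob.simps word_map.simps)
    qed
    also have "\<dots> = cylinder_mean f (\<omega> n)"
      by (simp only: sum_divide_distrib[symmetric] limit_value_split_word[OF s f] cylinder_mean_def)
    finally show "words.kernel_op (cylinder_mean f) (\<omega> n) = cylinder_mean f (\<omega> n)" .
  qed
  finally show ?case using Suc.IH by simp
qed

lemma AE_word_growth:
  "AE \<omega> in word_paths. \<omega> 0 = [] \<and> (\<forall>n. \<exists>j\<in>J. \<omega> (Suc n) = j # \<omega> n)"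
proof -
  let ?L = "count_space (lists J)"
  have "AE s in distr word_paths ?L (\<lambda>\<omega>. \<omega> 0). s = []"
    unfolding words.law_0[OF return_Nil] by (subst AE_return) auto
  then have start: "AE \<omega> in word_paths. \<omega> 0 = []"
    by (rule AE_distrD[OF words.coordinate_measurable[OF return_Nil]])
  have "AE \<omega> in word_paths. \<omega> n \<in> {s} \<longrightarrow> \<omega> (Suc n) \<in> (\<lambda>j. j # s) ` J" if s: "s \<in> lists J" for n s
  proof (rule words.AE_path_step[OF return_Nil])
    fix t assume "t \<in> {s}"
    then have t: "t = s" by simp
    have "emeasure (word_kernel s) ((\<lambda>j. j # s) ` J)
        = ennreal (\<Sum>j\<in>J. weight (j # s) / weight s * indicator ((\<lambda>j. j # s) ` J) (j # s))"
      using s by (intro words.emeasure_choice_kernel) auto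
    also have "(\<Sum>j\<in>J. weight (j # s) / weight s * indicator ((\<lambda>j. j # s) ` J) (j # s)) = (\<Sum>j\<in>J. weight (j # s) / weight s)"
      by (intro sum.cong refl) simp
    also have "\<dots> = 1" using s by (intro words.prob_sum) simp
    finally show "emeasure (word_kernel t) ((\<lambda>j. j # s) ` J) = 1" by (simp add: t)
  qed (use s in auto)
  moreover have "countable (lists J)" using finite_J by (intro countable_lists countable_finite)
  ultimately have "AE \<omega> in word_paths. \<forall>n. \<forall>s\<in>lists J. \<omega> n \<in> {s} \<longrightarrow> \<omega> (Suc n) \<in> (\<lambda>j. j # s) ` J"
    by (simp only: AE_all_countable AE_ball_countable) blast
  then show ?thesis
    using start AE_space
  proof eventually_elim
    case (elim \<omega>)
    have "\<exists>j\<in>J. \<omega> (Suc n) = j # \<omega> n" for n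
    proof -
      have "\<omega> n \<in> lists J"
        using words.path_coordinate_in[OF return_Nil elim(3)] by simp
      then have "\<omega> (Suc n) \<in> (\<lambda>j. j # \<omega> n) ` J" using elim(1) by blast
      then show ?thesis by blast
    qed
    then show ?case using elim(2) by blast
  qed
qed

text \<open>
  The images of the ball under a growing word are nested, because new maps act first, and
  the word of length $n$ shrinks diameters by $q^n$. They close in on one point, at which the
  cylinder means of a continuous function converge to its value.
\<close>

lemma word_growth_limit:
  assumes start: "\<omega> 0 = []" and grow: "\<And>n. \<exists>j\<in>J. \<omega> (Suc n) = j # \<omega> n"
  obtains z where "z \<in> trap min_radius" "(\<lambda>n. word_map (\<omega> n) base) \<longlonglongrightarrow> z"
    "\<And>f. continuous_on X f \<Longrightarrow> (\<lambda>n. cylinder_mean f (\<omega> n)) \<longlonglongrightarrow> f z"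
proof -
  let ?B = "trap min_radius"
  have words: "\<omega> n \<in> lists J \<and> length (\<omega> n) = n" for n
  proof (induction n)
    case (Suc n)
    then show ?case using grow[of n] by auto
  qed (simp add: start)
  have base: "base \<in> ?B" by (rule base_in_trap) simp
  have nested: "word_map (\<omega> (n + k)) ` ?B \<subseteq> word_map (\<omega> n) ` ?B" for n k
  proof (induction k)
    case (Suc k)
    obtain j where j: "j \<in> J" "\<omega> (Suc (n + k)) = j # \<omega> (n + k)" using grow by blast
    have "word_map (\<omega> (n + Suc k)) x \<in> word_map (\<omega> (n + k)) ` ?B" if "x \<in> ?B" for x
      using w_trap[OF order_refl j(1) that] by (simp add: j(2))
    then show ?case using Suc.IH by blast
  qed simp
  have small: "d x y \<le> 2 * min_radius * q ^ n" if xy: "x \<in> word_map (\<omega> n) ` ?B" "y \<in> word_map (\<omega> n) ` ?B" for n x y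
  proof -
    obtain x' y' where x': "x = word_map (\<omega> n) x'" "y = word_map (\<omega> n) y'" "x' \<in> ?B" "y' \<in> ?B"
      using xy by blast
    have "d x y \<le> q ^ n * d x' y'"
      using word_map_contract[of "\<omega> n" x' y'] words x' trap_subset[of min_radius] by auto
    also have "\<dots> \<le> q ^ n * (2 * min_radius)"
      using trap_diameter[OF x'(3,4)] q by (intro mult_left_mono) auto
    finally show ?thesis by (simp add: mult_ac)
  qed
  have in_B: "word_map (\<omega> n) ` ?B \<subseteq> ?B" for n
    using words[of n] word_map_trap[OF order_refl, of "\<omega> n"] by blast
  have pts: "word_map (\<omega> (n + k)) base \<in> word_map (\<omega> n) ` ?B" for n k
    using nested[of n k] base by blast
  have "Cauchy (\<lambda>n. word_map (\<omega> n) base)"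
  proof (rule CauchyI')
    fix e :: real assume "0 < e"
    obtain N where N: "\<And>n x y. N \<le> n \<Longrightarrow> x \<in> ?B \<Longrightarrow> y \<in> ?B \<Longrightarrow> d x y \<le> 2 * min_radius * q ^ n \<Longrightarrow> dist x y < e"
      using compact_uniform_geometric[OF compact_trap trap_subset continuous_on_id \<open>0 < e\<close>] by blast
    have "dist (word_map (\<omega> m) base) (word_map (\<omega> n) base) < e" if "N \<le> m" "m < n" for m n
    proof -
      have 1: "word_map (\<omega> m) base \<in> word_map (\<omega> m) ` ?B" "word_map (\<omega> n) base \<in> word_map (\<omega> m) ` ?B"
        using pts[of m 0] pts[of m "n - m"] that by auto
      show ?thesis
        by (rule N[OF that(1) subsetD[OF in_B 1(1)] subsetD[OF in_B 1(2)] small[OF 1]])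
    qed
    then show "\<exists>M. \<forall>m\<ge>M. \<forall>n>m. dist (word_map (\<omega> m) base) (word_map (\<omega> n) base) < e" by blast
  qed
  moreover have base_B: "word_map (\<omega> n) base \<in> ?B" for n
    using in_B[of n] base by blast
  ultimately obtain z where z: "z \<in> ?B" "(\<lambda>n. word_map (\<omega> n) base) \<longlonglongrightarrow> z"
    using completeE[OF compact_imp_complete[OF compact_trap[of min_radius]], of "\<lambda>n. word_map (\<omega> n) base"]
    by metis
  have "(\<lambda>n. cylinder_mean f (\<omega> n)) \<longlonglongrightarrow> f z" if f: "continuous_on X f" for f
  proof -
    have fz: "(\<lambda>n. f (word_map (\<omega> n) base)) \<longlonglongrightarrow> f z"
      using z(1) base_B trap_subset[of min_radius]
      by (intro continuous_on_tendsto_compose[OF f z(2)] always_eventually) blast+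
    have "(\<lambda>n. cylinder_mean f (\<omega> n) - f (word_map (\<omega> n) base)) \<longlonglongrightarrow> 0"
    proof (rule LIMSEQ_I)
      fix r :: real assume "0 < r"
      then have r: "0 < r / 2" by simp
      obtain N where N: "\<And>n x y. N \<le> n \<Longrightarrow> x \<in> ?B \<Longrightarrow> y \<in> ?B \<Longrightarrow> d x y \<le> 2 * min_radius * q ^ n \<Longrightarrow> dist (f x) (f y) < r / 2"
        using compact_uniform_geometric[OF compact_trap trap_subset continuous_on_subset[OF f trap_subset] r] by blast
      have "\<bar>cylinder_mean f (\<omega> n) - f (word_map (\<omega> n) base)\<bar> \<le> r / 2" if "N \<le> n" for n
      proof (rule cylinder_mean_near[OF _ f])
        show "\<omega> n \<in> lists J" using words by blast
        fix x assume "x \<in> ?B"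
        then have 1: "word_map (\<omega> n) x \<in> word_map (\<omega> n) ` ?B" "word_map (\<omega> n) base \<in> word_map (\<omega> n) ` ?B"
          using base by blast+
        show "\<bar>f (word_map (\<omega> n) x) - f (word_map (\<omega> n) base)\<bar> \<le> r / 2"
          using N[OF that subsetD[OF in_B 1(1)] subsetD[OF in_B 1(2)] small[OF 1]]
          by (simp add: dist_real_def)
      qed
      then show "\<exists>no. \<forall>n\<ge>no. norm (cylinder_mean f (\<omega> n) - f (word_map (\<omega> n) base) - 0) < r"
        using \<open>0 < r\<close> by (intro exI[of _ N]) fastforce
    qed
    from tendsto_add[OF this fz] show ?thesis by simp
  qed
  with z show ?thesis by (rule that)
qed

text \<open>
  The measure is the law of the limit point of the growing random word: dominated convergence
  carries the constant expectations of the cylinder means to the expectation of \<open>f\<close> at that point.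
\<close>

lemma limit_value_representation:
  obtains \<mu> where "\<mu> \<in> space (prob_algebra (restrict_space borel X))"
    "AE x in \<mu>. x \<in> trap min_radius"
    "\<And>f. continuous_on X f \<Longrightarrow> (\<integral>x. f x \<partial>\<mu>) = limit_value f"
proof -
  let ?B = "trap min_radius" and ?S = "restrict_space borel X"
  interpret M: prob_space word_paths by (rule words.prob_space_path[OF return_Nil])
  \<comment> \<open>On the null set of badly growing words the limit point is set to \<open>base\<close>, which keeps it measurable.\<close>
  obtain N where N: "N \<in> null_sets word_paths"
    "{\<omega> \<in> space word_paths. \<not> (\<omega> 0 = [] \<and> (\<forall>n. \<exists>j\<in>J. \<omega> (Suc n) = j # \<omega> n))} \<subseteq> N"
    using AE_word_growth unfolding eventually_ae_filter by blast
  define Z where "Z \<omega> = (if \<omega> \<in> N then base else lim (\<lambda>n. word_map (\<omega> n) base))" for \<omega>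
  have good: "Z \<omega> \<in> ?B \<and> (\<lambda>n. word_map (\<omega> n) base) \<longlonglongrightarrow> Z \<omega>
      \<and> (\<forall>f. continuous_on X f \<longrightarrow> (\<lambda>n. cylinder_mean f (\<omega> n)) \<longlonglongrightarrow> f (Z \<omega>))"
    if "\<omega> \<in> space word_paths" "\<omega> \<notin> N" for \<omega>
  proof -
    have "\<omega> 0 = []" "\<And>n. \<exists>j\<in>J. \<omega> (Suc n) = j # \<omega> n" using N(2) that by blast+
    from word_growth_limit[OF this] obtain z where z: "z \<in> ?B" "(\<lambda>n. word_map (\<omega> n) base) \<longlonglongrightarrow> z"
      "\<And>f. continuous_on X f \<Longrightarrow> (\<lambda>n. cylinder_mean f (\<omega> n)) \<longlonglongrightarrow> f z" by blast
    have "Z \<omega> = z" using that(2) limI[OF z(2)] by (simp add: Z_def)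
    then show ?thesis using z by simp
  qed
  have Z_in: "Z \<omega> \<in> ?B" if "\<omega> \<in> space word_paths" for \<omega>
    using good[OF that] base_in_trap[OF order_refl] by (cases "\<omega> \<in> N") (auto simp: Z_def)
  have meas: "(\<lambda>\<omega>. g (\<omega> n)) \<in> borel_measurable word_paths" for g :: "'j list \<Rightarrow> 'c::topological_space" and n
    by (rule measurable_compose[OF words.coordinate_measurable[OF return_Nil]]) simp
  have "Z \<in> borel_measurable word_paths"
  proof (rule borel_measurable_LIMSEQ_metric)
    show "(\<lambda>\<omega>. if \<omega> \<in> N then base else word_map (\<omega> n) base) \<in> borel_measurable word_paths" for n
      using N(1) by (intro measurable_If_set meas measurable_const) auto
    show "(\<lambda>n. if \<omega> \<in> N then base else word_map (\<omega> n) base) \<longlonglongrightarrow> Z \<omega>" if "\<omega> \<in> space word_paths" for \<omega>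
      using good[OF that] by (cases "\<omega> \<in> N") (auto simp: Z_def)
  qed
  then have Z: "Z \<in> word_paths \<rightarrow>\<^sub>M ?S"
    using Z_in trap_subset by (intro measurable_restrict_space2) auto
  show ?thesis
  proof (rule that[of "distr word_paths ?S Z"])
    show "distr word_paths ?S Z \<in> space (prob_algebra ?S)"
      using M.prob_space_distr[OF Z] by (simp add: space_prob_algebra)
    have "{x \<in> space ?S. x \<in> ?B} = ?B"
      using trap_subset by (auto simp: space_restrict_space)
    then have "{x \<in> space ?S. x \<in> ?B} \<in> sets ?S" by (simp only: trap_sets)
    from AE_distr_iff[OF Z this] show "AE x in distr word_paths ?S Z. x \<in> ?B"
      using Z_in by (simp add: AE_I2)
  next
    fix f :: "'a \<Rightarrow> real" assume f: "continuous_on X f"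
    have f_meas: "f \<in> borel_measurable ?S"
      using f by (rule borel_measurable_continuous_on_restrict)
    obtain C where C: "\<And>x. x \<in> ?B \<Longrightarrow> \<bar>f x\<bar> \<le> C" using bounded_on_trap[OF f] by blast
    have "(\<lambda>n. \<integral>\<omega>. cylinder_mean f (\<omega> n) \<partial>word_paths) \<longlonglongrightarrow> (\<integral>\<omega>. f (Z \<omega>) \<partial>word_paths)"
    proof (rule integral_dominated_convergence[where w="\<lambda>_. C"])
      show "AE \<omega> in word_paths. (\<lambda>n. cylinder_mean f (\<omega> n)) \<longlonglongrightarrow> f (Z \<omega>)"
        using AE_not_in[OF N(1)] AE_space by eventually_elim (use good f in blast)
      show "AE \<omega> in word_paths. norm (cylinder_mean f (\<omega> n)) \<le> C" for n
        using words.path_coordinate_in[OF return_Nil]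
        by (intro AE_I2) (auto intro!: cylinder_mean_bounded[OF f C])
    qed (auto intro: meas measurable_compose[OF Z f_meas])
    then have "limit_value f = (\<integral>\<omega>. f (Z \<omega>) \<partial>word_paths)"
      by (simp add: integral_cylinder_mean[OF f C] LIMSEQ_const_iff)
    then show "(\<integral>x. f x \<partial>distr word_paths ?S Z) = limit_value f"
      using integral_distr[OF Z f_meas] by simp
  qed
qed

end

section \<open>Determination by continuous functions, and ergodicity\<close>

lemma prob_algebra_restrictD:
  assumes "Q \<in> space (prob_algebra (restrict_space borel X))"
  shows "prob_space Q" "sets Q = sets (restrict_space borel X)" "space Q = X"
proof -
  show "prob_space Q" and *: "sets Q = sets (restrict_space borel X)"
    using assms by (auto simp: space_prob_algebra)
  show "space Q = X" using sets_eq_imp_space_eq[OF *] by (simp add: space_restrict_space)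
qed

text \<open>
  The indicator of a nonempty closed set \<open>C\<close> is the limit of the bounded continuous functions
  $\max(0, 1 - n \, \mathrm{dist}(x, C))$, and closed sets generate the Borel sets and are stable
  under intersection.
\<close>

lemma prob_measure_eqI_continuous:
  fixes X :: "'a::metric_space set"
  assumes M: "M \<in> space (prob_algebra (restrict_space borel X))"
    and N: "N \<in> space (prob_algebra (restrict_space borel X))" and X: "closed X"
    and eq: "\<And>f :: 'a \<Rightarrow> real. continuous_on X f \<Longrightarrow> bounded (f ` X) \<Longrightarrow> (\<integral>x. f x \<partial>M) = (\<integral>x. f x \<partial>N)"
  shows "M = N"
proof -
  let ?S = "restrict_space borel X"
  note sp = prob_algebra_restrictD(1,2)[OF M] prob_algebra_restrictD(1,2)[OF N]
  note spX = prob_algebra_restrictD(3)[OF M] prob_algebra_restrictD(3)[OF N]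
  have closed_eq: "measure M (C \<inter> X) = measure N (C \<inter> X)" if C: "closed C" "C \<noteq> {}" for C
  proof -
    let ?f = "\<lambda>n x. max 0 (1 - real n * infdist x C)"
    have lim: "(\<lambda>n. \<integral>x. ?f n x \<partial>Q) \<longlonglongrightarrow> measure Q (C \<inter> X)"
      if Q: "prob_space Q" "sets Q = sets ?S" for Q
    proof -
      interpret Q: prob_space Q by fact
      have spQ: "space Q = X"
        using sets_eq_imp_space_eq[OF Q(2)] by (simp add: space_restrict_space)
      have CX: "C \<inter> X \<in> sets Q"
        using C(1) by (auto simp: Q(2) sets_restrict_space intro!: image_eqI[of _ _ C])
      have "?f n \<in> borel_measurable ?S" for n
        by (intro borel_measurable_continuous_on_restrict continuous_intros)
      then have f_meas: "?f n \<in> borel_measurable Q" for n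
        using measurable_cong_sets[OF Q(2) refl] by blast
      have "(\<lambda>n. \<integral>x. ?f n x \<partial>Q) \<longlonglongrightarrow> (\<integral>x. indicator (C \<inter> X) x \<partial>Q)"
      proof (rule integral_dominated_convergence[where w="\<lambda>_. 1"])
        show "AE x in Q. (\<lambda>n. ?f n x) \<longlonglongrightarrow> indicator (C \<inter> X) x"
        proof (rule AE_I2)
          fix x assume x: "x \<in> space Q"
          show "(\<lambda>n. ?f n x) \<longlonglongrightarrow> indicator (C \<inter> X) x"
          proof (cases "x \<in> C")
            case True
            then show ?thesis using x by (simp add: spQ)
          next
            case False
            then have pos: "0 < infdist x C"
              using C in_closed_iff_infdist_zero[of C x] infdist_nonneg[of x C] by linarith
            obtain n0 :: nat where n0: "1 < real n0 * infdist x C"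
              using reals_Archimedean3[OF pos] by blast
            have "?f n x = 0" if "n0 \<le> n" for n
            proof -
              have "real n0 * infdist x C \<le> real n * infdist x C"
                using that pos by (intro mult_right_mono) auto
              then show ?thesis using n0 by simp
            qed
            then have "\<forall>\<^sub>F n in sequentially. ?f n x = indicator (C \<inter> X) x"
              using False by (auto simp: eventually_sequentially)
            then show ?thesis by (rule tendsto_eventually)
          qed
        qed
        show "AE x in Q. norm (?f n x) \<le> 1" for n
          by (intro AE_I2) (auto simp: infdist_nonneg)
      qed (use CX f_meas in auto)
      then show ?thesis using CX by simp
    qed
    have "(\<integral>x. ?f n x \<partial>M) = (\<integral>x. ?f n x \<partial>N)" for n
    proof (rule eq)
      show "bounded (?f n ` X)"
        by (rule boundedI[of _ 1]) (auto simp: infdist_nonneg)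
    qed (intro continuous_intros)
    then show ?thesis
      using lim[OF sp(1,2)] lim[OF sp(3,4)] LIMSEQ_unique by simp
  qed
  have id: "(\<lambda>x. x) \<in> Q \<rightarrow>\<^sub>M borel" if "sets Q = sets ?S" for Q
    by (subst measurable_cong_sets[OF that refl]) (simp add: measurable_restrict_space1)
  have "distr M borel (\<lambda>x. x) = distr N borel (\<lambda>x. x)"
  proof (rule measure_eqI_generator_eq[where E="Collect closed" and \<Omega>=UNIV and A="\<lambda>_. UNIV"])
    show "Int_stable (Collect closed :: 'a set set)" by (auto simp: Int_stable_def)
    show "sets (distr M borel (\<lambda>x. x)) = sigma_sets UNIV (Collect closed)"
      "sets (distr N borel (\<lambda>x. x)) = sigma_sets UNIV (Collect closed)"
      by (simp_all add: borel_eq_closed)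
    fix C :: "'a set" assume "C \<in> Collect closed"
    then have C: "closed C" by simp
    show "emeasure (distr M borel (\<lambda>x. x)) C = emeasure (distr N borel (\<lambda>x. x)) C"
    proof (cases "C = {}")
      case False
      have "emeasure M (C \<inter> X) = emeasure N (C \<inter> X)"
        using closed_eq[OF C False] sp
        by (simp add: finite_measure.emeasure_eq_measure prob_space.finite_measure)
      then show ?thesis
        using C sp by (simp add: emeasure_distr[OF id] spX borel_closed)
    qed simp
  next
    interpret prob_space "distr M borel (\<lambda>x. x)"
      by (rule prob_space.prob_space_distr[OF sp(1) id[OF sp(2)]])
    show "emeasure (distr M borel (\<lambda>x. x)) UNIV \<noteq> \<infinity>" by (simp add: emeasure_eq_measure)
  qed auto
  then have *: "emeasure (distr M borel (\<lambda>x. x)) A = emeasure (distr N borel (\<lambda>x. x)) A" for A by simp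
  show ?thesis
  proof (rule measure_eqI)
    show "sets M = sets N" using sp by simp
    fix A assume "A \<in> sets M"
    then have A: "A \<in> sets ?S" using sp by simp
    then have A': "A \<in> sets borel" "A \<subseteq> X"
      using borel_closed[OF X] by (auto simp: sets_restrict_space_iff)
    show "emeasure M A = emeasure N A"
      using *[of A] A' by (simp add: emeasure_distr id sp spX Int_absorb2)
  qed
qed

context markov_kernel begin

text \<open>
  By invariance, a set from which the chain almost surely does not escape is almost surely not
  entered from outside either. The measure conditioned on such a set is therefore invariant again.
  Unless the set is null, uniqueness identifies it with \<open>\<mu>\<close>, and the set has full measure.
\<close>

lemma ergodic_if_unique_invariant:
  assumes inv: "invariant_measure S K \<mu>"
    and unique: "\<And>\<nu>. invariant_measure S K \<nu> \<Longrightarrow> \<nu> = \<mu>"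
  shows "ergodic_measure S K \<mu>"
  unfolding ergodic_measure_def
proof (intro ballI impI)
  fix A assume A: "A \<in> sets S" and absorbing: "AE x in \<mu>. x \<in> A \<longrightarrow> emeasure (K x) A = 1"
  have \<mu>: "\<mu> \<in> space (prob_algebra S)" and bind: "\<mu> \<bind> K = \<mu>"
    using inv by (auto simp: invariant_measure_def)
  interpret \<mu>: prob_space \<mu> using \<mu> by (simp add: space_prob_algebra)
  have sets_\<mu>: "sets \<mu> = sets S" using \<mu> by (simp add: space_prob_algebra)
  have space_\<mu>: "space \<mu> = space S" by (rule sets_eq_imp_space_eq[OF sets_\<mu>])
  have meas[measurable]: "(\<lambda>x. emeasure (K x) B) \<in> borel_measurable \<mu>" if "B \<in> sets S" for B
    using measurable_compose[OF K_sub measurable_emeasure_subprob_algebra[OF that]]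
      measurable_cong_sets[OF sets_\<mu> refl] by blast
  have Amu[measurable]: "A \<in> sets \<mu>" using A sets_\<mu> by simp
  have inv_eq: "(\<integral>\<^sup>+x. emeasure (K x) B \<partial>\<mu>) = emeasure \<mu> B" if "B \<in> sets S" for B
    using emeasure_bind_prob_algebra[OF \<mu> K that] bind by simp
  have "(\<integral>\<^sup>+x. emeasure (K x) A \<partial>\<mu>)
      = (\<integral>\<^sup>+x. emeasure (K x) A * indicator A x + emeasure (K x) A * indicator (space \<mu> - A) x \<partial>\<mu>)"
    by (intro nn_integral_cong) (auto simp: indicator_def)
  also have "\<dots> = (\<integral>\<^sup>+x. emeasure (K x) A * indicator A x \<partial>\<mu>) + (\<integral>\<^sup>+x. emeasure (K x) A * indicator (space \<mu> - A) x \<partial>\<mu>)"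
    using A by (intro nn_integral_add) auto
  also have "(\<integral>\<^sup>+x. emeasure (K x) A * indicator A x \<partial>\<mu>) = (\<integral>\<^sup>+x. indicator A x \<partial>\<mu>)"
  proof (rule nn_integral_cong_AE)
    show "AE x in \<mu>. emeasure (K x) A * indicator A x = indicator A x"
      using absorbing by eventually_elim (simp add: indicator_def)
  qed
  also have "(\<integral>\<^sup>+x. indicator A x \<partial>\<mu>) = emeasure \<mu> A"
    by (rule nn_integral_indicator[OF Amu])
  finally have "emeasure \<mu> A + 0 = emeasure \<mu> A + (\<integral>\<^sup>+x. emeasure (K x) A * indicator (space \<mu> - A) x \<partial>\<mu>)"
    unfolding inv_eq[OF A] by (simp only: add_0_right)
  then have zero: "(\<integral>\<^sup>+x. emeasure (K x) A * indicator (space \<mu> - A) x \<partial>\<mu>) = 0"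
    unfolding ennreal_add_left_cancel using \<mu>.emeasure_finite[of A] by (metis infinity_ennreal_def)
  have "(\<lambda>x. emeasure (K x) A * indicator (space \<mu> - A) x) \<in> borel_measurable \<mu>"
    by (intro borel_measurable_times_ennreal meas[OF A] borel_measurable_indicator sets.compl_sets Amu)
  from nn_integral_0_iff_AE[OF this] have "AE x in \<mu>. emeasure (K x) A * indicator (space \<mu> - A) x = 0"
    using zero by blast
  \<comment> \<open>No mass enters \<open>A\<close> from outside: the mass that stays inside already accounts for the measure of \<open>A\<close>.\<close>
  then have outside: "AE x in \<mu>. x \<notin> A \<longrightarrow> emeasure (K x) A = 0"
    using AE_space by eventually_elim (auto simp: indicator_def split: if_splits)
  show "emeasure \<mu> A = 0 \<or> emeasure \<mu> A = 1"
  proof (rule disjCI)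
    assume "emeasure \<mu> A \<noteq> 1"
    show "emeasure \<mu> A = 0"
    proof (rule ccontr)
      assume pos: "emeasure \<mu> A \<noteq> 0"
      let ?\<nu> = "uniform_measure \<mu> A"
      have fin: "emeasure \<mu> A \<noteq> \<infinity>" by (simp add: \<mu>.emeasure_eq_measure)
      have \<nu>: "?\<nu> \<in> space (prob_algebra S)"
        using prob_space_uniform_measure[OF pos fin] sets_\<mu> by (simp add: space_prob_algebra)
      have "?\<nu> \<bind> K = ?\<nu>"
      proof (rule measure_eqI)
        show "sets (?\<nu> \<bind> K) = sets ?\<nu>" using sets_bind'[OF \<nu> K] sets_\<mu> by simp
        fix B assume "B \<in> sets (?\<nu> \<bind> K)"
        then have B: "B \<in> sets S" using sets_bind'[OF \<nu> K] by simp
        have split: "AE x in \<mu>. emeasure (K x) B * indicator A x = emeasure (K x) (A \<inter> B)"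
          using absorbing outside AE_space
        proof eventually_elim
          case (elim x)
          then have x: "x \<in> space S" by (simp add: space_\<mu>)
          interpret Kx: prob_space "K x" using x by (rule prob_space_K)
          have AB: "A \<in> sets (K x)" "B \<in> sets (K x)" using A B sets_K[OF x] by auto
          show ?case
          proof (cases "x \<in> A")
            case True
            then have "AE y in K x. y \<in> A"
              using elim(1) AB by (subst Kx.AE_in_set_eq_1) (auto simp: measure_def)
            then have "emeasure (K x) B = emeasure (K x) (A \<inter> B)"
              using AB by (intro emeasure_eq_AE) auto
            then show ?thesis using True by simp
          next
            case False
            then have "emeasure (K x) (A \<inter> B) \<le> 0"
              using elim(2) AB emeasure_mono[of "A \<inter> B" A "K x"] by auto
            then show ?thesis using False by simp
          qed
        qed
        have "emeasure (?\<nu> \<bind> K) B = (\<integral>\<^sup>+x. emeasure (K x) B \<partial>?\<nu>)"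
          by (rule emeasure_bind_prob_algebra[OF \<nu> K B])
        also have "\<dots> = (\<integral>\<^sup>+x. emeasure (K x) B * indicator A x \<partial>\<mu>) / emeasure \<mu> A"
          by (rule nn_integral_uniform_measure[OF meas[OF B] Amu])
        also have "(\<integral>\<^sup>+x. emeasure (K x) B * indicator A x \<partial>\<mu>) = (\<integral>\<^sup>+x. emeasure (K x) (A \<inter> B) \<partial>\<mu>)"
          by (rule nn_integral_cong_AE[OF split])
        also have "\<dots> = emeasure \<mu> (A \<inter> B)" by (intro inv_eq sets.Int A B)
        also have "\<dots> / emeasure \<mu> A = emeasure ?\<nu> B"
          using B sets_\<mu> by (intro emeasure_uniform_measure[OF Amu, symmetric]) (simp only:)
        finally show "emeasure (?\<nu> \<bind> K) B = emeasure ?\<nu> B" .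
      qed
      with \<nu> have "?\<nu> = \<mu>" by (intro unique) (simp add: invariant_measure_def)
      moreover have "emeasure ?\<nu> A = 1"
      proof -
        have "emeasure \<mu> A < top"
          using \<mu>.emeasure_finite[of A] unfolding less_top by simp
        then show ?thesis
          using ennreal_divide_self[OF pos] by (simp add: emeasure_uniform_measure[OF Amu Amu])
      qed
      ultimately show False using \<open>emeasure \<mu> A \<noteq> 1\<close> by simp
    qed
  qed
qed

context
  fixes \<nu> assumes \<nu>: "\<nu> \<in> space (prob_algebra S)"
begin

lemma kernel_op_iter_bounded:
  assumes f: "f \<in> borel_measurable S" and fb: "\<And>x. x \<in> space S \<Longrightarrow> \<bar>f x\<bar> \<le> B"
  shows "(kernel_op ^^ n) f \<in> borel_measurable S \<and> (\<forall>x\<in>space S. \<bar>(kernel_op ^^ n) f x\<bar> \<le> B)"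
proof (induction n)
  case (Suc n)
  show ?case
  proof (intro conjI ballI)
    show "(kernel_op ^^ Suc n) f \<in> borel_measurable S"
      using kernel_op_measurable[of "(kernel_op ^^ n) f"] Suc.IH by simp
    show "\<bar>(kernel_op ^^ Suc n) f x\<bar> \<le> B" if "x \<in> space S" for x
      using kernel_op_bounded[of "(kernel_op ^^ n) f" B x] Suc.IH that by simp
  qed
qed (use f fb in simp)

text \<open>
  Replacing the state at time $k+1$ by that at time $k$ in the martingale differences changes a sum
  of bounded terms only by its two end terms. So \<open>f\<close> and \<open>kernel_op f\<close> have the same averages
  asymptotically, and after $m$ repetitions so do \<open>f\<close> and its $m$-th iterate.
\<close>

lemma averages_iter_diff_tendsto_0:
  assumes f: "f \<in> borel_measurable S" and fb: "\<And>x. x \<in> space S \<Longrightarrow> \<bar>f x\<bar> \<le> B"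
  shows "AE \<omega> in path_measure S K \<nu>.
    (\<lambda>n. (\<Sum>k<n. f (\<omega> k) - (kernel_op ^^ m) f (\<omega> k)) / real n) \<longlonglongrightarrow> 0"
proof -
  let ?h = "\<lambda>m. (kernel_op ^^ m) f"
  note h = kernel_op_iter_bounded[OF f fb]
  have "AE \<omega> in path_measure S K \<nu>. \<forall>m. (\<lambda>n. (\<Sum>k<n. ?h m (\<omega> (Suc k)) - ?h (Suc m) (\<omega> k)) / real n) \<longlonglongrightarrow> 0"
    unfolding AE_all_countable
  proof
    fix m
    show "AE \<omega> in path_measure S K \<nu>. (\<lambda>n. (\<Sum>k<n. ?h m (\<omega> (Suc k)) - ?h (Suc m) (\<omega> k)) / real n) \<longlonglongrightarrow> 0"
      using martingale_averages_tendsto_0[OF \<nu>, of "?h m" B] h[of m] by simp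
  qed
  then show ?thesis
    using AE_space
  proof eventually_elim
    case (elim \<omega>)
    have in_S: "\<omega> k \<in> space S" for k by (rule path_coordinate_in[OF \<nu> elim(2)])
    have one: "(\<lambda>n. (\<Sum>k<n. ?h m (\<omega> k) - ?h (Suc m) (\<omega> k)) / real n) \<longlonglongrightarrow> 0" for m
    proof -
      have shift: "(\<Sum>k<n. ?h m (\<omega> k) - ?h (Suc m) (\<omega> k))
          = (\<Sum>k<n. ?h m (\<omega> (Suc k)) - ?h (Suc m) (\<omega> k)) - (?h m (\<omega> n) - ?h m (\<omega> 0))" for n
        using sum_lessThan_telescope[of "\<lambda>k. ?h m (\<omega> k)" n] by (simp add: sum_subtractf)
      have "(\<lambda>n. (?h m (\<omega> n) - ?h m (\<omega> 0)) / real n) \<longlonglongrightarrow> 0"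
      proof (rule Lim_null_comparison)
        show "\<forall>\<^sub>F n in sequentially. norm ((?h m (\<omega> n) - ?h m (\<omega> 0)) / real n) \<le> (2 * B) / real n"
        proof (intro always_eventually allI)
          fix n
          have "\<bar>?h m (\<omega> n) - ?h m (\<omega> 0)\<bar> \<le> 2 * B"
            using h[of m] in_S[of n] in_S[of 0] by (smt (verit))
          then show "norm ((?h m (\<omega> n) - ?h m (\<omega> 0)) / real n) \<le> (2 * B) / real n"
            by (simp add: divide_right_mono)
        qed
        show "(\<lambda>n. (2 * B) / real n) \<longlonglongrightarrow> 0" by (rule lim_const_over_n)
      qed
      from tendsto_diff[OF elim(1)[rule_format, of m] this]
      show ?thesis unfolding shift by (simp add: diff_divide_distrib)
    qed
    show ?case
    proof (induction m)
      case (Suc m)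
      have "(\<Sum>k<n. f (\<omega> k) - ?h (Suc m) (\<omega> k)) / real n
          = (\<Sum>k<n. f (\<omega> k) - ?h m (\<omega> k)) / real n + (\<Sum>k<n. ?h m (\<omega> k) - ?h (Suc m) (\<omega> k)) / real n" for n
        by (simp add: add_divide_distrib[symmetric] sum.distrib[symmetric])
      then show ?case using tendsto_add[OF Suc.IH one[of m]] by simp
    qed simp
  qed
qed

end

end

section \<open>Unique ergodicity of contractive systems\<close>

context contractive_ifs begin

abbreviation state_space :: "'a measure" where
  "state_space \<equiv> restrict_space borel X"

lemma state_random_choice: "random_choice state_space J p w"
proof
  show "w j \<in> state_space \<rightarrow>\<^sub>M state_space" if "j \<in> J" for j
    using w_in[OF that] borel_measurable_continuous_on_restrict[OF w_continuous[OF that]]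
    by (intro measurable_restrict_space2) (auto simp: space_restrict_space)
  show "p j \<in> borel_measurable state_space" if "j \<in> J" for j
    using that by (intro borel_measurable_continuous_on_restrict p_continuous)
qed (auto simp: finite_J space_restrict_space p_nonneg p_sum)

sublocale chain: random_choice state_space J p w
  by (rule state_random_choice)

abbreviation chain_kernel :: "'a \<Rightarrow> 'a measure" where
  "chain_kernel \<equiv> choice_kernel state_space J p w"

lemma kernel_op_iter_eq_transfer:
  assumes f: "continuous_on X f" and x: "x \<in> X"
  shows "(chain.kernel_op ^^ n) f x = (transfer ^^ n) f x"
  using x
proof (induction n arbitrary: x)
  case (Suc n)
  let ?g = "(chain.kernel_op ^^ n) f" and ?t = "(transfer ^^ n) f"
  have "continuous_on X ?g"
    using Suc.IH by (subst continuous_on_cong[OF refl]) (auto intro: transfer_iter_continuous[OF f])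
  then have "?g \<in> borel_measurable state_space" by (rule borel_measurable_continuous_on_restrict)
  then have "chain.kernel_op ?g x = (\<Sum>j\<in>J. p j x * ?g (w j x))"
    using Suc.prems by (intro chain.kernel_op_choice) (simp_all add: space_restrict_space)
  also have "\<dots> = transfer ?t x"
    unfolding transfer_def[of ?t] using Suc by (simp add: w_in)
  finally show ?case by simp
qed simp

lemma invariant_if_limit_value:
  assumes \<mu>: "\<mu> \<in> space (prob_algebra state_space)"
    and int: "\<And>f. continuous_on X f \<Longrightarrow> (\<integral>x. f x \<partial>\<mu>) = limit_value f"
  shows "invariant_measure state_space chain_kernel \<mu>"
proof -
  have bind: "\<mu> \<bind> chain_kernel \<in> space (prob_algebra state_space)"
    using prob_space_bind'[OF \<mu> chain.choice_kernel_measurable] sets_bind'[OF \<mu> chain.choice_kernel_measurable]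
    by (simp add: space_prob_algebra)
  note space_\<mu> = prob_algebra_restrictD(3)[OF \<mu>]
  have "\<mu> \<bind> chain_kernel = \<mu>"
  proof (rule prob_measure_eqI_continuous[OF bind \<mu> X_closed])
    fix f :: "'a \<Rightarrow> real" assume f: "continuous_on X f" and "bounded (f ` X)"
    then obtain B where B: "\<And>x. x \<in> X \<Longrightarrow> \<bar>f x\<bar> \<le> B" unfolding bounded_iff by auto
    have f_meas: "f \<in> borel_measurable state_space" by (rule borel_measurable_continuous_on_restrict[OF f])
    have "(\<integral>x. f x \<partial>(\<mu> \<bind> chain_kernel)) = (\<integral>x. chain.kernel_op f x \<partial>\<mu>)"
      using B by (intro chain.integral_bind_kernel[OF \<mu> f_meas]) (simp add: space_restrict_space)
    also have "\<dots> = (\<integral>x. transfer f x \<partial>\<mu>)"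
      using chain.kernel_op_choice[OF _ f_meas]
      by (intro Bochner_Integration.integral_cong) (auto simp: space_\<mu> space_restrict_space transfer_def)
    also have "\<dots> = (\<integral>x. f x \<partial>\<mu>)"
      using int[OF f] int[OF transfer_continuous[OF f]] limit_value_transfer[OF f] by simp
    finally show "(\<integral>x. f x \<partial>(\<mu> \<bind> chain_kernel)) = (\<integral>x. f x \<partial>\<mu>)" .
  qed
  with \<mu> show ?thesis by (simp add: invariant_measure_def)
qed

lemma law_tendsto_limit_value:
  assumes \<nu>: "\<nu> \<in> space (prob_algebra state_space)" and f: "continuous_on X f" and b: "bounded (f ` X)"
  shows "(\<lambda>k. \<integral>x. f x \<partial>distr (path_measure state_space chain_kernel \<nu>) state_space (\<lambda>\<omega>. \<omega> k)) \<longlonglongrightarrow> limit_value f"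
proof -
  obtain B where B: "\<And>x. x \<in> X \<Longrightarrow> \<bar>f x\<bar> \<le> B" using b unfolding bounded_iff by auto
  have f_meas: "f \<in> borel_measurable state_space" by (rule borel_measurable_continuous_on_restrict[OF f])
  note sets_\<nu> = prob_algebra_restrictD(2)[OF \<nu>] and space_\<nu> = prob_algebra_restrictD(3)[OF \<nu>]
  interpret \<nu>: prob_space \<nu> by (rule prob_algebra_restrictD(1)[OF \<nu>])
  note it = chain.kernel_op_iter_bounded[OF \<nu> f_meas, of B]
  have "(\<lambda>k. \<integral>x. (chain.kernel_op ^^ k) f x \<partial>\<nu>) \<longlonglongrightarrow> (\<integral>x. limit_value f \<partial>\<nu>)"
  proof (rule integral_dominated_convergence[where w="\<lambda>_. B"])
    show "AE x in \<nu>. (\<lambda>k. (chain.kernel_op ^^ k) f x) \<longlonglongrightarrow> limit_value f"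
      using transfer_iter_tendsto[OF f]
      by (intro AE_I2) (simp add: space_\<nu> kernel_op_iter_eq_transfer[OF f])
    show "AE x in \<nu>. norm ((chain.kernel_op ^^ k) f x) \<le> B" for k
      using it B by (intro AE_I2) (simp add: space_\<nu> space_restrict_space)
    show "(chain.kernel_op ^^ k) f \<in> borel_measurable \<nu>" for k
      using it[of k] B by (subst measurable_cong_sets[OF sets_\<nu> refl]) (simp add: space_restrict_space)
  qed auto
  moreover have "(\<integral>x. f x \<partial>distr (path_measure state_space chain_kernel \<nu>) state_space (\<lambda>\<omega>. \<omega> k))
      = (\<integral>x. (chain.kernel_op ^^ k) f x \<partial>\<nu>)" for k
    using B by (intro chain.integral_law[OF \<nu> f_meas]) (simp add: space_restrict_space)
  ultimately show ?thesis by (simp add: \<nu>.prob_space)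
qed

text \<open>
  Under an invariant initial law the integral of \<open>f\<close> along the trajectory is constant in time, while
  it converges to the limit value.
\<close>

lemma integral_invariant:
  assumes inv: "invariant_measure state_space chain_kernel \<nu>"
    and f: "continuous_on X f" and b: "bounded (f ` X)"
  shows "(\<integral>x. f x \<partial>\<nu>) = limit_value f"
proof -
  have \<nu>: "\<nu> \<in> space (prob_algebra state_space)" and bind: "\<nu> \<bind> chain_kernel = \<nu>"
    using inv by (auto simp: invariant_measure_def)
  obtain B where B: "\<And>x. x \<in> X \<Longrightarrow> \<bar>f x\<bar> \<le> B" using b unfolding bounded_iff by auto
  have f_meas: "f \<in> borel_measurable state_space" by (rule borel_measurable_continuous_on_restrict[OF f])
  note it = chain.kernel_op_iter_bounded[OF \<nu> f_meas, of B]
  have step: "(\<integral>x. chain.kernel_op g x \<partial>\<nu>) = (\<integral>x. g x \<partial>\<nu>)"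
    if g: "g \<in> borel_measurable state_space" "\<And>x. x \<in> X \<Longrightarrow> \<bar>g x\<bar> \<le> B" for g
    using chain.integral_bind_kernel[OF \<nu> g(1), of B] g(2) by (simp add: bind space_restrict_space)
  have "(\<integral>x. (chain.kernel_op ^^ k) f x \<partial>\<nu>) = (\<integral>x. f x \<partial>\<nu>)" for k
  proof (induction k)
    case (Suc k)
    then show ?case using step[of "(chain.kernel_op ^^ k) f"] it[of k] B by (simp add: space_restrict_space)
  qed simp
  moreover have "(\<integral>x. f x \<partial>distr (path_measure state_space chain_kernel \<nu>) state_space (\<lambda>\<omega>. \<omega> k))
      = (\<integral>x. (chain.kernel_op ^^ k) f x \<partial>\<nu>)" for k
    using B by (intro chain.integral_law[OF \<nu> f_meas]) (simp add: space_restrict_space)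
  ultimately show ?thesis
    using law_tendsto_limit_value[OF \<nu> f b] by (simp add: LIMSEQ_const_iff)
qed

text \<open>
  Breiman's argument: the averages of \<open>g\<close> and of the $m$-th iterate agree asymptotically, and for
  large \<open>m\<close> the latter is uniformly close to the limit value on the invariant ball that contains
  the trajectory.
\<close>

lemma time_averages_tendsto:
  assumes x0: "x0 \<in> X" and g: "continuous_on X g"
  shows "AE \<omega> in path_measure state_space chain_kernel (return state_space x0).
    (\<lambda>k. (\<Sum>\<nu>\<le>k. g (\<omega> \<nu>)) / real (k + 1)) \<longlonglongrightarrow> limit_value g"
proof -
  define R where "R = max min_radius (d base x0)"
  have R: "min_radius \<le> R" and x0R: "x0 \<in> trap R" using x0 by (auto simp: R_def trap_def)
  let ?B = "trap R" and ?\<nu> = "return state_space x0"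
  have \<nu>: "?\<nu> \<in> space (prob_algebra state_space)"
    using x0 by (simp add: space_prob_algebra prob_space_return space_restrict_space)
  obtain C where C: "\<And>x. x \<in> ?B \<Longrightarrow> \<bar>g x\<bar> \<le> C" using bounded_on_trap[OF g] by blast
  have C0: "0 \<le> C" using C[OF x0R] by linarith
  \<comment> \<open>Only the values of \<open>g\<close> on the ball matter; cutting it off makes it bounded everywhere.\<close>
  define g' where "g' x = max (- C) (min C (g x))" for x
  have g'_eq: "g' x = g x" if "x \<in> ?B" for x using C[OF that] by (auto simp: g'_def)
  have g': "continuous_on X g'" unfolding g'_def by (intro continuous_intros g)
  have g'b: "\<bar>g' x\<bar> \<le> C" for x using C0 by (auto simp: g'_def)
  have "limit_value g \<le> limit_value g'" "limit_value g' \<le> limit_value g"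
    using g'_eq by (auto intro!: limit_value_mono[OF _ _ R] g g')
  then have lim_eq: "limit_value g' = limit_value g" by simp
  have g'_meas: "g' \<in> borel_measurable state_space" by (rule borel_measurable_continuous_on_restrict[OF g'])
  note B_sets = trap_sets[of R]
  have stay: "AE \<omega> in path_measure state_space chain_kernel ?\<nu>. \<forall>n. \<omega> n \<in> ?B"
  proof (rule chain.AE_path_invariant[OF \<nu> B_sets])
    show "AE x in ?\<nu>. x \<in> ?B"
      using x0 x0R B_sets by (subst AE_return) (auto simp: space_restrict_space Measurable.pred_def[symmetric] pred_sets2)
    fix x assume x: "x \<in> ?B"
    then have xX: "x \<in> X" using trap_subset by auto
    have "(\<Sum>j\<in>J. p j x * indicator ?B (w j x)) = (\<Sum>j\<in>J. p j x)"
      using w_trap[OF R _ x] by (intro sum.cong) auto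
    then show "emeasure (chain_kernel x) ?B = 1"
      using chain.emeasure_choice_kernel[OF _ B_sets, of x] xX p_sum[OF xX] by (simp add: space_restrict_space)
  qed
  have "AE \<omega> in path_measure state_space chain_kernel ?\<nu>.
    \<forall>m. (\<lambda>n. (\<Sum>k<n. g' (\<omega> k) - (chain.kernel_op ^^ m) g' (\<omega> k)) / real n) \<longlonglongrightarrow> 0"
    unfolding AE_all_countable by (intro allI chain.averages_iter_diff_tendsto_0[OF \<nu> g'_meas g'b])
  then show ?thesis using stay
  proof eventually_elim
    case (elim \<omega>)
    then have inB: "\<omega> k \<in> ?B" for k by simp
    have "(\<lambda>n. (\<Sum>k<n. g (\<omega> k)) / real n) \<longlonglongrightarrow> limit_value g"
    proof (rule LIMSEQ_I)
      fix r :: real assume "0 < r"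
      then have r2: "0 < r / 2" by simp
      obtain m where m: "\<And>n x. m \<le> n \<Longrightarrow> x \<in> ?B \<Longrightarrow> \<bar>(transfer ^^ n) g' x - limit_value g'\<bar> \<le> r / 2"
        using transfer_iter_uniform_limit[OF R g' r2] by blast
      let ?h = "(chain.kernel_op ^^ m) g'"
      have h: "\<bar>?h (\<omega> k) - limit_value g\<bar> \<le> r / 2" for k
        using m[OF order_refl inB[of k]] kernel_op_iter_eq_transfer[OF g' subsetD[OF trap_subset inB[of k]], of m]
        by (simp only: lim_eq)
      obtain n0 where n0: "\<And>n. n0 \<le> n \<Longrightarrow> \<bar>(\<Sum>k<n. g' (\<omega> k) - ?h (\<omega> k)) / real n\<bar> < r / 2"
        using LIMSEQ_D[OF elim(1)[rule_format, of m] r2] unfolding real_norm_def diff_0_right by blast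
      have "\<bar>(\<Sum>k<n. g (\<omega> k)) / real n - limit_value g\<bar> < r" if n: "max 1 n0 \<le> n" for n
      proof -
        have "(\<Sum>k<n. g (\<omega> k)) / real n - limit_value g
            = (\<Sum>k<n. g' (\<omega> k) - ?h (\<omega> k)) / real n + (\<Sum>k<n. ?h (\<omega> k) - limit_value g) / real n"
          using n by (simp add: sum_subtractf g'_eq[OF inB] diff_divide_distrib)
        moreover have "\<bar>\<Sum>k<n. ?h (\<omega> k) - limit_value g\<bar> \<le> (\<Sum>k<n. r / 2)"
          by (intro order_trans[OF sum_abs] sum_mono h)
        then have "\<bar>(\<Sum>k<n. ?h (\<omega> k) - limit_value g) / real n\<bar> \<le> r / 2"
          using n by (simp add: field_simps)
        moreover have "\<bar>(\<Sum>k<n. g' (\<omega> k) - ?h (\<omega> k)) / real n\<bar> < r / 2"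
          using n by (intro n0) simp
        ultimately show ?thesis by linarith
      qed
      then show "\<exists>no. \<forall>n\<ge>no. norm ((\<Sum>k<n. g (\<omega> k)) / real n - limit_value g) < r"
        unfolding real_norm_def by blast
    qed
    then have "(\<lambda>n. (\<Sum>k<Suc n. g (\<omega> k)) / real (Suc n)) \<longlonglongrightarrow> limit_value g" by (rule LIMSEQ_Suc)
    then show ?case by (simp only: lessThan_Suc_atMost Suc_eq_plus1[symmetric])
  qed
qed

theorem unique_ergodicity:
  "(\<exists>!\<mu>. invariant_measure state_space chain_kernel \<mu> \<and> attractive_measure X chain_kernel \<mu>)
    \<and> uniquely_ergodic X chain_kernel"
proof -
  obtain \<mu> where \<mu>: "\<mu> \<in> space (prob_algebra state_space)" "AE x in \<mu>. x \<in> trap min_radius"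
    and int: "\<And>f. continuous_on X f \<Longrightarrow> (\<integral>x. f x \<partial>\<mu>) = limit_value f"
    using limit_value_representation by blast
  have inv: "invariant_measure state_space chain_kernel \<mu>"
    by (rule invariant_if_limit_value[OF \<mu>(1) int])
  have attr: "attractive_measure X chain_kernel \<mu>"
    unfolding attractive_measure_def converges_in_distribution_def Let_def
  proof (intro ballI allI impI)
    fix \<nu> and f :: "'a \<Rightarrow> real"
    assume \<nu>: "\<nu> \<in> space (prob_algebra state_space)" and f: "continuous_on X f \<and> bounded (f ` X)"
    show "(\<lambda>k. \<integral>x. f x \<partial>distr (path_measure state_space chain_kernel \<nu>) state_space (\<lambda>\<omega>. \<omega> k)) \<longlonglongrightarrow> (\<integral>x. f x \<partial>\<mu>)"
      unfolding int[OF conjunct1[OF f]]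
      by (rule law_tendsto_limit_value[OF \<nu> conjunct1[OF f] conjunct2[OF f]])
  qed
  have unique: "\<nu> = \<mu>" if "invariant_measure state_space chain_kernel \<nu>" for \<nu>
  proof (rule prob_measure_eqI_continuous[OF _ \<mu>(1) X_closed])
    show "\<nu> \<in> space (prob_algebra state_space)" using that by (simp add: invariant_measure_def)
    show "(\<integral>x. f x \<partial>\<nu>) = (\<integral>x. f x \<partial>\<mu>)" if "continuous_on X f" "bounded (f ` X)" for f :: "'a \<Rightarrow> real"
      unfolding int[OF that(1)] by (rule integral_invariant[OF \<open>invariant_measure state_space chain_kernel \<nu>\<close> that])
  qed
  have erg: "ergodic_measure state_space chain_kernel \<mu>"
    by (rule chain.ergodic_if_unique_invariant[OF inv unique])
  have integrable: "integrable \<mu> g" if g: "continuous_on X g" for g :: "'a \<Rightarrow> real"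
  proof -
    interpret prob_space \<mu> by (rule prob_algebra_restrictD(1)[OF \<mu>(1)])
    obtain C where C: "\<And>x. x \<in> trap min_radius \<Longrightarrow> \<bar>g x\<bar> \<le> C" using bounded_on_trap[OF g] by blast
    show ?thesis
    proof (rule integrable_const_bound)
      show "AE x in \<mu>. norm (g x) \<le> C" using \<mu>(2) by eventually_elim (use C in simp)
      show "g \<in> borel_measurable \<mu>"
        by (subst measurable_cong_sets[OF prob_algebra_restrictD(2)[OF \<mu>(1)] refl])
          (rule borel_measurable_continuous_on_restrict[OF g])
    qed
  qed
  have "\<forall>x0\<in>X. \<forall>g :: 'a \<Rightarrow> real. continuous_on X g \<longrightarrow> integrable \<mu> g \<and>
      (AE \<omega> in path_measure state_space chain_kernel (return state_space x0).
        (\<lambda>k. (\<Sum>\<nu>\<le>k. g (\<omega> \<nu>)) / real (k + 1)) \<longlonglongrightarrow> (\<integral>x. g x \<partial>\<mu>))"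
  proof (intro ballI allI impI conjI)
    fix x0 and g :: "'a \<Rightarrow> real" assume x0: "x0 \<in> X" and g: "continuous_on X g"
    show "integrable \<mu> g" by (rule integrable[OF g])
    show "AE \<omega> in path_measure state_space chain_kernel (return state_space x0).
        (\<lambda>k. (\<Sum>\<nu>\<le>k. g (\<omega> \<nu>)) / real (k + 1)) \<longlonglongrightarrow> (\<integral>x. g x \<partial>\<mu>)"
      unfolding int[OF g] by (rule time_averages_tendsto[OF x0 g])
  qed
  then have "uniquely_ergodic X chain_kernel"
    unfolding uniquely_ergodic_def Let_def
    by (intro exI[of _ \<mu>] conjI inv attr erg allI impI unique)
  then show ?thesis using inv attr unique by blast
qed

end

text \<open>
  Summing the recursion bounds $(1-r) \sum_{i<n} x_i$ by $x_0$ plus the sum of the \<open>e n\<close>.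
\<close>

section \<open>A norm contracted by a Schur matrix\<close>

lemma summable_linear_recursion:
  fixes x e :: "nat \<Rightarrow> real"
  assumes x0: "\<And>n. 0 \<le> x n" and e0: "\<And>n. 0 \<le> e n" and e: "summable e"
    and r: "r < 1" and rec: "\<And>n. x (Suc n) \<le> r * x n + e n"
  shows "summable x"
proof (rule summableI_nonneg_bounded[OF x0])
  fix n
  have "(\<Sum>i<n. x i) \<le> x 0 + (\<Sum>i<n. x (Suc i))"
    using sum.lessThan_Suc_shift[of x n] sum.lessThan_Suc[of x n] x0[of n] by linarith
  also have "(\<Sum>i<n. x (Suc i)) \<le> r * (\<Sum>i<n. x i) + (\<Sum>i<n. e i)"
    unfolding sum_distrib_left sum.distrib[symmetric] by (intro sum_mono rec)
  also have "(\<Sum>i<n. e i) \<le> suminf e" using e e0 by (intro sum_le_suminf) auto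
  finally have "(1 - r) * (\<Sum>i<n. x i) \<le> x 0 + suminf e" by (simp add: algebra_simps)
  then show "(\<Sum>i<n. x i) \<le> (x 0 + suminf e) / (1 - r)" using r by (simp add: field_simps)
qed

context
  fixes M :: "complex ^ 'n ^ 'n"
begin

lemma matrix_iter_zero: "(((*v) M ^^ i) (0 :: complex ^ 'n)) = 0"
  by (induction i) auto

lemma matrix_iter_scale: "((*v) M ^^ i) (c *s x) = c *s ((*v) M ^^ i) x"
  by (induction i) (auto simp: vector_scalar_commute)

lemma matrix_iter_diff: "((*v) M ^^ i) (x - y) = ((*v) M ^^ i) x - ((*v) M ^^ i) y"
  by (induction i) (auto simp: matrix_vector_mult_diff_distrib)

text \<open>
  The vector \<open>p(M) v\<close>, expressed through iterates so that no algebra of matrices is involved.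
\<close>

definition matrix_poly :: "complex poly \<Rightarrow> complex ^ 'n \<Rightarrow> complex ^ 'n" where
  "matrix_poly p v = (\<Sum>i\<le>degree p. coeff p i *s ((*v) M ^^ i) v)"

lemma matrix_poly_upto:
  assumes "degree p \<le> n" shows "matrix_poly p v = (\<Sum>i\<le>n. coeff p i *s ((*v) M ^^ i) v)"
  unfolding matrix_poly_def
  by (rule sum.mono_neutral_left) (use assms in \<open>auto simp: coeff_eq_0\<close>)

lemma matrix_poly_linear_factor:
  "matrix_poly ([:- z, 1:] * q) v = M *v matrix_poly q v - z *s matrix_poly q v"
  "matrix_poly ([:- z, 1:] * q) v = matrix_poly q (M *v v - z *s v)"
proof -
  let ?n = "degree q"
  have deg: "degree ([:- z, 1:] * q) \<le> Suc ?n"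
    using degree_mult_le[of "[:- z, 1:]" q] by simp
  have c: "coeff ([:- z, 1:] * q) i = coeff (pCons 0 q) i - z * coeff q i" for i
    by simp
  have "matrix_poly ([:- z, 1:] * q) v
      = (\<Sum>i\<le>Suc ?n. coeff (pCons 0 q) i *s ((*v) M ^^ i) v) - (\<Sum>i\<le>Suc ?n. (z * coeff q i) *s ((*v) M ^^ i) v)"
    unfolding matrix_poly_upto[OF deg] c by (simp only: sum_subtractf[symmetric] vec.scale_left_diff_distrib)
  also have "(\<Sum>i\<le>Suc ?n. coeff (pCons 0 q) i *s ((*v) M ^^ i) v) = (\<Sum>i\<le>?n. coeff q i *s ((*v) M ^^ Suc i) v)"
    by (subst sum.atMost_Suc_shift) simp
  also have "(\<Sum>i\<le>Suc ?n. (z * coeff q i) *s ((*v) M ^^ i) v) = z *s matrix_poly q v"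
    by (simp add: matrix_poly_def coeff_eq_0 vec.scale_sum_right)
  finally have *: "matrix_poly ([:- z, 1:] * q) v = (\<Sum>i\<le>?n. coeff q i *s ((*v) M ^^ Suc i) v) - z *s matrix_poly q v" .
  have "M *v matrix_poly q v = (\<Sum>i\<le>?n. coeff q i *s ((*v) M ^^ Suc i) v)"
    unfolding matrix_poly_def
    by (simp add: vec.linear_sum[OF matrix_vector_mul_linear_gen] vector_scalar_commute)
  with * show "matrix_poly ([:- z, 1:] * q) v = M *v matrix_poly q v - z *s matrix_poly q v" by simp
  have "matrix_poly q (M *v v - z *s v) = (\<Sum>i\<le>?n. coeff q i *s ((*v) M ^^ Suc i) v - z *s (coeff q i *s ((*v) M ^^ i) v))"
    unfolding matrix_poly_def matrix_iter_diff matrix_iter_scale funpow_Suc_right comp_apply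
    by (intro sum.cong refl) (simp add: vec.scale_right_diff_distrib mult.commute)
  with * show "matrix_poly ([:- z, 1:] * q) v = matrix_poly q (M *v v - z *s v)"
    by (simp add: sum_subtractf matrix_poly_def vec.scale_sum_right)
qed

text \<open>
  More iterates of \<open>v\<close> than the real dimension of the space are linearly dependent, or two of them
  coincide; either relation is a polynomial.
\<close>

lemma exists_annihilating_poly: "\<exists>p. p \<noteq> 0 \<and> matrix_poly p v = 0"
proof -
  let ?m = "DIM(complex ^ 'n)" and ?g = "\<lambda>i. ((*v) M ^^ i) v"
  show ?thesis
  proof (cases "inj_on ?g {..?m}")
    case True
    then have card: "card (?g ` {..?m}) = Suc ?m" by (simp add: card_image)
    have dep: "dependent (?g ` {..?m})"
    proof (rule ccontr)
      assume "independent (?g ` {..?m})"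
      then have "card (?g ` {..?m}) \<le> ?m" by (rule independent_bound[THEN conjunct2])
      with card show False by (simp only: Suc_n_not_le_n)
    qed
    have "finite (?g ` {..?m})" by (intro finite_imageI finite_atMost)
    from dep[unfolded dependent_finite[OF this]] obtain u k where
      u: "k \<le> ?m" "u (?g k) \<noteq> 0" "(\<Sum>x\<in>?g ` {..?m}. u x *\<^sub>R x) = 0" by blast
    define p where "p = (\<Sum>i\<le>?m. monom (complex_of_real (u (?g i))) i)"
    have c: "coeff p i = (if i \<le> ?m then complex_of_real (u (?g i)) else 0)" for i
      by (simp add: p_def coeff_sum)
    have "coeff p k \<noteq> 0" using u(1,2) by (simp only: c if_True of_real_eq_0_iff not_False_eq_True)
    then have "p \<noteq> 0" by (metis coeff_0)
    have "degree p \<le> ?m" by (rule degree_le) (simp add: c)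
    then have "matrix_poly p v = (\<Sum>i\<le>?m. complex_of_real (u (?g i)) *s ?g i)"
      by (simp add: matrix_poly_upto c)
    also have "\<dots> = (\<Sum>i\<le>?m. u (?g i) *\<^sub>R ?g i)"
      by (intro sum.cong refl) (simp add: vec_eq_iff scaleR_conv_of_real[where 'a=complex])
    also have "\<dots> = 0" using u(3) by (simp only: sum.reindex[OF True] comp_def)
    finally show ?thesis using \<open>p \<noteq> 0\<close> by blast
  next
    case False
    then obtain i j where ij: "i \<noteq> j" "?g i = ?g j" by (auto simp: inj_on_def)
    define p where "p = monom (1 :: complex) i - monom 1 j"
    have c: "coeff p k = (if k = i then 1 else 0) - (if k = j then 1 else 0)" for k
      by (simp add: p_def)
    have "p \<noteq> 0" using c[of i] ij(1) by auto
    moreover have "degree p \<le> max i j" by (rule degree_le) (simp add: c)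
    then have "matrix_poly p v = (\<Sum>k\<le>max i j. (if k = i then ?g k else 0) - (if k = j then ?g k else 0))"
      unfolding matrix_poly_upto[OF \<open>degree p \<le> max i j\<close>] by (intro sum.cong refl) (auto simp: c)
    then have "matrix_poly p v = 0" using ij(2) by (simp add: sum_subtractf)
    ultimately show ?thesis by blast
  qed
qed

text \<open>
  Induction over the degree of a polynomial that annihilates \<open>v\<close>. Split off a root \<open>z\<close>, with quotient
  \<open>q\<close>. If \<open>q(M) v = 0\<close>, the degree has dropped. Otherwise \<open>q(M) v\<close> is an eigenvector for \<open>z\<close>, so
  $|z| < 1$; the vector $Mv - zv$ is annihilated by \<open>q\<close>, and the iterates of \<open>v\<close> satisfy a linear
  recursion with factor \<open>z\<close> and the summable iterates of $Mv - zv$ as inhomogeneity.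
\<close>

lemma summable_matrix_iter:
  assumes eig: "\<And>z v. v \<noteq> 0 \<Longrightarrow> M *v v = z *s v \<Longrightarrow> cmod z < 1"
  shows "summable (\<lambda>n. norm (((*v) M ^^ n) v))"
proof -
  have "summable (\<lambda>n. norm (((*v) M ^^ n) v))" if "p \<noteq> 0" "matrix_poly p v = 0" for p v
    using that
  proof (induction "degree p" arbitrary: p v)
    case 0
    then obtain c where "p = [:c:]" by (metis degree_eq_zeroE)
    with 0 have "v = 0" by (simp add: matrix_poly_def)
    then show ?case by (simp add: matrix_iter_zero)
  next
    case (Suc n)
    then have "\<not> constant (poly p)" by (simp add: constant_degree)
    then obtain z where "poly p z = 0" using fundamental_theorem_of_algebra by blast
    then obtain q where p: "p = [:- z, 1:] * q" unfolding poly_eq_0_iff_dvd by (elim dvdE)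
    have q: "q \<noteq> 0" using Suc.prems p by auto
    have "degree p = Suc (degree q)" unfolding p using q by (subst degree_mult_eq) auto
    then have n: "n = degree q" using Suc.hyps(2) by simp
    show ?case
    proof (cases "matrix_poly q v = 0")
      case True
      then show ?thesis using Suc.hyps(1)[OF n q] by blast
    next
      case False
      have "M *v matrix_poly q v = z *s matrix_poly q v"
        using Suc.prems(2) unfolding p matrix_poly_linear_factor(1) by simp
      then have z: "cmod z < 1" using eig[OF False] by blast
      have "matrix_poly q (M *v v - z *s v) = 0"
        using Suc.prems(2) unfolding p matrix_poly_linear_factor(2) .
      from Suc.hyps(1)[OF n q this] have sm: "summable (\<lambda>k. norm (((*v) M ^^ k) (M *v v - z *s v)))" .
      show ?thesis
      proof (rule summable_linear_recursion[OF _ _ sm z])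
        fix k
        have "((*v) M ^^ Suc k) v = z *s ((*v) M ^^ k) v + ((*v) M ^^ k) (M *v v - z *s v)"
          by (simp add: matrix_iter_diff matrix_iter_scale funpow_swap1)
        moreover have "norm (z *s ((*v) M ^^ k) v) = cmod z * norm (((*v) M ^^ k) v)"
          by (simp add: norm_vec_def L2_set_def norm_mult power_mult_distrib sum_distrib_left[symmetric] real_sqrt_mult)
        ultimately show "norm (((*v) M ^^ Suc k) v) \<le> cmod z * norm (((*v) M ^^ k) v) + norm (((*v) M ^^ k) (M *v v - z *s v))"
          by (metis norm_triangle_ineq)
      qed auto
    qed
  qed
  then show ?thesis using exists_annihilating_poly by blast
qed

end

lemma summable_schur_iter:
  fixes A :: "real ^ 'n ^ 'n"
  assumes "schur A"
  shows "summable (\<lambda>n. norm (((*v) A ^^ n) v))"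
proof -
  \<comment> \<open>The iterates of \<open>v\<close> are followed in the complexification, where norms do not change.\<close>
  let ?M = "map_matrix complex_of_real A" and ?c = "\<lambda>v :: real ^ 'n. \<chi> i. complex_of_real (v $ i)"
  have "?M *v ?c v = ?c (A *v v)" for v
    by (simp add: vec_eq_iff matrix_vector_mult_def map_matrix_def)
  then have "((*v) ?M ^^ n) (?c v) = ?c (((*v) A ^^ n) v)" for n
    by (induction n) simp_all
  moreover have "norm (?c v) = norm v" for v by (simp add: norm_vec_def)
  moreover have "summable (\<lambda>n. norm (((*v) ?M ^^ n) (?c v)))"
    using assms unfolding schur_def by (intro summable_matrix_iter) blast
  ultimately show ?thesis by simp
qed

text \<open>
  A discrete Lyapunov function: applying \<open>A\<close> shifts the series and removes its first term \<open>norm v\<close>.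
\<close>

definition lyapunov_norm :: "real ^ 'n ^ 'n \<Rightarrow> real ^ 'n \<Rightarrow> real" where
  "lyapunov_norm A v = (\<Sum>n. norm (((*v) A ^^ n) v))"

lemma real_matrix_iter_linear: "linear ((*v) (A :: real ^ 'n ^ 'n) ^^ n)"
proof (induction n)
  case (Suc n)
  then show ?case using linear_compose[OF Suc.IH matrix_vector_mul_linear[of A]] by (simp add: comp_def)
qed (simp add: linear_id[unfolded id_def])

context
  fixes A :: "real ^ 'n ^ 'n"
  assumes A: "schur A"
begin

lemma summable_iter: "summable (\<lambda>n. norm (((*v) A ^^ n) v))"
  by (rule summable_schur_iter[OF A])

lemma lyapunov_norm_step: "lyapunov_norm A (A *v v) = lyapunov_norm A v - norm v"
  using suminf_split_head[OF summable_iter[of v]]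
  by (simp add: lyapunov_norm_def funpow_Suc_right del: funpow.simps)

lemma lyapunov_norm_ge: "norm v \<le> lyapunov_norm A v"
proof -
  have "0 \<le> lyapunov_norm A (A *v v)"
    unfolding lyapunov_norm_def by (intro suminf_nonneg summable_iter) simp
  then show ?thesis unfolding lyapunov_norm_step by simp
qed

lemma lyapunov_norm_add: "lyapunov_norm A (u + v) \<le> lyapunov_norm A u + lyapunov_norm A v"
  unfolding lyapunov_norm_def suminf_add[OF summable_iter summable_iter]
  by (intro suminf_le summable_iter summable_add)
    (simp add: linear_add[OF real_matrix_iter_linear] norm_triangle_ineq)

lemma lyapunov_norm_scale: "lyapunov_norm A (c *\<^sub>R v) = \<bar>c\<bar> * lyapunov_norm A v"
  unfolding lyapunov_norm_def
  by (simp add: linear_cmul[OF real_matrix_iter_linear] suminf_mult[OF summable_iter])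

lemma lyapunov_norm_minus: "lyapunov_norm A (u - v) = lyapunov_norm A (v - u)"
  using lyapunov_norm_scale[of "- 1" "u - v"] by simp

lemma lyapunov_norm_zero: "lyapunov_norm A 0 = 0"
  using lyapunov_norm_scale[of 0 0] by simp

lemma lyapunov_norm_bound: obtains c where "1 \<le> c" "\<And>v. lyapunov_norm A v \<le> c * norm v"
proof -
  let ?N = "lyapunov_norm A"
  have sum: "?N (sum g I) \<le> (\<Sum>i\<in>I. ?N (g i))" if "finite I" for g and I :: "(real ^ 'n) set"
    using that
  proof (induction I rule: finite_induct)
    case (insert i I)
    then show ?case using lyapunov_norm_add[of "g i" "sum g I"] by simp
  qed (simp add: lyapunov_norm_zero)
  let ?C = "\<Sum>b\<in>Basis. ?N b"
  have nonneg: "0 \<le> ?N b" for b using lyapunov_norm_ge[of b] norm_ge_zero order_trans by blast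
  have le: "?N v \<le> ?C * norm v" for v
  proof -
    have "?N v = ?N (\<Sum>b\<in>Basis. (v \<bullet> b) *\<^sub>R b)" by (simp only: euclidean_representation)
    also have "\<dots> \<le> (\<Sum>b\<in>Basis. ?N ((v \<bullet> b) *\<^sub>R b))" by (rule sum) simp
    also have "\<dots> = (\<Sum>b\<in>Basis. \<bar>v \<bullet> b\<bar> * ?N b)" by (simp only: lyapunov_norm_scale)
    also have "\<dots> \<le> (\<Sum>b\<in>Basis. norm v * ?N b)"
      by (intro sum_mono mult_right_mono Basis_le_norm nonneg)
    also have "\<dots> = ?C * norm v" by (simp only: sum_distrib_left mult.commute)
    finally show ?thesis .
  qed
  show ?thesis
  proof (rule that[of "max 1 ?C"])
    show "?N v \<le> max 1 ?C * norm v" for v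
      by (rule order_trans[OF le]) (simp add: mult_right_mono)
  qed simp
qed

text \<open>
  Applying \<open>A\<close> lowers the Lyapunov norm by \<open>norm v\<close>, at least a fixed fraction of the Lyapunov norm
  since all norms on a finite-dimensional space are equivalent.
\<close>

lemma lyapunov_norm_contraction:
  obtains \<rho> where "0 \<le> \<rho>" "\<rho> < 1" "\<And>v. lyapunov_norm A (A *v v) \<le> \<rho> * lyapunov_norm A v"
proof -
  obtain c where c: "1 \<le> c" "\<And>v. lyapunov_norm A v \<le> c * norm v" using lyapunov_norm_bound by blast
  show ?thesis
  proof (rule that[of "1 - 1 / c"])
    fix v
    have "lyapunov_norm A v / c \<le> norm v" using c by (simp add: field_simps)
    then show "lyapunov_norm A (A *v v) \<le> (1 - 1 / c) * lyapunov_norm A v"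
      by (simp add: lyapunov_norm_step left_diff_distrib)
  qed (use c in auto)
qed

lemma lyapunov_norm_continuous: "continuous_on UNIV (lyapunov_norm A)"
proof -
  obtain c where c: "1 \<le> c" "\<And>v. lyapunov_norm A v \<le> c * norm v" using lyapunov_norm_bound by blast
  have "\<bar>lyapunov_norm A u - lyapunov_norm A v\<bar> \<le> c * norm (u - v)" for u v
    using lyapunov_norm_add[of "u - v" v] lyapunov_norm_add[of "v - u" u] lyapunov_norm_minus[of u v] c(2)[of "u - v"]
    by simp
  then show ?thesis
    using c(1) by (intro lipschitz_on_continuous_on[of c] lipschitz_onI) (auto simp: dist_real_def dist_norm)
qed

end

text \<open>
  The modulus of continuity is monotone, so on the interval $(c q^{k+1}, c q^k]$ the Dini integrand
  is at least $\omega(c q^{k+1}) / (c q^k)$, and the integral over this interval is at least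
  $(1-q)\,\omega(c q^{k+1})$. The intervals are disjoint.
\<close>

section \<open>Dini continuity along geometric sequences\<close>

lemma dini_summable:
  assumes dini: "dini_continuous_on D f" and range: "f \<in> D \<rightarrow> {0..1}" and q: "0 < q" "q < 1"
  obtains \<eta> where "summable \<eta>" "\<And>k. 0 \<le> \<eta> k"
    "\<And>k s t. s \<in> D \<Longrightarrow> t \<in> D \<Longrightarrow> \<bar>s - t\<bar> \<le> c * q ^ k \<Longrightarrow> \<bar>f s - f t\<bar> \<le> \<eta> k"
proof -
  define c' where "c' = max 1 c"
  have c': "0 < c'" by (simp add: c'_def)
  let ?\<omega> = "modulus_of_continuity D f"
  have mono: "?\<omega> s \<le> ?\<omega> t" if "s \<le> t" for s t
    unfolding modulus_of_continuity_def using that by (intro SUP_subset_mono) auto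
  have le1: "?\<omega> t \<le> 1" for t
    unfolding modulus_of_continuity_def
  proof (rule SUP_least, clarsimp)
    fix s s' assume "s \<in> D" "s' \<in> D"
    then have "0 \<le> f s" "f s \<le> 1" "0 \<le> f s'" "f s' \<le> 1" using range by (auto simp: Pi_iff)
    then show "\<bar>f s - f s'\<bar> \<le> 1" by linarith
  qed
  have val: "ennreal \<bar>f s - f t\<bar> \<le> ?\<omega> u" if "s \<in> D" "t \<in> D" "\<bar>s - t\<bar> \<le> u" for s t u
    unfolding modulus_of_continuity_def using that by (intro SUP_upper2[of "(s, t)"]) auto
  define \<eta> where "\<eta> k = enn2real (?\<omega> (c' * q ^ k))" for k
  have \<eta>: "ennreal (\<eta> k) = ?\<omega> (c' * q ^ k)" for k
    unfolding \<eta>_def using le1[of "c' * q ^ k"] by (intro ennreal_enn2real) (auto simp: less_top[symmetric] top_unique)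
  have \<eta>0: "0 \<le> \<eta> k" for k by (simp add: \<eta>_def)
  have "(\<lambda>k. c' * q ^ k) \<longlonglongrightarrow> c' * 0"
    using q by (intro tendsto_mult_left LIMSEQ_power_zero) auto
  then have "\<forall>\<^sub>F k in sequentially. c' * q ^ k < 1"
    by (intro order_tendstoD(2)) auto
  then obtain K where K: "c' * q ^ K < 1" by (auto simp: eventually_sequentially)
  define b where "b n = c' * q ^ (K + n)" for n
  have b0: "0 < b n" and b1: "b n \<le> 1" and bS: "b (Suc n) = q * b n" for n
  proof -
    show "0 < b n" using c' q by (simp add: b_def)
    have "c' * q ^ (K + n) \<le> c' * q ^ K"
      using c' q by (intro mult_left_mono power_decreasing) auto
    then show "b n \<le> 1" using K by (simp add: b_def)
    show "b (Suc n) = q * b n" by (simp add: b_def)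
  qed
  have b_dec: "b m \<le> b n" if "n \<le> m" for n m
    using that c' q by (auto simp: b_def intro!: mult_left_mono power_decreasing)
  define I where "I n = {b (Suc n)<..b n}" for n
  let ?F = "\<lambda>t. ?\<omega> t / ennreal t * indicator {0<..1} t"
  define T where "T = (\<integral>\<^sup>+ t. ?F t \<partial>lborel)"
  have T: "T < \<infinity>" using dini by (simp add: dini_continuous_on_def T_def)
  define a where "a n = ennreal (\<eta> (K + Suc n) / b n)" for n
  \<comment> \<open>The intervals \<open>I n\<close> are disjoint, so at each point at most one term of the sum below is nonzero.\<close>
  have disj: "n = m" if "t \<in> I n" "t \<in> I m" for t n m
  proof (rule ccontr)
    assume "n \<noteq> m"
    then have "Suc n \<le> m \<or> Suc m \<le> n" by linarith
    then have "b m \<le> b (Suc n) \<or> b n \<le> b (Suc m)" using b_dec by blast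
    then show False using that by (auto simp: I_def)
  qed
  have pointwise: "(\<Sum>n<N. a n * indicator (I n) t) \<le> ?F t" for N t
  proof (cases "\<exists>n<N. t \<in> I n")
    case True
    then obtain n where n: "n < N" "t \<in> I n" by blast
    have t: "b (Suc n) < t" "t \<le> b n" "0 < t" "t \<le> 1"
      using n(2) b0[of "Suc n"] b1[of n] by (auto simp: I_def)
    have "(\<Sum>m<N. a m * indicator (I m) t) = (\<Sum>m<N. if m = n then a n else 0)"
    proof (intro sum.cong refl)
      fix m
      show "a m * indicator (I m) t = (if m = n then a n else 0)"
      proof (cases "m = n")
        case False
        then have "t \<notin> I m" using disj[OF n(2)] by blast
        then show ?thesis using False by simp
      qed (use n in simp)
    qed
    also have "\<dots> = a n" using n by simp
    also have "a n \<le> ennreal (\<eta> (K + Suc n) / t)"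
      unfolding a_def using t \<eta>0 b0 by (intro ennreal_leI divide_left_mono) auto
    also have "\<dots> = ?\<omega> (b (Suc n)) / ennreal t"
      using t \<eta>0 by (simp add: divide_ennreal[symmetric] \<eta> b_def)
    also have "\<dots> \<le> ?\<omega> t / ennreal t"
      using t by (intro divide_right_mono_ennreal mono) simp
    finally show ?thesis using t by simp
  next
    case False
    then have "(\<Sum>n<N. a n * indicator (I n) t) = 0" by (intro sum.neutral) auto
    then show ?thesis by simp
  qed
  have bound: "ennreal (\<Sum>n<N. \<eta> (K + Suc n) * (1 - q)) \<le> T" for N
  proof -
    have "ennreal (\<Sum>n<N. \<eta> (K + Suc n) * (1 - q)) = (\<Sum>n<N. ennreal (\<eta> (K + Suc n) * (1 - q)))"
      using \<eta>0 q by (intro sum_ennreal[symmetric]) auto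
    also have "\<dots> = (\<Sum>n<N. a n * emeasure lborel (I n))"
    proof (intro sum.cong refl)
      fix n
      have "emeasure lborel (I n) = ennreal ((1 - q) * b n)"
        using b_dec[of n "Suc n"] by (simp add: I_def bS algebra_simps)
      moreover have "\<eta> (K + Suc n) / b n * ((1 - q) * b n) = \<eta> (K + Suc n) * (1 - q)"
        using b0[of n] by simp
      ultimately show "ennreal (\<eta> (K + Suc n) * (1 - q)) = a n * emeasure lborel (I n)"
        unfolding a_def using \<eta>0[of "K + Suc n"] b0[of n] q by (simp add: ennreal_mult'[symmetric])
    qed
    also have "\<dots> = (\<integral>\<^sup>+ t. (\<Sum>n<N. a n * indicator (I n) t) \<partial>lborel)"
      by (subst nn_integral_sum) (auto simp: I_def nn_integral_cmult_indicator)
    also have "\<dots> \<le> T" unfolding T_def by (intro nn_integral_mono pointwise)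
    finally show ?thesis .
  qed
  have "(\<Sum>n<N. \<eta> (K + Suc n) * (1 - q)) \<le> enn2real T" for N
  proof -
    have "0 \<le> (\<Sum>n<N. \<eta> (K + Suc n) * (1 - q))" using \<eta>0 q by (intro sum_nonneg mult_nonneg_nonneg) auto
    moreover have "T < top" using T by simp
    ultimately show ?thesis using enn2real_mono[OF bound[of N]] by simp
  qed
  then have "summable (\<lambda>n. \<eta> (K + Suc n) * (1 - q))"
    using \<eta>0 q by (intro summableI_nonneg_bounded[of _ "enn2real T"]) auto
  then have "summable (\<lambda>n. \<eta> (K + Suc n) * (1 - q) / (1 - q))" by (rule summable_divide)
  then have "summable (\<lambda>n. \<eta> (K + Suc n))" using q by simp
  then have "summable \<eta>"
    using summable_iff_shift[of \<eta> "K + 1"] by (simp add: add.commute add.left_commute)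
  moreover note \<eta>0
  moreover have "\<bar>f s - f t\<bar> \<le> \<eta> k" if "s \<in> D" "t \<in> D" "\<bar>s - t\<bar> \<le> c * q ^ k" for k s t
  proof -
    have "c * q ^ k \<le> c' * q ^ k" using q by (intro mult_right_mono) (auto simp: c'_def)
    then have "ennreal \<bar>f s - f t\<bar> \<le> ennreal (\<eta> k)" unfolding \<eta> using that by (intro val) auto
    then show ?thesis using \<eta>0 by (simp add: ennreal_le_iff)
  qed
  ultimately show ?thesis by (rule that)
qed

section \<open>The feedback loop as a contractive system\<close>

lemma euclidean_dist_sym: "euclidean_dist n x y = euclidean_dist n y x"
  by (simp add: euclidean_dist_def L2_set_def power2_commute)

lemma euclidean_dist_triangle: "euclidean_dist n x z \<le> euclidean_dist n x y + euclidean_dist n y z"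
  using L2_set_triangle_ineq[of "\<lambda>m. x m - y m" "\<lambda>m. y m - z m" "{..<n}"]
  by (simp add: euclidean_dist_def)

lemma euclidean_dist_nonneg: "0 \<le> euclidean_dist n x y"
  by (simp add: euclidean_dist_def L2_set_nonneg)

lemma euclidean_dist_coordinate: "m < n \<Longrightarrow> \<bar>x m - y m\<bar> \<le> euclidean_dist n x y"
  using member_le_L2_set[of "{..<n}" m "\<lambda>m. \<bar>x m - y m\<bar>"]
  by (simp add: euclidean_dist_def L2_set_def)

lemma euclidean_dist_eq_0:
  assumes "x \<in> topspace (Euclidean_space n)" "y \<in> topspace (Euclidean_space n)"
  shows "euclidean_dist n x y = 0 \<longleftrightarrow> x = y"
proof
  assume "euclidean_dist n x y = 0"
  then have "x m = y m" if "m < n" for m using euclidean_dist_coordinate[OF that, of x y] by simp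
  moreover have "x m = y m" if "\<not> m < n" for m
    using assms that by (simp add: topspace_Euclidean_space)
  ultimately show "x = y" by (intro ext) blast
qed (simp add: euclidean_dist_def L2_set_def)

lemma continuous_on_euclidean_dist:
  assumes "continuous_on S f" "continuous_on S g"
  shows "continuous_on S (\<lambda>z. euclidean_dist n (f z) (g z))"
  unfolding euclidean_dist_def L2_set_def
  by (intro continuous_intros continuous_on_product_then_coordinatewise[OF assms(1)]
      continuous_on_product_then_coordinatewise[OF assms(2)])

lemma compact_function_box:
  fixes B :: "'i \<Rightarrow> 'a::topological_space set"
  assumes "\<And>i. compact (B i)"
  shows "compact {f. \<forall>i. f i \<in> B i}"
proof -
  have "compactin (product_topology (\<lambda>_. euclidean) UNIV) (PiE UNIV B)"
    using assms by (simp add: compactin_PiE)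
  then show ?thesis by (simp add: euclidean_product_topology PiE_UNIV_domain Pi_def)
qed

text \<open>
  A triangular system of three contractions becomes one contraction if each component is given
  enough weight to pay for its influence on the next one: first \<open>\<beta>\<close> is chosen to absorb \<open>c\<close>, then \<open>\<alpha>\<close>
  to absorb \<open>\<beta> * b\<close>.
\<close>

lemma triangular_contraction_weights:
  fixes l \<rho> \<rho>' b c :: real
  assumes "0 \<le> l" "l < 1" "0 \<le> \<rho>" "\<rho> < 1" "0 \<le> \<rho>'" "\<rho>' < 1" "0 \<le> b" "0 \<le> c"
  obtains \<alpha> \<beta> q where "0 < \<alpha>" "0 < \<beta>" "0 < q" "q < 1"
    "\<And>s u v s' u' v'. \<lbrakk>0 \<le> s; 0 \<le> u; 0 \<le> v; s' \<le> l * s; u' \<le> \<rho> * u + b * s; v' \<le> \<rho>' * v + c * u\<rbrakk>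
      \<Longrightarrow> \<alpha> * s' + \<beta> * u' + v' \<le> q * (\<alpha> * s + \<beta> * u + v)"
proof -
  define m where "m = max l (max \<rho> \<rho>')"
  define q where "q = (1 + m) / 2"
  have m: "l \<le> m" "\<rho> \<le> m" "\<rho>' \<le> m" "0 \<le> m" "m < 1" using assms by (auto simp: m_def)
  then have q: "l < q" "\<rho> < q" "\<rho>' \<le> q" "0 < q" "q < 1" by (auto simp: q_def)
  define \<beta> where "\<beta> = (c + 1) / (q - \<rho>)"
  define \<alpha> where "\<alpha> = (\<beta> * b + 1) / (q - l)"
  have \<beta>: "0 < \<beta>" "\<beta> * (q - \<rho>) = c + 1" using q assms by (auto simp: \<beta>_def)
  have "0 \<le> \<beta> * b" using \<beta>(1) assms by simp
  then have \<alpha>: "0 < \<alpha>" "\<alpha> * (q - l) = \<beta> * b + 1" using q by (auto simp: \<alpha>_def)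
  show ?thesis
  proof (rule that[OF \<alpha>(1) \<beta>(1) q(4,5)])
    fix s u v s' u' v' :: real
    assume nn: "0 \<le> s" "0 \<le> u" "0 \<le> v"
      and le: "s' \<le> l * s" "u' \<le> \<rho> * u + b * s" "v' \<le> \<rho>' * v + c * u"
    have "\<alpha> * s' + \<beta> * u' + v' \<le> \<alpha> * (l * s) + \<beta> * (\<rho> * u + b * s) + (\<rho>' * v + c * u)"
      using \<alpha>(1) \<beta>(1) le by (intro add_mono mult_left_mono) auto
    also have "\<dots> = (\<alpha> * l + \<beta> * b) * s + (\<beta> * \<rho> + c) * u + \<rho>' * v"
      by (simp add: algebra_simps)
    also have "\<dots> \<le> (q * \<alpha>) * s + (q * \<beta>) * u + q * v"
      using \<alpha> \<beta> q nn by (intro add_mono mult_right_mono) (auto simp: algebra_simps)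
    also have "\<dots> = q * (\<alpha> * s + \<beta> * u + v)" by (simp add: algebra_simps)
    finally show "\<alpha> * s' + \<beta> * u' + v' \<le> q * (\<alpha> * s + \<beta> * u + v)" .
  qed
qed

definition ensemble_dist :: "'i::finite ensemble \<Rightarrow> ('i \<Rightarrow> nat \<Rightarrow> real) \<Rightarrow> ('i \<Rightarrow> nat \<Rightarrow> real) \<Rightarrow> real" where
  "ensemble_dist E x y = (\<Sum>i\<in>UNIV. euclidean_dist (state_dim E i) (x i) (y i))"

lemma ensemble_dist_nonneg: "0 \<le> ensemble_dist E x y"
  by (simp add: ensemble_dist_def sum_nonneg euclidean_dist_nonneg)

lemma ensemble_dist_ge: "euclidean_dist (state_dim E i) (x i) (y i) \<le> ensemble_dist E x y"
  unfolding ensemble_dist_def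
  by (rule member_le_sum[of i UNIV "\<lambda>i. euclidean_dist (state_dim E i) (x i) (y i)"]) (auto intro: euclidean_dist_nonneg)

lemma ensemble_dist_triangle: "ensemble_dist E x z \<le> ensemble_dist E x y + ensemble_dist E y z"
  unfolding ensemble_dist_def sum.distrib[symmetric] by (intro sum_mono euclidean_dist_triangle)

definition loop_dist ::
    "'i::finite ensemble \<Rightarrow> 'f::finite linear_filter \<Rightarrow> 'c::finite linear_controller \<Rightarrow> real \<Rightarrow> real \<Rightarrow>
     ('i, 'f, 'c) loop_state \<Rightarrow> ('i, 'f, 'c) loop_state \<Rightarrow> real" where
  "loop_dist E F C \<alpha> \<beta> = (\<lambda>(x, xf, xc) (y, yf, yc).
     \<alpha> * ensemble_dist E x y + \<beta> * lyapunov_norm (A_f F) (xf - yf) + lyapunov_norm (A_c C) (xc - yc))"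

locale closed_loop =
  fixes E :: "'i::finite ensemble"
    and F :: "'f::finite linear_filter"
    and C :: "'c::finite linear_controller"
    and r :: real
    and Pi_set :: "real set"
    and l l' :: "'i \<Rightarrow> nat \<Rightarrow> real"
    and \<delta> \<delta>' :: real
  assumes agent_space_closed:
      "\<And>i. closedin (Euclidean_space (state_dim E i)) (agent_space E i)"
    and agent_space_nonempty: "\<And>i. agent_space E i \<noteq> {}"
    and trans_map_into:
      "\<And>i j. j \<in> {1..trans_count E i} \<Longrightarrow> trans_map E i j \<in> agent_space E i \<rightarrow> agent_space E i"
    and trans_map_lipschitz:
      "\<And>i j. j \<in> {1..trans_count E i} \<Longrightarrow>
         lipschitz_map_on (state_dim E i) (l i j) (agent_space E i) (trans_map E i j)"
    and out_map_lipschitz: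
      "\<And>i k. k \<in> {1..out_count E i} \<Longrightarrow>
         lipschitz_fun_on (state_dim E i) (l' i k) (agent_space E i) (out_map E i k)"
    and trans_prob_range:
      "\<And>i j. j \<in> {1..trans_count E i} \<Longrightarrow> trans_prob E i j \<in> Pi_set \<rightarrow> {0..1}"
    and out_prob_range:
      "\<And>i k. k \<in> {1..out_count E i} \<Longrightarrow> out_prob E i k \<in> Pi_set \<rightarrow> {0..1}"
    and trans_prob_dini:
      "\<And>i j. j \<in> {1..trans_count E i} \<Longrightarrow> dini_continuous_on Pi_set (trans_prob E i j)"
    and out_prob_dini:
      "\<And>i k. k \<in> {1..out_count E i} \<Longrightarrow> dini_continuous_on Pi_set (out_prob E i k)"
    and trans_prob_sum:
      "\<And>i s. s \<in> Pi_set \<Longrightarrow> (\<Sum>j\<in>{1..trans_count E i}. trans_prob E i j s) = 1"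
    and out_prob_sum:
      "\<And>i s. s \<in> Pi_set \<Longrightarrow> (\<Sum>k\<in>{1..out_count E i}. out_prob E i k s) = 1"
    and delta_pos: "\<delta> > 0" "\<delta>' > 0"
    and trans_prob_lower:
      "\<And>i j s. j \<in> {1..trans_count E i} \<Longrightarrow> s \<in> Pi_set \<Longrightarrow> trans_prob E i j s \<ge> \<delta>"
    and out_prob_lower:
      "\<And>i k s. k \<in> {1..out_count E i} \<Longrightarrow> s \<in> Pi_set \<Longrightarrow> out_prob E i k s \<ge> \<delta>'"
    and contractive: "\<And>i j. j \<in> {1..trans_count E i} \<Longrightarrow> l i j < 1"
    and stable_controller: "schur (A_c C)"
    and stable_filter: "schur (A_f F)"
    and broadcast_admissible:
      "\<And>z :: ('i, 'f, 'c) loop_state. z \<in> loop_space E \<Longrightarrow> broadcast_signal F C r z \<in> Pi_set"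
begin

abbreviation "Nf \<equiv> lyapunov_norm (A_f F)"
abbreviation "Nc \<equiv> lyapunov_norm (A_c C)"
abbreviation "Loop \<equiv> loop_space E :: ('i, 'f, 'c) loop_state set"

lemma Nf_nonneg: "0 \<le> Nf v" and Nc_nonneg: "0 \<le> Nc v'"
  using lyapunov_norm_ge[OF stable_filter, of v] lyapunov_norm_ge[OF stable_controller, of v']
    norm_ge_zero order_trans by blast+

lemma Nf_eq_0: "Nf v = 0 \<longleftrightarrow> v = 0" and Nc_eq_0: "Nc v' = 0 \<longleftrightarrow> v' = 0"
  using lyapunov_norm_ge[OF stable_filter, of v] lyapunov_norm_ge[OF stable_controller, of v']
    lyapunov_norm_zero[OF stable_filter] lyapunov_norm_zero[OF stable_controller] by auto

lemma agent_space_closed': "closed (agent_space E i)"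
  and agent_space_subset: "agent_space E i \<subseteq> topspace (Euclidean_space (state_dim E i))"
  using agent_space_closed[of i] by (auto simp: closedin_Euclidean_space_iff)

lemma loop_space_iff: "(x, xf, xc) \<in> Loop \<longleftrightarrow> (\<forall>i. x i \<in> agent_space E i)"
  by (simp add: loop_space_def)

lemma closed_loop_space: "closed Loop"
proof -
  have "Loop = fst -` {x. \<forall>i. x i \<in> agent_space E i}"
    by (auto simp: loop_space_def)
  moreover have "closed {x. \<forall>i. x i \<in> agent_space E i}"
  proof (rule closed_Collect_all)
    fix i
    have "closed ((\<lambda>x. x i) -` agent_space E i)"
      by (rule closed_vimage[OF agent_space_closed' continuous_on_product_coordinates])
    then show "closed {x. x i \<in> agent_space E i}" by (simp add: vimage_def)
  qed
  ultimately show ?thesis by (simp only: closed_vimage_fst)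
qed

lemma loop_space_nonempty: "Loop \<noteq> {}"
proof -
  have "\<forall>i. \<exists>x. x \<in> agent_space E i" using agent_space_nonempty by blast
  then obtain x where "\<forall>i. x i \<in> agent_space E i" by (rule choice[THEN exE])
  then show ?thesis using loop_space_iff by blast
qed

definition trans_rate :: real where
  "trans_rate = Max (insert 0 ((\<lambda>(i, j). l i j) ` (SIGMA i:UNIV. {1..trans_count E i})))"

definition out_rate :: real where
  "out_rate = Max (insert 0 ((\<lambda>(i, k). l' i k) ` (SIGMA i:UNIV. {1..out_count E i})))"

lemma trans_rate: "0 \<le> trans_rate" "trans_rate < 1"
  and l_le: "j \<in> {1..trans_count E i} \<Longrightarrow> l i j \<le> trans_rate"
proof -
  show "0 \<le> trans_rate" unfolding trans_rate_def by (intro Max_ge) auto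
  show "trans_rate < 1" unfolding trans_rate_def using contractive by (subst Max_less_iff) auto
  show "l i j \<le> trans_rate" if "j \<in> {1..trans_count E i}"
    unfolding trans_rate_def using that by (intro Max_ge) force+
qed

lemma out_rate: "0 \<le> out_rate" and l'_le: "k \<in> {1..out_count E i} \<Longrightarrow> l' i k \<le> out_rate"
proof -
  show "0 \<le> out_rate" unfolding out_rate_def by (intro Max_ge) auto
  show "l' i k \<le> out_rate" if "k \<in> {1..out_count E i}"
    unfolding out_rate_def using that by (intro Max_ge) force+
qed

context
  fixes x y :: "'i \<Rightarrow> nat \<Rightarrow> real"
  assumes xy: "\<And>i. x i \<in> agent_space E i" "\<And>i. y i \<in> agent_space E i"
begin

lemma trans_maps_contract:
  assumes js: "\<And>i. js i \<in> {1..trans_count E i}"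
  shows "ensemble_dist E (\<lambda>i. trans_map E i (js i) (x i)) (\<lambda>i. trans_map E i (js i) (y i))
    \<le> trans_rate * ensemble_dist E x y"
  unfolding ensemble_dist_def sum_distrib_left
proof (rule sum_mono)
  fix i
  let ?d = "euclidean_dist (state_dim E i)"
  have "?d (trans_map E i (js i) (x i)) (trans_map E i (js i) (y i)) \<le> l i (js i) * ?d (x i) (y i)"
    using trans_map_lipschitz[OF js[of i]] xy by (simp add: lipschitz_map_on_def)
  also have "\<dots> \<le> trans_rate * ?d (x i) (y i)"
    by (rule mult_right_mono[OF l_le[OF js] euclidean_dist_nonneg])
  finally show "?d (trans_map E i (js i) (x i)) (trans_map E i (js i) (y i)) \<le> trans_rate * ?d (x i) (y i)" .
qed

lemma aggregate_output_lipschitz: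
  assumes ls: "\<And>i. ls i \<in> {1..out_count E i}"
  shows "\<bar>(\<Sum>i\<in>UNIV. out_map E i (ls i) (x i)) - (\<Sum>i\<in>UNIV. out_map E i (ls i) (y i))\<bar>
    \<le> out_rate * ensemble_dist E x y"
  unfolding ensemble_dist_def sum_distrib_left sum_subtractf[symmetric]
proof (rule order_trans[OF sum_abs sum_mono])
  fix i
  let ?d = "euclidean_dist (state_dim E i)"
  have "\<bar>out_map E i (ls i) (x i) - out_map E i (ls i) (y i)\<bar> \<le> l' i (ls i) * ?d (x i) (y i)"
    using out_map_lipschitz[OF ls[of i]] xy by (simp add: lipschitz_fun_on_def)
  also have "\<dots> \<le> out_rate * ?d (x i) (y i)"
    by (rule mult_right_mono[OF l'_le[OF ls] euclidean_dist_nonneg])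
  finally show "\<bar>out_map E i (ls i) (x i) - out_map E i (ls i) (y i)\<bar> \<le> out_rate * ?d (x i) (y i)" .
qed

end

lemma joint_choicesD:
  "(js, ls) \<in> joint_choices E \<Longrightarrow> js i \<in> {1..trans_count E i} \<and> ls i \<in> {1..out_count E i}"
  by (auto simp: joint_choices_def PiE_iff)

text \<open>
  The agents ignore the filter and the controller, the filter sees only the agents, and the
  controller only the filter: with the Lyapunov norms, the three distances satisfy the triangular
  system above. The factor of the agents is below $1$ since there are finitely many maps.
\<close>

lemma loop_steps_contract:
  obtains \<alpha> \<beta> q where "0 < \<alpha>" "0 < \<beta>" "0 < q" "q < 1"
    "\<And>js ls z z'. \<lbrakk>(js, ls) \<in> joint_choices E; z \<in> Loop; z' \<in> Loop\<rbrakk>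
      \<Longrightarrow> loop_dist E F C \<alpha> \<beta> (loop_step E F C r js ls z) (loop_step E F C r js ls z') \<le> q * loop_dist E F C \<alpha> \<beta> z z'"
proof -
  obtain \<rho>f where \<rho>f: "0 \<le> \<rho>f" "\<rho>f < 1" "\<And>v. Nf (A_f F *v v) \<le> \<rho>f * Nf v"
    using lyapunov_norm_contraction[OF stable_filter] by blast
  obtain \<rho>c where \<rho>c: "0 \<le> \<rho>c" "\<rho>c < 1" "\<And>v. Nc (A_c C *v v) \<le> \<rho>c * Nc v"
    using lyapunov_norm_contraction[OF stable_controller] by blast
  obtain \<alpha> \<beta> q where w: "0 < \<alpha>" "0 < \<beta>" "0 < q" "q < 1"
    "\<And>s u v s' u' v'. \<lbrakk>0 \<le> s; 0 \<le> u; 0 \<le> v; s' \<le> trans_rate * s;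
       u' \<le> \<rho>f * u + (out_rate * Nf (B_f F)) * s; v' \<le> \<rho>c * v + (norm (C_f F) * Nc (B_c C)) * u\<rbrakk>
      \<Longrightarrow> \<alpha> * s' + \<beta> * u' + v' \<le> q * (\<alpha> * s + \<beta> * u + v)"
    using triangular_contraction_weights[OF trans_rate \<rho>f(1,2) \<rho>c(1,2)
        mult_nonneg_nonneg[OF out_rate Nf_nonneg[of "B_f F"]]
        mult_nonneg_nonneg[OF norm_ge_zero[of "C_f F"] Nc_nonneg[of "B_c C"]]] by blast
  show ?thesis
  proof (rule that[OF w(1-4)])
    fix js ls and z z' :: "('i, 'f, 'c) loop_state"
    assume c: "(js, ls) \<in> joint_choices E" and zz': "z \<in> Loop" "z' \<in> Loop"
    obtain x xf xc where z1: "z = (x, xf, xc)" by (rule prod_cases3)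
  obtain y yf yc where z2: "z' = (y, yf, yc)" by (rule prod_cases3)
  note z = z1 z2
    have xy: "\<And>i. x i \<in> agent_space E i" "\<And>i. y i \<in> agent_space E i"
      using zz' by (auto simp: z loop_space_iff)
    let ?o = "\<lambda>x. \<Sum>i\<in>UNIV. out_map E i (ls i) (x i)"
    have "Nf ((A_f F *v xf + ?o x *\<^sub>R B_f F) - (A_f F *v yf + ?o y *\<^sub>R B_f F))
        = Nf (A_f F *v (xf - yf) + (?o x - ?o y) *\<^sub>R B_f F)"
      by (simp add: matrix_vector_mult_diff_distrib scaleR_left_diff_distrib algebra_simps)
    also have "\<dots> \<le> Nf (A_f F *v (xf - yf)) + \<bar>?o x - ?o y\<bar> * Nf (B_f F)"
      using lyapunov_norm_add[OF stable_filter] by (simp only: lyapunov_norm_scale[OF stable_filter, symmetric])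
    also have "\<dots> \<le> \<rho>f * Nf (xf - yf) + (out_rate * ensemble_dist E x y) * Nf (B_f F)"
      using joint_choicesD[OF c]
      by (intro add_mono \<rho>f(3) mult_right_mono aggregate_output_lipschitz xy Nf_nonneg) blast
    finally have f: "Nf ((A_f F *v xf + ?o x *\<^sub>R B_f F) - (A_f F *v yf + ?o y *\<^sub>R B_f F))
        \<le> \<rho>f * Nf (xf - yf) + (out_rate * Nf (B_f F)) * ensemble_dist E x y"
      by (simp add: mult_ac)
    let ?e = "\<lambda>v. r - C_f F \<bullet> v"
    have "Nc ((A_c C *v xc + ?e xf *\<^sub>R B_c C) - (A_c C *v yc + ?e yf *\<^sub>R B_c C))
        = Nc (A_c C *v (xc - yc) + (C_f F \<bullet> (yf - xf)) *\<^sub>R B_c C)"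
      by (simp add: matrix_vector_mult_diff_distrib scaleR_left_diff_distrib inner_diff_right algebra_simps)
    also have "\<dots> \<le> Nc (A_c C *v (xc - yc)) + \<bar>C_f F \<bullet> (yf - xf)\<bar> * Nc (B_c C)"
      using lyapunov_norm_add[OF stable_controller] by (simp only: lyapunov_norm_scale[OF stable_controller, symmetric])
    also have "\<dots> \<le> \<rho>c * Nc (xc - yc) + (norm (C_f F) * Nf (xf - yf)) * Nc (B_c C)"
    proof (intro add_mono \<rho>c(3) mult_right_mono Nc_nonneg)
      have "\<bar>C_f F \<bullet> (yf - xf)\<bar> \<le> norm (C_f F) * norm (xf - yf)"
        using Cauchy_Schwarz_ineq2[of "C_f F" "yf - xf"] by (simp add: norm_minus_commute)
      also have "\<dots> \<le> norm (C_f F) * Nf (xf - yf)"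
        by (intro mult_left_mono lyapunov_norm_ge[OF stable_filter]) simp
      finally show "\<bar>C_f F \<bullet> (yf - xf)\<bar> \<le> norm (C_f F) * Nf (xf - yf)" .
    qed
    finally have c': "Nc ((A_c C *v xc + ?e xf *\<^sub>R B_c C) - (A_c C *v yc + ?e yf *\<^sub>R B_c C))
        \<le> \<rho>c * Nc (xc - yc) + (norm (C_f F) * Nc (B_c C)) * Nf (xf - yf)"
      by (simp add: mult_ac)
    show "loop_dist E F C \<alpha> \<beta> (loop_step E F C r js ls z) (loop_step E F C r js ls z') \<le> q * loop_dist E F C \<alpha> \<beta> z z'"
      unfolding loop_dist_def loop_step_def z prod.case error_signal_def
      by (rule w(5)[OF ensemble_dist_nonneg Nf_nonneg Nc_nonneg trans_maps_contract[OF xy] f c'])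
        (use joint_choicesD[OF c] in blast)
  qed
qed

context
  fixes \<alpha> \<beta> :: real
  assumes \<alpha>: "0 < \<alpha>" and \<beta>: "0 < \<beta>"
begin

abbreviation "D \<equiv> loop_dist E F C \<alpha> \<beta>"

lemma loop_dist_parts:
  "\<alpha> * ensemble_dist E x y \<le> D (x, xf, xc) (y, yf, yc)"
  "\<beta> * Nf (xf - yf) \<le> D (x, xf, xc) (y, yf, yc)"
  "Nc (xc - yc) \<le> D (x, xf, xc) (y, yf, yc)"
proof -
  have "0 \<le> \<alpha> * ensemble_dist E x y"
    by (rule mult_nonneg_nonneg[OF less_imp_le[OF \<alpha>] ensemble_dist_nonneg])
  moreover have "0 \<le> \<beta> * Nf (xf - yf)"
    by (rule mult_nonneg_nonneg[OF less_imp_le[OF \<beta>] Nf_nonneg])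
  moreover have "0 \<le> Nc (xc - yc)" by (rule Nc_nonneg)
  ultimately show "\<alpha> * ensemble_dist E x y \<le> D (x, xf, xc) (y, yf, yc)"
    "\<beta> * Nf (xf - yf) \<le> D (x, xf, xc) (y, yf, yc)"
    "Nc (xc - yc) \<le> D (x, xf, xc) (y, yf, yc)"
    unfolding loop_dist_def prod.case by linarith+
qed

lemma loop_dist_sym: "D z z' = D z' z"
proof -
  have "ensemble_dist E (fst z) (fst z') = ensemble_dist E (fst z') (fst z)"
    unfolding ensemble_dist_def by (intro sum.cong refl euclidean_dist_sym)
  then show ?thesis
    unfolding loop_dist_def case_prod_beta
      lyapunov_norm_minus[OF stable_filter, of "fst (snd z)" "fst (snd z')"]
      lyapunov_norm_minus[OF stable_controller, of "snd (snd z)" "snd (snd z')"] by simp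
qed

lemma loop_dist_triangle: "D x z \<le> D x y + D y z"
proof -
  obtain x1 x2 x3 where [simp]: "x = (x1, x2, x3)" by (rule prod_cases3)
  obtain y1 y2 y3 where [simp]: "y = (y1, y2, y3)" by (rule prod_cases3)
  obtain z1 z2 z3 where [simp]: "z = (z1, z2, z3)" by (rule prod_cases3)
  have "\<alpha> * ensemble_dist E x1 z1 \<le> \<alpha> * (ensemble_dist E x1 y1 + ensemble_dist E y1 z1)"
    using \<alpha> by (intro mult_left_mono ensemble_dist_triangle) auto
  moreover have "\<beta> * Nf (x2 - z2) \<le> \<beta> * (Nf (x2 - y2) + Nf (y2 - z2))"
    using \<beta> lyapunov_norm_add[OF stable_filter, of "x2 - y2" "y2 - z2"] by (intro mult_left_mono) auto
  moreover have "Nc (x3 - z3) \<le> Nc (x3 - y3) + Nc (y3 - z3)"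
    using lyapunov_norm_add[OF stable_controller, of "x3 - y3" "y3 - z3"] by simp
  ultimately show ?thesis by (simp add: loop_dist_def distrib_left)
qed

lemma loop_dist_eq_0:
  assumes "z \<in> Loop" "z' \<in> Loop"
  shows "D z z' = 0 \<longleftrightarrow> z = z'"
proof -
  obtain x xf xc where z1: "z = (x, xf, xc)" by (rule prod_cases3)
  obtain y yf yc where z2: "z' = (y, yf, yc)" by (rule prod_cases3)
  note z = z1 z2
  show ?thesis
  proof
    assume D: "D z z' = 0"
    have "\<alpha> * ensemble_dist E x y \<le> 0" "\<beta> * Nf (xf - yf) \<le> 0" "Nc (xc - yc) \<le> 0"
      using loop_dist_parts[where x=x and y=y and xf=xf and yf=yf and xc=xc and yc=yc] D by (simp_all add: z)
    then have 0: "ensemble_dist E x y \<le> 0" "Nf (xf - yf) \<le> 0" "Nc (xc - yc) \<le> 0"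
      using \<alpha> \<beta> by (simp_all add: mult_le_0_iff)
    have "x i = y i" for i
    proof -
      have "euclidean_dist (state_dim E i) (x i) (y i) = 0"
        using ensemble_dist_ge[of E i x y] euclidean_dist_nonneg[of "state_dim E i" "x i" "y i"] 0(1) by linarith
      then show ?thesis
        using assms agent_space_subset[of i] euclidean_dist_eq_0[of "x i" "state_dim E i" "y i"]
        by (auto simp: z loop_space_iff)
    qed
    moreover have "xf = yf" using 0(2) Nf_nonneg[of "xf - yf"] Nf_eq_0[of "xf - yf"] by simp
    moreover have "xc = yc" using 0(3) Nc_nonneg[of "xc - yc"] Nc_eq_0[of "xc - yc"] by simp
    ultimately show "z = z'" by (auto simp: z)
  next
    assume "z = z'"
    then show "D z z' = 0"
      using lyapunov_norm_zero[OF stable_filter] lyapunov_norm_zero[OF stable_controller]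
      by (simp add: z loop_dist_def ensemble_dist_def euclidean_dist_def L2_set_def)
  qed
qed

lemma loop_dist_continuous: "continuous_on UNIV (\<lambda>(z, z'). D z z')"
proof -
  have Nf: "continuous_on UNIV Nf" and Nc: "continuous_on UNIV Nc"
    by (rule lyapunov_norm_continuous[OF stable_filter], rule lyapunov_norm_continuous[OF stable_controller])
  have x: "continuous_on UNIV (\<lambda>u. fst (g u) i)" if "continuous_on UNIV g"
    for g :: "('i, 'f, 'c) loop_state \<times> ('i, 'f, 'c) loop_state \<Rightarrow> ('i, 'f, 'c) loop_state" and i
    by (rule continuous_on_product_then_coordinatewise[OF continuous_on_fst[OF that]])
  have id: "continuous_on UNIV (\<lambda>u :: ('i, 'f, 'c) loop_state \<times> ('i, 'f, 'c) loop_state. u)"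
    by (rule continuous_on_id)
  note fst = continuous_on_fst[OF id] and snd = continuous_on_snd[OF id]
  have agents: "continuous_on UNIV (\<lambda>u :: ('i, 'f, 'c) loop_state \<times> ('i, 'f, 'c) loop_state.
      ensemble_dist E (fst (fst u)) (fst (snd u)))"
    unfolding ensemble_dist_def
    by (rule continuous_on_sum) (rule continuous_on_euclidean_dist[OF x[OF fst] x[OF snd]])
  have filt: "continuous_on UNIV (\<lambda>u :: ('i, 'f, 'c) loop_state \<times> ('i, 'f, 'c) loop_state.
      Nf (fst (snd (fst u)) - fst (snd (snd u))))"
    by (rule continuous_on_compose2[OF Nf continuous_on_diff[OF
          continuous_on_fst[OF continuous_on_snd[OF fst]] continuous_on_fst[OF continuous_on_snd[OF snd]]] subset_UNIV])
  have contr: "continuous_on UNIV (\<lambda>u :: ('i, 'f, 'c) loop_state \<times> ('i, 'f, 'c) loop_state.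
      Nc (snd (snd (fst u)) - snd (snd (snd u))))"
    by (rule continuous_on_compose2[OF Nc continuous_on_diff[OF
          continuous_on_snd[OF continuous_on_snd[OF fst]] continuous_on_snd[OF continuous_on_snd[OF snd]]] subset_UNIV])
  show ?thesis
    unfolding loop_dist_def case_prod_beta
    by (rule continuous_on_add[OF continuous_on_add[OF continuous_on_mult[OF continuous_on_const agents]
            continuous_on_mult[OF continuous_on_const filt]] contr])
qed

text \<open>
  The ball is closed and lies in a product of compact intervals for the agents' coordinates, which
  are $0$ beyond the dimension of the agent, and of closed balls for the filter and the controller.
\<close>

lemma loop_dist_proper:
  assumes z: "z \<in> Loop" shows "compact {z' \<in> Loop. D z z' \<le> R}"
proof -
  obtain x xf xc where [simp]: "z = (x, xf, xc)" by (rule prod_cases3)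
  define B where "B i m = (if m < state_dim E i then {x i m - R / \<alpha>..x i m + R / \<alpha>} else {0})" for i and m :: nat
  let ?K = "{y. \<forall>i. y i \<in> {u. \<forall>m. u m \<in> B i m}} \<times> cball xf (R / \<beta>) \<times> cball xc R"
  have "compact ?K"
    by (intro compact_Times compact_cball compact_function_box) (simp add: B_def)
  moreover have "closed {z' \<in> Loop. D z z' \<le> R}"
  proof -
    have "continuous_on UNIV (\<lambda>z'. D z z')"
      using continuous_on_compose2[OF loop_dist_continuous, of UNIV "\<lambda>z'. (z, z')"]
      by (simp add: continuous_on_Pair continuous_on_const continuous_on_id)
    then have "closed {z'. D z z' \<le> R}" by (intro closed_Collect_le continuous_on_const)
    moreover have "{z' \<in> Loop. D z z' \<le> R} = Loop \<inter> {z'. D z z' \<le> R}" by blast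
    ultimately show ?thesis using closed_loop_space by (simp add: closed_Int)
  qed
  moreover have "{z' \<in> Loop. D z z' \<le> R} \<subseteq> ?K"
  proof
    fix z' assume "z' \<in> {z' \<in> Loop. D z z' \<le> R}"
    then obtain y yf yc where y: "z' = (y, yf, yc)" "(y, yf, yc) \<in> Loop" "D (x, xf, xc) (y, yf, yc) \<le> R"
      by (cases z') auto
    have le: "\<alpha> * ensemble_dist E x y \<le> R" "\<beta> * Nf (xf - yf) \<le> R" "Nc (xc - yc) \<le> R"
      by (rule order_trans[OF loop_dist_parts(1) y(3)], rule order_trans[OF loop_dist_parts(2) y(3)],
          rule order_trans[OF loop_dist_parts(3) y(3)])
    have "y i m \<in> B i m" for i m
    proof (cases "m < state_dim E i")
      case True
      have "\<bar>x i m - y i m\<bar> \<le> ensemble_dist E x y"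
        using euclidean_dist_coordinate[OF True, of "x i" "y i"] ensemble_dist_ge[of E i x y] by linarith
      also have "\<dots> \<le> R / \<alpha>" using le(1) \<alpha> by (simp add: field_simps)
      finally have "x i m - R / \<alpha> \<le> y i m \<and> y i m \<le> x i m + R / \<alpha>" by linarith
      then show ?thesis using True by (simp add: B_def)
    next
      case False
      then show ?thesis
        using y(2) agent_space_subset[of i] by (auto simp: loop_space_iff B_def topspace_Euclidean_space)
    qed
    moreover have "dist xf yf \<le> R / \<beta>"
    proof -
      have "norm (xf - yf) \<le> Nf (xf - yf)" by (rule lyapunov_norm_ge[OF stable_filter])
      also have "\<dots> \<le> R / \<beta>" using le(2) \<beta> by (simp add: field_simps)
      finally show ?thesis by (simp add: dist_norm)
    qed
    moreover have "dist xc yc \<le> R"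
      using lyapunov_norm_ge[OF stable_controller, of "xc - yc"] le(3) by (simp add: dist_norm)
    ultimately show "z' \<in> ?K" by (simp add: y(1))
  qed
  ultimately show ?thesis using compact_Int_closed[of ?K "{z' \<in> Loop. D z z' \<le> R}"] by (simp only: Int_absorb1)
qed

lemma broadcast_lipschitz:
  obtains L where "0 \<le> L" "\<And>z z'. \<bar>broadcast_signal F C r z - broadcast_signal F C r z'\<bar> \<le> L * D z z'"
proof (rule that[of "norm (C_c C) + \<bar>D_c C\<bar> * norm (C_f F) / \<beta>"])
  show "0 \<le> norm (C_c C) + \<bar>D_c C\<bar> * norm (C_f F) / \<beta>" using \<beta> by simp
  fix z z' :: "('i, 'f, 'c) loop_state"
  obtain x xf xc where z1: "z = (x, xf, xc)" by (rule prod_cases3)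
  obtain y yf yc where z2: "z' = (y, yf, yc)" by (rule prod_cases3)
  note z = z1 z2
  have "broadcast_signal F C r z - broadcast_signal F C r z' = C_c C \<bullet> (xc - yc) - D_c C * (C_f F \<bullet> (xf - yf))"
    by (simp add: z broadcast_signal_def error_signal_def inner_diff_right algebra_simps)
  then have "\<bar>broadcast_signal F C r z - broadcast_signal F C r z'\<bar>
      \<le> \<bar>C_c C \<bullet> (xc - yc)\<bar> + \<bar>D_c C\<bar> * \<bar>C_f F \<bullet> (xf - yf)\<bar>"
    using abs_triangle_ineq4[of "C_c C \<bullet> (xc - yc)" "D_c C * (C_f F \<bullet> (xf - yf))"] by (simp only: abs_mult)
  also have "\<dots> \<le> norm (C_c C) * norm (xc - yc) + \<bar>D_c C\<bar> * (norm (C_f F) * norm (xf - yf))"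
    by (intro add_mono mult_left_mono Cauchy_Schwarz_ineq2) simp
  also have "\<dots> \<le> norm (C_c C) * D z z' + \<bar>D_c C\<bar> * (norm (C_f F) * (D z z' / \<beta>))"
  proof (intro add_mono mult_left_mono)
    show "norm (xc - yc) \<le> D z z'"
      unfolding z by (rule order_trans[OF lyapunov_norm_ge[OF stable_controller] loop_dist_parts(3)])
    have "\<beta> * norm (xf - yf) \<le> \<beta> * Nf (xf - yf)"
      using \<beta> lyapunov_norm_ge[OF stable_filter] by simp
    also have "\<dots> \<le> D z z'" unfolding z by (rule loop_dist_parts(2))
    finally show "norm (xf - yf) \<le> D z z' / \<beta>" using \<beta> by (simp add: field_simps)
  qed simp_all
  also have "\<dots> = (norm (C_c C) + \<bar>D_c C\<bar> * norm (C_f F) / \<beta>) * D z z'" by (simp add: algebra_simps)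
  finally show "\<bar>broadcast_signal F C r z - broadcast_signal F C r z'\<bar>
      \<le> (norm (C_c C) + \<bar>D_c C\<bar> * norm (C_f F) / \<beta>) * D z z'" .
qed

end

lemma joint_choice_prob_sum:
  assumes s: "s \<in> Pi_set" shows "(\<Sum>c\<in>joint_choices E. joint_choice_prob E s c) = 1"
proof -
  have "(\<Sum>c\<in>joint_choices E. joint_choice_prob E s c)
      = (\<Sum>js\<in>(\<Pi>\<^sub>E i\<in>UNIV. {1..trans_count E i}). \<Prod>i\<in>UNIV. trans_prob E i (js i) s)
        * (\<Sum>ls\<in>(\<Pi>\<^sub>E i\<in>UNIV. {1..out_count E i}). \<Prod>i\<in>UNIV. out_prob E i (ls i) s)"
    by (simp add: joint_choices_def joint_choice_prob_def sum_product sum.cartesian_product case_prod_beta)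
  also have "\<dots> = (\<Prod>i\<in>UNIV. \<Sum>j\<in>{1..trans_count E i}. trans_prob E i j s)
        * (\<Prod>i\<in>UNIV. \<Sum>k\<in>{1..out_count E i}. out_prob E i k s)"
    by (simp add: prod_sum_PiE)
  also have "\<dots> = 1" using trans_prob_sum[OF s] out_prob_sum[OF s] by simp
  finally show ?thesis .
qed

lemma joint_choice_prob_lower:
  assumes s: "s \<in> Pi_set" and c: "c \<in> joint_choices E"
  shows "\<delta> ^ CARD('i) * \<delta>' ^ CARD('i) \<le> joint_choice_prob E s c"
proof -
  obtain js ls where cs: "c = (js, ls)" by (cases c)
  note j = joint_choicesD[OF c[unfolded cs]]
  have "(\<Prod>i\<in>(UNIV :: 'i set). \<delta>) \<le> (\<Prod>i\<in>UNIV. trans_prob E i (js i) s)"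
    using j trans_prob_lower[OF _ s] delta_pos by (intro prod_mono) auto
  moreover have "(\<Prod>i\<in>(UNIV :: 'i set). \<delta>') \<le> (\<Prod>i\<in>UNIV. out_prob E i (ls i) s)"
    using j out_prob_lower[OF _ s] delta_pos by (intro prod_mono) auto
  moreover have "0 \<le> \<delta> ^ CARD('i)" "0 \<le> \<delta>' ^ CARD('i)" using delta_pos by simp_all
  ultimately show ?thesis
    unfolding cs joint_choice_prob_def prod.case prod_constant
    by (intro mult_mono) linarith+
qed

lemma abs_prod_diff:
  fixes a b :: "'i \<Rightarrow> real"
  assumes "\<And>i. a i \<in> {0..1}" "\<And>i. b i \<in> {0..1}"
  shows "\<bar>(\<Prod>i\<in>UNIV. a i) - (\<Prod>i\<in>UNIV. b i)\<bar> \<le> (\<Sum>i\<in>UNIV. \<bar>a i - b i\<bar>)"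
  using norm_prod_diff[of UNIV a b] assms by simp

text \<open>
  Products of numbers in $[0,1]$ differ by at most the sum of the differences of the factors.
\<close>

lemma joint_choice_prob_diff:
  assumes s: "s \<in> Pi_set" and t: "t \<in> Pi_set" and c: "(js, ls) \<in> joint_choices E"
  shows "\<bar>joint_choice_prob E s (js, ls) - joint_choice_prob E t (js, ls)\<bar>
    \<le> (\<Sum>i\<in>UNIV. \<bar>trans_prob E i (js i) s - trans_prob E i (js i) t\<bar>)
      + (\<Sum>i\<in>UNIV. \<bar>out_prob E i (ls i) s - out_prob E i (ls i) t\<bar>)"
proof -
  note j = joint_choicesD[OF c]
  have T: "trans_prob E i (js i) u \<in> {0..1}" and O: "out_prob E i (ls i) u \<in> {0..1}" if "u \<in> Pi_set" for i u
    using trans_prob_range[of "js i" i] out_prob_range[of "ls i" i] j[of i] that by blast+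
  let ?T = "\<lambda>u. \<Prod>i\<in>UNIV. trans_prob E i (js i) u" and ?O = "\<lambda>u. \<Prod>i\<in>UNIV. out_prob E i (ls i) u"
  have bounds: "0 \<le> ?O u" "?O u \<le> 1" "0 \<le> ?T u" "?T u \<le> 1" if "u \<in> Pi_set" for u
    using T[OF that] O[OF that] by (auto intro!: prod_nonneg prod_le_1)
  have "?T s * ?O s - ?T t * ?O t = (?T s - ?T t) * ?O s + ?T t * (?O s - ?O t)"
    by (simp add: algebra_simps)
  then have "\<bar>?T s * ?O s - ?T t * ?O t\<bar> \<le> \<bar>?T s - ?T t\<bar> * \<bar>?O s\<bar> + \<bar>?T t\<bar> * \<bar>?O s - ?O t\<bar>"
    using abs_triangle_ineq[of "(?T s - ?T t) * ?O s" "?T t * (?O s - ?O t)"] by (simp only: abs_mult)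
  also have "\<dots> \<le> \<bar>?T s - ?T t\<bar> * 1 + 1 * \<bar>?O s - ?O t\<bar>"
    using bounds[OF s] bounds[OF t] by (intro add_mono mult_left_mono mult_right_mono) auto
  also have "\<dots> \<le> (\<Sum>i\<in>UNIV. \<bar>trans_prob E i (js i) s - trans_prob E i (js i) t\<bar>)
      + (\<Sum>i\<in>UNIV. \<bar>out_prob E i (ls i) s - out_prob E i (ls i) t\<bar>)"
    using abs_prod_diff[of "\<lambda>i. trans_prob E i (js i) s" "\<lambda>i. trans_prob E i (js i) t"]
      abs_prod_diff[of "\<lambda>i. out_prob E i (ls i) s" "\<lambda>i. out_prob E i (ls i) t"] T[OF s] T[OF t] O[OF s] O[OF t]
    by simp
  finally show ?thesis by (simp add: joint_choice_prob_def)
qed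

lemma joint_choice_prob_variation:
  assumes q: "0 < q" "q < 1"
  obtains \<eta> where "summable \<eta>"
    "\<And>k s t b. \<lbrakk>s \<in> Pi_set; t \<in> Pi_set; \<bar>s - t\<bar> \<le> c * q ^ k; b \<in> joint_choices E\<rbrakk>
      \<Longrightarrow> \<bar>joint_choice_prob E s b - joint_choice_prob E t b\<bar> \<le> \<eta> k"
proof -
  \<comment> \<open>\<open>V f \<eta>\<close>: the sequence \<open>\<eta>\<close> dominates the variation of \<open>f\<close> at the scales \<open>c * q ^ k\<close>.\<close>
  define V where "V f \<eta> \<longleftrightarrow> summable \<eta> \<and> (\<forall>k. 0 \<le> \<eta> k) \<and>
    (\<forall>k. \<forall>s\<in>Pi_set. \<forall>t\<in>Pi_set. \<bar>s - t\<bar> \<le> c * q ^ k \<longrightarrow> \<bar>f s - f t\<bar> \<le> \<eta> k)"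
    for f :: "real \<Rightarrow> real" and \<eta>
  have ex: "V f (SOME \<eta>. V f \<eta>)" if f: "dini_continuous_on Pi_set f" "f \<in> Pi_set \<rightarrow> {0..1}" for f
  proof -
    obtain \<eta> where "summable \<eta>" "\<And>k. 0 \<le> \<eta> k"
      "\<And>k s t. s \<in> Pi_set \<Longrightarrow> t \<in> Pi_set \<Longrightarrow> \<bar>s - t\<bar> \<le> c * q ^ k \<Longrightarrow> \<bar>f s - f t\<bar> \<le> \<eta> k"
      by (rule dini_summable[OF f q, of c]) blast
    then have "\<exists>\<eta>. V f \<eta>" unfolding V_def by blast
    then show ?thesis by (rule someI_ex)
  qed
  define \<eta>t where "\<eta>t i j = (SOME \<eta>. V (trans_prob E i j) \<eta>)" for i j
  define \<eta>o where "\<eta>o i j = (SOME \<eta>. V (out_prob E i j) \<eta>)" for i j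
  have \<eta>t: "summable (\<eta>t i j) \<and> (\<forall>k. 0 \<le> \<eta>t i j k) \<and> (\<forall>k. \<forall>s\<in>Pi_set. \<forall>t\<in>Pi_set.
      \<bar>s - t\<bar> \<le> c * q ^ k \<longrightarrow> \<bar>trans_prob E i j s - trans_prob E i j t\<bar> \<le> \<eta>t i j k)"
    if "j \<in> {1..trans_count E i}" for i j
    using ex[OF trans_prob_dini[OF that] trans_prob_range[OF that]] unfolding \<eta>t_def V_def .
  have \<eta>o: "summable (\<eta>o i j) \<and> (\<forall>k. 0 \<le> \<eta>o i j k) \<and> (\<forall>k. \<forall>s\<in>Pi_set. \<forall>t\<in>Pi_set.
      \<bar>s - t\<bar> \<le> c * q ^ k \<longrightarrow> \<bar>out_prob E i j s - out_prob E i j t\<bar> \<le> \<eta>o i j k)"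
    if "j \<in> {1..out_count E i}" for i j
    using ex[OF out_prob_dini[OF that] out_prob_range[OF that]] unfolding \<eta>o_def V_def .
  define \<eta> where "\<eta> k = (\<Sum>i\<in>UNIV. \<Sum>j\<in>{1..trans_count E i}. \<eta>t i j k) + (\<Sum>i\<in>UNIV. \<Sum>j\<in>{1..out_count E i}. \<eta>o i j k)" for k
  show ?thesis
  proof (rule that[of \<eta>])
    show "summable \<eta>"
      unfolding \<eta>_def using \<eta>t \<eta>o by (intro summable_add summable_sum) blast+
    fix k s t b
    assume s: "s \<in> Pi_set" and t: "t \<in> Pi_set" and st: "\<bar>s - t\<bar> \<le> c * q ^ k" and b: "b \<in> joint_choices E"
    obtain js ls where bs: "b = (js, ls)" by (cases b)
    note j = joint_choicesD[OF b[unfolded bs]]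
    have "\<bar>trans_prob E i (js i) s - trans_prob E i (js i) t\<bar> \<le> (\<Sum>j\<in>{1..trans_count E i}. \<eta>t i j k)" for i
    proof -
      have "\<bar>trans_prob E i (js i) s - trans_prob E i (js i) t\<bar> \<le> \<eta>t i (js i) k"
        using \<eta>t[OF j[THEN conjunct1]] s t st by blast
      also have "\<dots> \<le> (\<Sum>j\<in>{1..trans_count E i}. \<eta>t i j k)"
        using \<eta>t j[of i] by (intro member_le_sum) blast+
      finally show ?thesis .
    qed
    moreover have "\<bar>out_prob E i (ls i) s - out_prob E i (ls i) t\<bar> \<le> (\<Sum>j\<in>{1..out_count E i}. \<eta>o i j k)" for i
    proof -
      have "\<bar>out_prob E i (ls i) s - out_prob E i (ls i) t\<bar> \<le> \<eta>o i (ls i) k"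
        using \<eta>o[OF j[THEN conjunct2]] s t st by blast
      also have "\<dots> \<le> (\<Sum>j\<in>{1..out_count E i}. \<eta>o i j k)"
        using \<eta>o j[of i] by (intro member_le_sum) blast+
      finally show ?thesis .
    qed
    ultimately show "\<bar>joint_choice_prob E s b - joint_choice_prob E t b\<bar> \<le> \<eta> k"
      unfolding bs \<eta>_def
      by (intro order_trans[OF joint_choice_prob_diff[OF s t b[unfolded bs]]] add_mono sum_mono)
  qed
qed

lemma finite_joint_choices: "finite (joint_choices E)"
  unfolding joint_choices_def by (intro finite_cartesian_product finite_PiE) auto

lemma loop_step_in:
  assumes "(js, ls) \<in> joint_choices E" "z \<in> Loop"
  shows "loop_step E F C r js ls z \<in> Loop"
proof -
  obtain x xf xc where z: "z = (x, xf, xc)" by (rule prod_cases3)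
  have "trans_map E i (js i) (x i) \<in> agent_space E i" for i
    using trans_map_into[of "js i" i] joint_choicesD[OF assms(1)] assms(2) unfolding z loop_space_iff by blast
  then show ?thesis by (simp add: z loop_step_def loop_space_iff)
qed

definition choice_step :: "('i \<Rightarrow> nat) \<times> ('i \<Rightarrow> nat) \<Rightarrow> ('i, 'f, 'c) loop_state \<Rightarrow> ('i, 'f, 'c) loop_state" where
  "choice_step b z = (case b of (js, ls) \<Rightarrow> loop_step E F C r js ls z)"

definition choice_prob :: "('i \<Rightarrow> nat) \<times> ('i \<Rightarrow> nat) \<Rightarrow> ('i, 'f, 'c) loop_state \<Rightarrow> real" where
  "choice_prob b z = joint_choice_prob E (broadcast_signal F C r z) b"

lemma loop_kernel_eq:
  "loop_kernel E F C r = choice_kernel (restrict_space borel Loop) (joint_choices E) choice_prob choice_step"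
  by (simp add: fun_eq_iff loop_kernel_def choice_kernel_def choice_prob_def choice_step_def)

theorem loop_is_contractive_ifs:
  obtains d q \<epsilon> where "contractive_ifs Loop d (joint_choices E) choice_step choice_prob q \<epsilon>"
proof -
  obtain \<alpha> \<beta> q where \<alpha>: "0 < \<alpha>" and \<beta>: "0 < \<beta>" and q: "0 < q" "q < 1" and contract:
    "\<And>js ls z z'. \<lbrakk>(js, ls) \<in> joint_choices E; z \<in> Loop; z' \<in> Loop\<rbrakk>
      \<Longrightarrow> loop_dist E F C \<alpha> \<beta> (loop_step E F C r js ls z) (loop_step E F C r js ls z') \<le> q * loop_dist E F C \<alpha> \<beta> z z'"
    using loop_steps_contract by blast
  let ?d = "loop_dist E F C \<alpha> \<beta>"
  obtain L where L: "0 \<le> L" "\<And>z z'. \<bar>broadcast_signal F C r z - broadcast_signal F C r z'\<bar> \<le> L * ?d z z'"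
    using broadcast_lipschitz[OF \<alpha> \<beta>] by blast
  have "contractive_ifs Loop ?d (joint_choices E) choice_step choice_prob q (\<delta> ^ CARD('i) * \<delta>' ^ CARD('i))"
  proof
    show "Loop \<noteq> {}" by (rule loop_space_nonempty)
    show "closed Loop" by (rule closed_loop_space)
    show "?d x y = 0 \<longleftrightarrow> x = y" if "x \<in> Loop" "y \<in> Loop" for x y by (rule loop_dist_eq_0[OF \<alpha> \<beta> that])
    show "?d x y = ?d y x" for x y by (rule loop_dist_sym[OF \<alpha> \<beta>])
    show "?d x z \<le> ?d x y + ?d y z" for x y z by (rule loop_dist_triangle[OF \<alpha> \<beta>])
    show "continuous_on (Loop \<times> Loop) (\<lambda>(x, y). ?d x y)"
      by (rule continuous_on_subset[OF loop_dist_continuous[OF \<alpha> \<beta>] subset_UNIV])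
    show "compact {y \<in> Loop. ?d x y \<le> R}" if "x \<in> Loop" for x R by (rule loop_dist_proper[OF \<alpha> \<beta> that])
    show "finite (joint_choices E)" by (rule finite_joint_choices)
    show "choice_step j x \<in> Loop" if "j \<in> joint_choices E" "x \<in> Loop" for j x
      using that loop_step_in by (cases j) (simp add: choice_step_def)
    show "?d (choice_step j x) (choice_step j y) \<le> q * ?d x y"
      if "j \<in> joint_choices E" "x \<in> Loop" "y \<in> Loop" for j x y
      using that contract by (cases j) (simp add: choice_step_def)
    show "0 < \<delta> ^ CARD('i) * \<delta>' ^ CARD('i)" using delta_pos by simp
    show "\<delta> ^ CARD('i) * \<delta>' ^ CARD('i) \<le> choice_prob j x" if "j \<in> joint_choices E" "x \<in> Loop" for j x
      unfolding choice_prob_def by (rule joint_choice_prob_lower[OF broadcast_admissible[OF that(2)] that(1)])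
    show "(\<Sum>j\<in>joint_choices E. choice_prob j x) = 1" if "x \<in> Loop" for x
      unfolding choice_prob_def by (rule joint_choice_prob_sum[OF broadcast_admissible[OF that]])
    show "\<exists>\<eta>. summable \<eta> \<and> (\<forall>k. \<forall>x\<in>Loop. \<forall>y\<in>Loop. ?d x y \<le> R * q ^ k \<longrightarrow>
        (\<forall>j\<in>joint_choices E. \<bar>choice_prob j x - choice_prob j y\<bar> \<le> \<eta> k))" for R
    proof -
      obtain \<eta> where \<eta>: "summable \<eta>"
        "\<And>k s t b. \<lbrakk>s \<in> Pi_set; t \<in> Pi_set; \<bar>s - t\<bar> \<le> (L * R) * q ^ k; b \<in> joint_choices E\<rbrakk>
          \<Longrightarrow> \<bar>joint_choice_prob E s b - joint_choice_prob E t b\<bar> \<le> \<eta> k"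
        using joint_choice_prob_variation[OF q, of "L * R"] by blast
      have "\<bar>choice_prob j x - choice_prob j y\<bar> \<le> \<eta> k"
        if "x \<in> Loop" "y \<in> Loop" "?d x y \<le> R * q ^ k" "j \<in> joint_choices E" for x y k j
        unfolding choice_prob_def
      proof (rule \<eta>(2)[OF broadcast_admissible[OF that(1)] broadcast_admissible[OF that(2)] _ that(4)])
        have "L * ?d x y \<le> L * (R * q ^ k)" by (rule mult_left_mono[OF that(3) L(1)])
        then show "\<bar>broadcast_signal F C r x - broadcast_signal F C r y\<bar> \<le> (L * R) * q ^ k"
          using L(2)[of x y] by (simp add: mult.assoc)
      qed
      then show ?thesis using \<eta>(1) by blast
    qed
  qed (rule q)+
  then show ?thesis by (rule that)
qed

end

theorem theorem16:
  fixes E :: "'i::finite ensemble"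
    and F :: "'f::finite linear_filter"
    and C :: "'c::finite linear_controller"
    and r :: real
    and Pi_set :: "real set"
    and l l' :: "'i \<Rightarrow> nat \<Rightarrow> real"
    and \<delta> \<delta>' :: real
  assumes agent_space_closed:
      "\<And>i. closedin (Euclidean_space (state_dim E i)) (agent_space E i)"
    and agent_space_nonempty: "\<And>i. agent_space E i \<noteq> {}"
    and trans_map_into:
      "\<And>i j. j \<in> {1..trans_count E i} \<Longrightarrow> trans_map E i j \<in> agent_space E i \<rightarrow> agent_space E i"
    and trans_map_lipschitz:
      "\<And>i j. j \<in> {1..trans_count E i} \<Longrightarrow>
         lipschitz_map_on (state_dim E i) (l i j) (agent_space E i) (trans_map E i j)"
    and out_map_lipschitz:
      "\<And>i k. k \<in> {1..out_count E i} \<Longrightarrow>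
         lipschitz_fun_on (state_dim E i) (l' i k) (agent_space E i) (out_map E i k)"
    and trans_prob_range:
      "\<And>i j. j \<in> {1..trans_count E i} \<Longrightarrow> trans_prob E i j \<in> Pi_set \<rightarrow> {0..1}"
    and out_prob_range:
      "\<And>i k. k \<in> {1..out_count E i} \<Longrightarrow> out_prob E i k \<in> Pi_set \<rightarrow> {0..1}"
    and trans_prob_dini:
      "\<And>i j. j \<in> {1..trans_count E i} \<Longrightarrow> dini_continuous_on Pi_set (trans_prob E i j)"
    and out_prob_dini:
      "\<And>i k. k \<in> {1..out_count E i} \<Longrightarrow> dini_continuous_on Pi_set (out_prob E i k)"
    and trans_prob_sum:
      "\<And>i s. s \<in> Pi_set \<Longrightarrow> (\<Sum>j\<in>{1..trans_count E i}. trans_prob E i j s) = 1"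
    and out_prob_sum:
      "\<And>i s. s \<in> Pi_set \<Longrightarrow> (\<Sum>k\<in>{1..out_count E i}. out_prob E i k s) = 1"
    and delta_pos: "\<delta> > 0" "\<delta>' > 0"
    and trans_prob_lower:
      "\<And>i j s. j \<in> {1..trans_count E i} \<Longrightarrow> s \<in> Pi_set \<Longrightarrow> trans_prob E i j s \<ge> \<delta>"
    and out_prob_lower:
      "\<And>i k s. k \<in> {1..out_count E i} \<Longrightarrow> s \<in> Pi_set \<Longrightarrow> out_prob E i k s \<ge> \<delta>'"
    and contractive: "\<And>i j. j \<in> {1..trans_count E i} \<Longrightarrow> l i j < 1"
    and stable_controller: "schur (A_c C)"
    and stable_filter: "schur (A_f F)"
    and broadcast_admissible:
      "\<And>z :: ('i, 'f, 'c) loop_state. z \<in> loop_space E \<Longrightarrow> broadcast_signal F C r z \<in> Pi_set"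
  shows "(\<exists>!\<mu>. invariant_measure (restrict_space borel (loop_space E)) (loop_kernel E F C r) \<mu> \<and>
               attractive_measure (loop_space E) (loop_kernel E F C r) \<mu>) \<and>
         uniquely_ergodic (loop_space E) (loop_kernel E F C r)"
proof -
  interpret closed_loop E F C r Pi_set l l' \<delta> \<delta>'
    by (rule closed_loop.intro) (fact assms)+
  obtain d q \<epsilon> where "contractive_ifs Loop d (joint_choices E) choice_step choice_prob q \<epsilon>"
    by (rule loop_is_contractive_ifs)
  then interpret contractive_ifs Loop d "joint_choices E" choice_step choice_prob q \<epsilon> .
  show ?thesis unfolding loop_kernel_eq by (rule unique_ergodicity)
qed

end
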